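(* Let $\ell \geq 5$ be odd, and let $G$ be the random graph constructed below from $n$, with $p = n^{-1+\frac{1}{\ell-1}} \cdot n^{\varepsilon}(\log n)^{-1}$ where $\varepsilon = ((2\ell-3)(\ell-1))^{-1}$. Then with high probability (i.e. with probability tending to $1$ as $n\to\infty$), $G$ contains no cycle of length $\ell$, has at least $n/2$ vertices, and satisfies \[ \alpha(G) \leq 8p^{-1} (\log n)^{3}. \]
   Context: Fix an odd integer $\ell\ge 5$; $n\to\infty$. Set $p_c = n^{-1+\frac{1}{\ell-1}}$, $\varepsilon = ((2\ell-3)(\ell-1))^{-1}$, $p = p_c n^{\varepsilon}(\log n)^{-1}$, $r = (pn)^{1/2}(\log n)^{-3/2}$ and $k = 8p^{-1}(\log n)^3$ (rounding to integers is suppressed; $r$ divides $n$). The vertex set $[n]$ carries its natural order. Construction. Choose two independent uniformly random partitions $[n] = V_1 \cup \cdots \cup V_{n/r}$ (red partition) and $[n] = W_1 \cup \cdots \cup W_{n/r}$ (blue partition) into sets of size $r$. Independently sample $G^{\circ}_R, G^{\circ}_B \sim G(n/r,p)$ on vertex set $[n/r]$. Let $G'_R$ be the graph on $[n]$ in which $x\in V_i$, $y \in V_j$ are adjacent iff $ij \in G^\circ_R$ (the $r$-blow-up of $G^\circ_R$ along the red partition), and let $G'_B$ be the analogous blow-up of $G^\circ_B$ along $W_1,\dots,W_{n/r}$. Let $G' = G'_R\cup G'_B$; edges of $G'_R$ are called red and those of $G'_B$ blue. A graph $H$ on $[n]$ is simple if $|H \cap (V_i \times V_j)| \leq 1$ and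 $|H \cap (W_i \times W_j)| \leq 1$ for all $i<j$. A broken cycle of length $t$ is a sequence $x_1\ldots x_t$ of vertices such that for each $i$ (indices mod $t$) either $x_ix_{i+1}\in G'$ (an actual edge) or $x_ix_{i+1}\notin G'$ and $x_i,x_{i+1}$ lie in a common $V_j$ or a common $W_j$ (a broken edge); it is simple if its actual edges form a simple graph. Vertex deletion: $\widehat G$ is obtained from $G'$ by deleting all vertices of every simple broken cycle in $G'$ of length at most $\ell-1$ having an odd number of actual edges. Edge deletion: fix a red ordering of the edges of $K_n$ in which, for each $i<j$, the edges in $V_i\times V_j$ are consecutive, and a blue ordering in which the edges in $W_i\times W_j$ are consecutive. For a copy $C$ of $C_\ell$, since $\ell$ is odd there is a vertex whose two incident edges in $C$ have the same colour; the largest such vertex is the apex of $C$. For each copy $C$ of $C_\ell$ in $\widehat G$: if $C$ is not monochromatic and its apex is incident (in $C$) to two red edges (resp. two blue edges), delete the largest blue edge of $C$ in the blue ordering (resp. the largest red edge of $C$ in the red ordering); if $C$ is monochromatic, delete its largest edge in the ordering of its colour. The resulting graph is $G = G_R\cup G_B$ (its red and blue parts). $\alpha(G)$ denotes the independence number of $G$. *)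

theory Defs
  imports "HOL-Probability.Probability" "HOL-Library.Ramsey" "HOL-Library.Disjoint_Sets"
begin

text \<open>
  A graph is given by its vertex set and its edge set, a set of two-element sets of vertices.
  \<^term>\<open>indep\<close> and \<^term>\<open>nsets\<close> are those of \<^theory>\<open>HOL-Library.Ramsey\<close>.
\<close>

section \<open>Parameters\<close>

definition eps :: "nat \<Rightarrow> real" where
  "eps l = 1 / ((2 * real l - 3) * (real l - 1))"

definition edge_prob :: "nat \<Rightarrow> nat \<Rightarrow> real" where
  "edge_prob l n = real n powr (- 1 + 1 / (real l - 1)) * real n powr eps l / ln (real n)"

text \<open>The real number of which the part size \<open>r\<close> is a rounding.\<close>

definition part_size :: "nat \<Rightarrow> nat \<Rightarrow> real" where
  "part_size l n = (edge_prob l n * real n) powr (1/2) * ln (real n) powr (- 3/2)"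

section \<open>Cycles and independence number\<close>

text \<open>The edge of the cyclic sequence \<open>xs\<close> from position \<open>i\<close> to position \<open>i + 1\<close> (modulo the length).\<close>

definition cyc_edge :: "nat list \<Rightarrow> nat \<Rightarrow> nat set" where
  "cyc_edge xs i = {xs ! i, xs ! (Suc i mod length xs)}"

definition cyc_edges :: "nat list \<Rightarrow> nat set set" where
  "cyc_edges xs = cyc_edge xs ` {..<length xs}"

definition is_cycle :: "nat set set \<Rightarrow> nat list \<Rightarrow> bool" where
  "is_cycle E xs \<longleftrightarrow> 3 \<le> length xs \<and> distinct xs \<and> cyc_edges xs \<subseteq> E"

definition indep_number :: "nat set \<Rightarrow> nat set set \<Rightarrow> nat" where
  "indep_number X E = Max {card S | S. S \<subseteq> X \<and> indep S E}"

section \<open>Random partitions and blow-ups\<close>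

definition equipartitions :: "nat \<Rightarrow> nat \<Rightarrow> (nat \<Rightarrow> nat set) set" where
  "equipartitions n r = {V \<in> {1..n div r} \<rightarrow>\<^sub>E Pow {1..n}.
     disjoint_family_on V {1..n div r} \<and> (\<Union>j\<in>{1..n div r}. V j) = {1..n} \<and>
     (\<forall>j\<in>{1..n div r}. card (V j) = r)}"

text \<open>The edge set of the binomial random graph \<open>G(m, p)\<close> on the vertices \<open>1, \<dots>, m\<close>.\<close>

definition gnp :: "nat \<Rightarrow> real \<Rightarrow> nat set set pmf" where
  "gnp m p = map_pmf (\<lambda>b. {e \<in> nsets {1..m} 2. b e})
     (Pi_pmf (nsets {1..m} 2) False (\<lambda>_. bernoulli_pmf p))"

definition between :: "nat set \<Rightarrow> nat set \<Rightarrow> nat set set" where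
  "between A B = {{x, y} | x y. x \<in> A \<and> y \<in> B}"

definition blow_up :: "(nat \<Rightarrow> nat set) \<Rightarrow> nat set set \<Rightarrow> nat set set" where
  "blow_up V E = (\<Union>{between (V i) (V j) | i j. {i, j} \<in> E})"

section \<open>Vertex deletion\<close>

text \<open>In the following, \<open>m\<close> is the number of parts of each of the two partitions \<open>V\<close> and \<open>W\<close>.\<close>

definition simple_wrt ::
  "nat \<Rightarrow> (nat \<Rightarrow> nat set) \<Rightarrow> (nat \<Rightarrow> nat set) \<Rightarrow> nat set set \<Rightarrow> bool" where
  "simple_wrt m V W H \<longleftrightarrow> (\<forall>i\<in>{1..m}. \<forall>j\<in>{1..m}. i < j \<longrightarrow>
     card (H \<inter> between (V i) (V j)) \<le> 1 \<and> card (H \<inter> between (W i) (W j)) \<le> 1)"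

definition common_part ::
  "nat \<Rightarrow> (nat \<Rightarrow> nat set) \<Rightarrow> (nat \<Rightarrow> nat set) \<Rightarrow> nat \<Rightarrow> nat \<Rightarrow> bool" where
  "common_part m V W x y \<longleftrightarrow> (\<exists>j\<in>{1..m}. {x, y} \<subseteq> V j \<or> {x, y} \<subseteq> W j)"

text \<open>
  As for ordinary cycles, the vertices of a broken cycle are distinct. Lengths 1 and 2 need not
  be excluded: such a sequence has an even number of actual edges (counted by position), so it
  plays no role in the vertex deletion.
\<close>

definition broken_cycle ::
  "nat \<Rightarrow> nat \<Rightarrow> (nat \<Rightarrow> nat set) \<Rightarrow> (nat \<Rightarrow> nat set) \<Rightarrow> nat set set \<Rightarrow> nat list \<Rightarrow> bool" where
  "broken_cycle n m V W E xs \<longleftrightarrow> distinct xs \<and> set xs \<subseteq> {1..n} \<and>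
     (\<forall>i<length xs. cyc_edge xs i \<in> E \<or>
        cyc_edge xs i \<notin> E \<and> common_part m V W (xs ! i) (xs ! (Suc i mod length xs)))"

definition surviving ::
  "nat \<Rightarrow> nat \<Rightarrow> nat \<Rightarrow> (nat \<Rightarrow> nat set) \<Rightarrow> (nat \<Rightarrow> nat set) \<Rightarrow> nat set set \<Rightarrow> nat set" where
  "surviving l n m V W E = {1..n} - \<Union>{set xs | xs.
     broken_cycle n m V W E xs \<and> simple_wrt m V W (cyc_edges xs \<inter> E) \<and>
     length xs \<le> l - 1 \<and> odd (card {i. i < length xs \<and> cyc_edge xs i \<in> E})}"

section \<open>Edge deletion\<close>

text \<open>
  A linear order \<open>L\<close> of the edges of the complete graph on \<open>1, \<dots>, n\<close> (with \<open>(e, f) \<in> L\<close> meaning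
  that \<open>e\<close> is at most \<open>f\<close>) in which the edges between any two parts of \<open>V\<close> are consecutive.
\<close>

definition block_ordering :: "nat \<Rightarrow> nat \<Rightarrow> (nat \<Rightarrow> nat set) \<Rightarrow> nat set rel \<Rightarrow> bool" where
  "block_ordering n m V L \<longleftrightarrow> linear_order_on (nsets {1..n} 2) L \<and>
     (\<forall>i\<in>{1..m}. \<forall>j\<in>{1..m}. i < j \<longrightarrow>
        (\<forall>e\<in>between (V i) (V j). \<forall>g\<in>between (V i) (V j). \<forall>f.
           (e, f) \<in> L \<and> (f, g) \<in> L \<longrightarrow> f \<in> between (V i) (V j)))"

definition largest_edge :: "nat set rel \<Rightarrow> nat set set \<Rightarrow> nat set \<Rightarrow> bool" where
  "largest_edge L S e \<longleftrightarrow> e \<in> S \<and> (\<forall>f\<in>S. (f, e) \<in> L)"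

definition incident :: "nat set set \<Rightarrow> nat \<Rightarrow> nat set set" where
  "incident C v = {e \<in> C. v \<in> e}"

text \<open>
  Here \<open>R\<close> and \<open>B\<close> are the sets of red and of blue edges and \<open>C\<close> is the edge set of a cycle.
  \<open>R\<close> and \<open>B\<close> may overlap: an edge lying in both blow-ups is both red and blue, and two edges
  have the same colour if both are red or both are blue.
\<close>

definition apex :: "nat set set \<Rightarrow> nat set set \<Rightarrow> nat set set \<Rightarrow> nat" where
  "apex R B C = Max {v \<in> \<Union>C. incident C v \<subseteq> R \<or> incident C v \<subseteq> B}"

text \<open>The edges deleted from the graph with edge set \<open>E\<close> on account of the copies of \<open>C\<^sub>l\<close> in it.\<close>

definition deleted_edges ::
  "nat \<Rightarrow> nat set rel \<Rightarrow> nat set rel \<Rightarrow> nat set set \<Rightarrow> nat set set \<Rightarrow> nat set set \<Rightarrow> nat set set" where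
  "deleted_edges l LR LB R B E = {e. \<exists>xs C. length xs = l \<and> is_cycle E xs \<and> C = cyc_edges xs \<and>
     (\<not> C \<subseteq> R \<and> \<not> C \<subseteq> B \<and> incident C (apex R B C) \<subseteq> R \<and> largest_edge LB (C \<inter> B) e \<or>
      \<not> C \<subseteq> R \<and> \<not> C \<subseteq> B \<and> incident C (apex R B C) \<subseteq> B \<and> largest_edge LR (C \<inter> R) e \<or>
      C \<subseteq> R \<and> largest_edge LR C e \<or>
      C \<subseteq> B \<and> largest_edge LB C e)}"

section \<open>The random graph\<close>

text \<open>The graph determined by the partitions and by the red and blue edge sets before deletions.\<close>

definition final_graph ::
  "nat \<Rightarrow> nat \<Rightarrow> nat \<Rightarrow> nat set rel \<Rightarrow> nat set rel \<Rightarrow> (nat \<Rightarrow> nat set) \<Rightarrow> (nat \<Rightarrow> nat set) \<Rightarrow>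
   nat set set \<Rightarrow> nat set set \<Rightarrow> nat set \<times> nat set set" where
  "final_graph l n m LR LB V W R B =
     (let X = surviving l n m V W (R \<union> B);
          E = (R \<union> B) \<inter> nsets X 2
      in (X, E - deleted_edges l LR LB R B E))"

text \<open>
  \<open>LR\<close> and \<open>LB\<close> assign the red and the blue edge ordering to the red and the blue partition.
\<close>

definition random_graph ::
  "nat \<Rightarrow> nat \<Rightarrow> nat \<Rightarrow> ((nat \<Rightarrow> nat set) \<Rightarrow> nat set rel) \<Rightarrow> ((nat \<Rightarrow> nat set) \<Rightarrow> nat set rel) \<Rightarrow>
   (nat set \<times> nat set set) pmf" where
  "random_graph l n r LR LB =
     map_pmf (\<lambda>((V, W), (ER, EB)).
         final_graph l n (n div r) (LR V) (LB W) V W (blow_up V ER) (blow_up W EB))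
       (pair_pmf
         (pair_pmf (pmf_of_set (equipartitions n r)) (pmf_of_set (equipartitions n r)))
         (pair_pmf (gnp (n div r) (edge_prob l n)) (gnp (n div r) (edge_prob l n))))"

end

theory Submission
  imports Defs "HOL-Real_Asymp.Real_Asymp"
begin

text \<open>
  Every cycle of length \<open>l\<close> loses an edge by construction, and a first moment bound on the short
  simple odd broken cycles shows that few vertices are deleted. The point is the independence number.
  With high probability every set with \<open>4 / p * (ln n) ^ 3\<close> vertices meets \<open>8 / p * (ln n)\<^sup>2\<close> parts of one
  of the two partitions, say the red one, and so contains a transversal \<open>S\<close> of that size.

  Reveal the blue graph and both partitions first, and then the red blocks in the red ordering. Call a
  pair of \<open>S\<close> open if it is not blue and the graph revealed before its block has fewer than \<open>r\<close> walks of
  length \<open>l - 1\<close> between its ends. Suppose that a red edge, not also blue, is deleted because of a cycle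
  \<open>C\<close>. It is then the largest red edge of \<open>C\<close>, and some vertex of the path \<open>C - e\<close> has two incident edges
  of one colour on this path: the apex if \<open>C\<close> is not monochromatic, any inner vertex otherwise. Moving
  that vertex within its part gives \<open>r\<close> walks, so the pair was not open. For this the red edges of
  \<open>C - e\<close> must lie in blocks other than that of \<open>e\<close>. They do, because a chord inside a part would split
  \<open>C\<close> into a shorter odd broken cycle, and the vertex deletion leaves such a cycle only close to the few
  vertices with a neighbour in their own part.

  The reduced graphs are pseudo-random, which bounds the number of walks and leaves at least a quarter of
  \<open>(card S)\<^sup>2\<close> pairs open. Whether a pair is open is decided before its block is revealed; hence no open
  pair is an edge with probability at most \<open>(1 - p) ^ ((card S)\<^sup>2 / 4)\<close>, which beats the number of choices
  of \<open>S\<close>.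
\<close>

text \<open>The exponent \<open>eps\<close> comes from one balance, up to powers of
  \<open>ln n\<close>. With parts of size \<open>r\<close> about \<open>sqrt (n * p)\<close>, the
  typical number \<open>p * (n * p) ^ (l - 2)\<close> of walks of length \<open>l - 1\<close>
  between two vertices is about \<open>r\<close>; equivalently, the expected number
  \<open>(n * p) ^ (l - 2) * r\<close> of broken cycles of length \<open>l - 1\<close> with a single
  broken edge is about \<open>n\<close>. The logarithms in \<open>p\<close> and in the part size
  push both quantities below their thresholds.

  One blow-up alone would fail: an independent set of the reduced graph becomes \<open>r\<close>
  times larger in it. The second, independent partition scatters every union of few parts of the
  first. Taking \<open>S\<close> transversal gives each pair of \<open>S\<close> a coin of its own.

  The set \<open>S\<close> is chosen after the graph, so the walks inside it have to be bounded for
  all \<open>S\<close> at once. Hence the walk bound is a deterministic consequence of the edge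
  densities between all pairs of vertex sets of the reduced graphs.\<close>

section \<open>Product distributions, tails for the binomial random graph, and adaptively revealed
  coins\<close>

lemma prob_pair_pmf_le:
  assumes "\<And>a. a \<in> set_pmf A \<Longrightarrow> measure_pmf.prob B {b. Q a b} \<le> c"
  shows "measure_pmf.prob (pair_pmf A B) {(a, b). Q a b} \<le> c"
proof -
  \<comment> \<open>The support of \<open>A\<close> is nonempty, so \<open>c\<close> bounds some
    probability and is nonnegative; this allows the passage from \<open>ennreal\<close> back to the
    reals.\<close>
  obtain a where "a \<in> set_pmf A" using set_pmf_not_empty by fast
  from assms[OF this] have c: "0 \<le> c" by (meson measure_nonneg order_trans)
  have "emeasure (pair_pmf A B) {(a, b). Q a b} = (\<integral>\<^sup>+x. indicator {(a, b). Q a b} x \<partial>pair_pmf A B)"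
    by simp
  also have "\<dots> = (\<integral>\<^sup>+a. \<integral>\<^sup>+b. indicator {b. Q a b} b \<partial>B \<partial>A)"
    unfolding nn_integral_pair_pmf' by (auto intro!: nn_integral_cong simp: indicator_def)
  also have "\<dots> \<le> (\<integral>\<^sup>+a. ennreal c \<partial>A)"
    using assms by (intro nn_integral_mono_AE) (auto simp: AE_measure_pmf_iff measure_pmf.emeasure_eq_measure intro!: ennreal_leI)
  also have "\<dots> = ennreal c" by simp
  finally show ?thesis using c by (simp add: measure_pmf.emeasure_eq_measure)
qed

text \<open>Needed to condition on the second factor, as when the blue graph is revealed before the
  red one.\<close>

lemma prob_pair_pmf_swap:
  "measure_pmf.prob (pair_pmf A B) {(a, b). Q a b} = measure_pmf.prob (pair_pmf B A) {(b, a). Q a b}"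
  by (subst pair_commute_pmf) (auto simp: vimage_def intro!: arg_cong[where f="measure_pmf.prob _"])

lemma prob_pair_pmf_fst:
  "measure_pmf.prob (pair_pmf A B) {(a, b). Q a} = measure_pmf.prob A {a. Q a}"
proof -
  have "measure_pmf.prob A {a. Q a} = measure_pmf.prob (map_pmf fst (pair_pmf A B)) {a. Q a}"
    by (simp add: map_fst_pair_pmf)
  also have "\<dots> = measure_pmf.prob (pair_pmf A B) {(a, b). Q a}"
    by (auto simp: vimage_def intro!: arg_cong[where f="measure_pmf.prob _"])
  finally show ?thesis by simp
qed

lemma prob_pair_pmf_snd:
  "measure_pmf.prob (pair_pmf A B) {(a, b). Q b} = measure_pmf.prob B {b. Q b}"
  using prob_pair_pmf_swap[of A B "\<lambda>a b. Q b"] prob_pair_pmf_fst[of B A Q] by simp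

lemma prob_UN_le:
  fixes c :: real
  assumes "finite T" "\<And>t. t \<in> T \<Longrightarrow> measure_pmf.prob M {x. Q t x} \<le> f t"
  shows "measure_pmf.prob M {x. \<exists>t\<in>T. Q t x} \<le> sum f T"
proof -
  have "measure_pmf.prob M (\<Union>t\<in>T. {x. Q t x}) \<le> (\<Sum>t\<in>T. measure_pmf.prob M {x. Q t x})"
    using assms by (intro measure_pmf.finite_measure_subadditive_finite) auto
  also have "\<dots> \<le> sum f T" using assms by (intro sum_mono) auto
  also have "(\<Union>t\<in>T. {x. Q t x}) = {x. \<exists>t\<in>T. Q t x}" by auto
  finally show ?thesis .
qed

lemma set_pmf_gnp: "set_pmf (gnp m p) \<subseteq> Pow (nsets {1..m} 2)"
  by (auto simp: gnp_def)

lemma prob_gnp_supset: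
  assumes "F \<subseteq> nsets {1..m} 2" "0 \<le> p" "p \<le> 1"
  shows "measure_pmf.prob (gnp m p) {E. F \<subseteq> E} = p ^ card F"
proof -
  let ?N = "nsets {1..m} (2::nat)"
  have fin: "finite ?N" by (rule finite_imp_finite_nsets) simp
  have "measure_pmf.prob (gnp m p) {E. F \<subseteq> E} =
      measure_pmf.prob (Pi_pmf ?N False (\<lambda>_. bernoulli_pmf p)) {b. F \<subseteq> {e \<in> ?N. b e}}"
    by (simp add: gnp_def vimage_def)
  also have "{b. F \<subseteq> {e \<in> ?N. b e}} = Pi ?N (\<lambda>e. if e \<in> F then {True} else UNIV)"
    using assms(1) by (auto simp: Pi_def split: if_splits)
  also have "measure_pmf.prob (Pi_pmf ?N False (\<lambda>_. bernoulli_pmf p)) \<dots> =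
     (\<Prod>e\<in>?N. measure_pmf.prob (bernoulli_pmf p) (if e \<in> F then {True} else UNIV))"
    using fin by (rule measure_Pi_pmf_Pi)
  also have "\<dots> = (\<Prod>e\<in>?N. if e \<in> F then p else 1)"
    using assms by (intro prod.cong) (auto simp: measure_pmf_single)
  also have "\<dots> = (\<Prod>e\<in>?N \<inter> F. p)"
    using fin by (simp add: prod.If_cases)
  also have "\<dots> = p ^ card F" using assms(1) by (simp add: Int_absorb1)
  finally show ?thesis .
qed

text \<open>The quotient \<open>q ^ q / fact q\<close> is a single term of the series of
  \<open>exp q\<close>.\<close>

lemma power_le_exp_fact: "real q ^ q \<le> exp (real q) * fact q"
proof -
  have "real q ^ q / fact q \<le> exp (real q)"
    using exp_bound_lemma sum_le_suminf[of "\<lambda>n. real q ^ n /\<^sub>R fact n" "{q}"] summable_exp_generic[of "real q"]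
    by (auto simp: exp_def field_simps)
  then show ?thesis by (simp add: field_simps)
qed

lemma binomial_le_exp_power:
  "q > 0 \<Longrightarrow> real (n choose q) \<le> (exp 1 * real n / real q) ^ q"
proof -
  assume q: "q > 0"
  have "real (n choose q) * fact q \<le> real n ^ q"
    using binomial_fact_pow[of n q] by (metis of_nat_fact of_nat_le_iff of_nat_mult of_nat_power)
  then have "real (n choose q) \<le> real n ^ q / fact q" by (simp add: field_simps)
  also have "\<dots> \<le> real n ^ q * exp (real q) / real q ^ q"
    using mult_left_mono[OF power_le_exp_fact[of q], of "real n ^ q"] q by (simp add: field_simps)
  also have "\<dots> = (exp 1 * real n / real q) ^ q"
    by (simp add: power_mult_distrib power_divide flip: exp_of_nat_mult)
  finally show ?thesis .
qed

text \<open>Union bound over the \<open>q\<close>-subsets of \<open>F\<close>, each of which is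
  present with probability \<open>p ^ q\<close>.\<close>

lemma prob_gnp_many_edges:
  assumes "F \<subseteq> nsets {1..m} 2" "0 \<le> p" "p \<le> 1" "q > 0"
  shows "measure_pmf.prob (gnp m p) {E. q \<le> card (F \<inter> E)} \<le> (exp 1 * real (card F) * p / real q) ^ q"
proof -
  have fin: "finite F" using assms(1) finite_imp_finite_nsets[of "{1..m}"] finite_subset by blast
  have "measure_pmf.prob (gnp m p) {E. q \<le> card (F \<inter> E)} \<le>
     measure_pmf.prob (gnp m p) {E. \<exists>T\<in>nsets F q. T \<subseteq> E}"
  proof (rule measure_pmf.finite_measure_mono)
    show "{E. q \<le> card (F \<inter> E)} \<subseteq> {E. \<exists>T\<in>nsets F q. T \<subseteq> E}"
    proof clarify
      fix E assume "q \<le> card (F \<inter> E)"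
      then obtain T where "T \<subseteq> F \<inter> E" "card T = q" "finite T" using obtain_subset_with_card_n by metis
      then show "\<exists>T\<in>nsets F q. T \<subseteq> E" by (auto simp: nsets_def)
    qed
  qed simp
  also have "\<dots> \<le> (\<Sum>T\<in>nsets F q. p ^ q)"
    using assms fin by (intro prob_UN_le finite_imp_finite_nsets order.refl)
      (auto simp: nsets_def intro!: prob_gnp_supset[THEN order.trans[OF eq_refl]])
  also have "\<dots> = real (card F choose q) * p ^ q" by (simp add: card_nsets)
  also have "\<dots> \<le> (exp 1 * real (card F) / real q) ^ q * p ^ q"
    using assms by (intro mult_right_mono binomial_le_exp_power) auto
  also have "\<dots> = (exp 1 * real (card F) * p / real q) ^ q" by (simp flip: power_mult_distrib)
  finally show ?thesis .
qed

lemma nn_integral_pmf_swap: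
  "(\<integral>\<^sup>+a. \<integral>\<^sup>+b. f a b \<partial>measure_pmf B \<partial>measure_pmf A) = (\<integral>\<^sup>+b. \<integral>\<^sup>+a. f a b \<partial>measure_pmf A \<partial>measure_pmf B)"
proof -
  have "(\<integral>\<^sup>+a. \<integral>\<^sup>+b. f a b \<partial>measure_pmf B \<partial>measure_pmf A) = (\<integral>\<^sup>+x. f (fst x) (snd x) \<partial>pair_pmf A B)"
    by (simp add: nn_integral_pair_pmf')
  also have "\<dots> = (\<integral>\<^sup>+x. f (snd x) (fst x) \<partial>pair_pmf B A)"
    by (subst pair_commute_pmf) (simp add: case_prod_unfold)
  also have "\<dots> = (\<integral>\<^sup>+b. \<integral>\<^sup>+a. f a b \<partial>measure_pmf A \<partial>measure_pmf B)"
    by (simp add: nn_integral_pair_pmf')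
  finally show ?thesis .
qed

text \<open>
  The product is a martingale in the order in which the coordinates are revealed: a coordinate
  contributes to it only if its openness, which is decided by the earlier coordinates, holds.
\<close>

lemma nn_integral_adaptive_product:
  fixes rk :: "'a \<Rightarrow> 'b::linorder" and opn :: "'a \<Rightarrow> ('a \<Rightarrow> bool) \<Rightarrow> bool"
  assumes "finite F" "T \<subseteq> F" "inj_on rk F" "0 \<le> p" "p < 1"
    and "\<And>f b b'. f \<in> T \<Longrightarrow> (\<And>g. g \<in> F \<Longrightarrow> rk g < rk f \<Longrightarrow> b g = b' g) \<Longrightarrow> opn f b = opn f b'"
  shows "(\<integral>\<^sup>+b. (\<Prod>f\<in>T. if opn f b then if b f then 0 else ennreal (1 / (1 - p)) else 1)
      \<partial>Pi_pmf F False (\<lambda>_. bernoulli_pmf p)) = 1"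
  using assms
proof (induction "card F" arbitrary: F T)
  case 0
  then have "T = {}" using 0(1-3) by simp
  then show ?case by simp
next
  case (Suc k)
  let ?w = "\<lambda>f b. if opn f b then if b f then 0 else ennreal (1 / (1 - p)) else 1"
  have ne: "F \<noteq> {}" using Suc.hyps(2) by auto
  have "\<exists>t\<in>F. \<forall>g\<in>F. rk g \<le> rk t"
  proof -
    have "Max (rk ` F) \<in> rk ` F" using Suc.prems(1) ne by (intro Max_in) auto
    then obtain t where "t \<in> F" "rk t = Max (rk ` F)" by auto
    then show ?thesis using Suc.prems(1) by (intro bexI[of _ t]) auto
  qed
  then obtain t where t: "t \<in> F" "\<And>g. g \<in> F \<Longrightarrow> rk g \<le> rk t" by auto
  have lt: "rk g < rk t" if "g \<in> F - {t}" for g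
    using t that Suc.prems(3) by (metis DiffD1 DiffD2 inj_onD insertI1 order_le_less)
  \<comment> \<open>The coordinate \<open>t\<close> is revealed last. No openness depends on it, so
    it is integrated out first while the other factors of the product stay constant.\<close>
  define F' where "F' = F - {t}"
  define T' where "T' = T - {t}"
  have F: "F = insert t F'" "t \<notin> F'" "finite F'" using t Suc.prems(1) by (auto simp: F'_def)
  have T': "T' \<subseteq> F'" using Suc.prems(2) by (auto simp: T'_def F'_def)
  \<comment> \<open>This includes \<open>f = t\<close>: openness looks only at strictly smaller
    ranks.\<close>
  have opT': "opn f (b(t := y)) = opn f b" if "f \<in> T" for f b y
    by (rule Suc.prems(6)[OF that]) (use t(2) Suc.prems(2) that in \<open>force simp: not_less\<close>)
  have prod': "(\<Prod>f\<in>T'. ?w f (b(t := y))) = (\<Prod>f\<in>T'. ?w f b)" for b y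
    by (intro prod.cong) (auto simp: T'_def opT')
  have fT: "finite T" using Suc.prems(1,2) finite_subset by blast
  \<comment> \<open>If \<open>t\<close> is open, its factor averages to
    \<open>(1 - p) * (1 / (1 - p)) = 1\<close>; otherwise it is constantly 1.\<close>
  have inner: "(\<integral>\<^sup>+y. (\<Prod>f\<in>T. ?w f (b(t := y))) \<partial>bernoulli_pmf p) = (\<Prod>f\<in>T'. ?w f b)" for b
  proof (cases "t \<in> T")
    case True
    then have T: "T = insert t T'" "t \<notin> T'" "finite T'" using fT by (auto simp: T'_def)
    have "(\<integral>\<^sup>+y. ?w t (b(t := y)) \<partial>bernoulli_pmf p) = 1"
    proof (cases "opn t b")
      case op: True
      have "(\<integral>\<^sup>+y. ?w t (b(t := y)) \<partial>bernoulli_pmf p) =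
         (\<integral>\<^sup>+y. (if y then 0 else ennreal (1 / (1 - p))) \<partial>bernoulli_pmf p)"
        using op True by (intro nn_integral_cong) (auto simp: opT')
      also have "\<dots> = ennreal (1 / (1 - p)) * ennreal (1 - p)"
        using Suc.prems(4,5) by simp
      also have "\<dots> = 1" using Suc.prems(5) by (simp flip: ennreal_mult add: ennreal_1[symmetric] del: ennreal_1)
      finally show ?thesis .
    next
      case False
      then show ?thesis using True by (simp add: opT')
    qed
    moreover have "(\<Prod>f\<in>T. ?w f (b(t := y))) = (\<Prod>f\<in>T'. ?w f b) * ?w t (b(t := y))" for y
      unfolding T(1) using T by (simp add: prod' mult.commute)
    ultimately show ?thesis by (simp add: nn_integral_cmult)
  next
    case False
    then have "T = T'" by (auto simp: T'_def)
    then show ?thesis by (simp add: prod')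
  qed
  have "(\<integral>\<^sup>+b. (\<Prod>f\<in>T. ?w f b) \<partial>Pi_pmf F False (\<lambda>_. bernoulli_pmf p)) =
     (\<integral>\<^sup>+y. (\<integral>\<^sup>+b. (\<Prod>f\<in>T. ?w f (b(t := y))) \<partial>Pi_pmf F' False (\<lambda>_. bernoulli_pmf p)) \<partial>bernoulli_pmf p)"
    using F by (simp add: Pi_pmf_insert nn_integral_pair_pmf' cong: if_cong)
  also have "\<dots> = (\<integral>\<^sup>+b. (\<integral>\<^sup>+y. (\<Prod>f\<in>T. ?w f (b(t := y))) \<partial>bernoulli_pmf p) \<partial>Pi_pmf F' False (\<lambda>_. bernoulli_pmf p))"
    by (rule nn_integral_pmf_swap)
  also have "\<dots> = (\<integral>\<^sup>+b. (\<Prod>f\<in>T'. ?w f b) \<partial>Pi_pmf F' False (\<lambda>_. bernoulli_pmf p))"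
    by (simp only: inner)
  also have "\<dots> = 1"
  proof (rule Suc.hyps(1))
    show "k = card F'" using Suc.hyps(2) F by simp
    show "inj_on rk F'" using Suc.prems(3) F(1) by auto
    fix f and b b' :: "'a \<Rightarrow> bool" assume f: "f \<in> T'" and eq: "\<And>g. g \<in> F' \<Longrightarrow> rk g < rk f \<Longrightarrow> b g = b' g"
    show "opn f b = opn f b'"
    proof (rule Suc.prems(6))
      show "f \<in> T" using f by (simp add: T'_def)
      fix g assume g: "g \<in> F" "rk g < rk f"
      have "rk f \<le> rk t" using f T' F(1) t(2) by blast
      then have "g \<in> F'" using g by (auto simp: F'_def)
      from eq[OF this g(2)] show "b g = b' g" .
    qed
  qed (use F T' Suc.prems(4,5) in auto)
  finally show ?case .
qed

text \<open>On this event the product of \<open>nn_integral_adaptive_product\<close> is at least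
  \<open>(1 / (1 - p)) ^ M\<close>, while its integral is 1; Markov's inequality gives the bound.
  The number of open coordinates may itself be random.\<close>

lemma prob_adaptive_avoid:
  fixes rk :: "'a \<Rightarrow> 'b::linorder" and opn :: "'a \<Rightarrow> ('a \<Rightarrow> bool) \<Rightarrow> bool"
  assumes "finite F" "T \<subseteq> F" "inj_on rk F" "0 \<le> p" "p < 1"
    and "\<And>f b b'. f \<in> T \<Longrightarrow> (\<And>g. g \<in> F \<Longrightarrow> rk g < rk f \<Longrightarrow> b g = b' g) \<Longrightarrow> opn f b = opn f b'"
  shows "measure_pmf.prob (Pi_pmf F False (\<lambda>_. bernoulli_pmf p))
     {b. (\<forall>f\<in>T. opn f b \<longrightarrow> \<not> b f) \<and> M \<le> card {f \<in> T. opn f b}} \<le> (1 - p) ^ M"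
proof -
  let ?P = "Pi_pmf F False (\<lambda>_. bernoulli_pmf p)"
  let ?E = "{b. (\<forall>f\<in>T. opn f b \<longrightarrow> \<not> b f) \<and> M \<le> card {f \<in> T. opn f b}}"
  let ?w = "\<lambda>f b. if opn f b then if b f then 0 else ennreal (1 / (1 - p)) else 1"
  have fT: "finite T" using assms(1,2) finite_subset by blast
  have "ennreal ((1 / (1 - p)) ^ M) * indicator ?E b \<le> (\<Prod>f\<in>T. ?w f b)" for b
  proof (cases "b \<in> ?E")
    case True
    have "(\<Prod>f\<in>T. ?w f b) = (\<Prod>f\<in>T. if opn f b then ennreal (1 / (1 - p)) else 1)"
      using True by (intro prod.cong) auto
    also have "\<dots> = ennreal (1 / (1 - p)) ^ card {f \<in> T. opn f b}"
      using fT by (simp add: prod.If_cases Int_def)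
    also have "\<dots> = ennreal ((1 / (1 - p)) ^ card {f \<in> T. opn f b})"
      using assms(4,5) by (simp add: ennreal_power)
    finally have "(\<Prod>f\<in>T. ?w f b) = ennreal ((1 / (1 - p)) ^ card {f \<in> T. opn f b})" .
    moreover have "(1 / (1 - p)) ^ M \<le> (1 / (1 - p)) ^ card {f \<in> T. opn f b}"
      using assms(4,5) True by (intro power_increasing) auto
    ultimately show ?thesis using True by (simp add: ennreal_leI)
  qed simp
  then have "(\<integral>\<^sup>+b. ennreal ((1 / (1 - p)) ^ M) * indicator ?E b \<partial>?P) \<le> (\<integral>\<^sup>+b. (\<Prod>f\<in>T. ?w f b) \<partial>?P)"
    by (rule nn_integral_mono)
  also have "\<dots> = 1" by (rule nn_integral_adaptive_product[OF assms(1-5)]) (rule assms(6))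
  finally have "ennreal ((1 / (1 - p)) ^ M * measure_pmf.prob ?P ?E) \<le> 1"
    using assms(4,5) by (simp add: nn_integral_cmult measure_pmf.emeasure_eq_measure ennreal_mult)
  then have "(1 / (1 - p)) ^ M * measure_pmf.prob ?P ?E \<le> 1" by simp
  then show ?thesis using assms(4,5) by (simp add: field_simps power_divide)
qed

section \<open>Counting walks in blow-ups of sparse graphs\<close>

definition deg_in :: "nat set set \<Rightarrow> nat set \<Rightarrow> nat \<Rightarrow> nat" where
  "deg_in E G i = card {j \<in> G. {i, j} \<in> E}"

text \<open>A one-sided density condition. The first alternative is a constant times the expected
  number of edges. The second covers sets so small that a union bound over all pairs
  \<open>(H, G)\<close> only allows deviations proportional to the number of vertices
  chosen.\<close>

definition pseudo_random :: "nat \<Rightarrow> real \<Rightarrow> real \<Rightarrow> real \<Rightarrow> nat set set \<Rightarrow> bool" where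
  "pseudo_random m p D lam E \<longleftrightarrow> E \<subseteq> nsets {1..m} 2 \<and>
     (\<forall>i\<in>{1..m}. real (deg_in E {1..m} i) \<le> D) \<and>
     (\<forall>H G. H \<subseteq> {1..m} \<and> G \<subseteq> {1..m} \<longrightarrow>
        real (card (E \<inter> between H G)) \<le> max (8 * p * real (card H) * real (card G)) (lam * real (max (card H) (card G))))"

lemma deg_in_mono: "finite G' \<Longrightarrow> G \<subseteq> G' \<Longrightarrow> deg_in E G i \<le> deg_in E G' i"
  unfolding deg_in_def by (rule card_mono) auto

lemma deg_in_eq_sum: "finite G \<Longrightarrow> deg_in E G i = (\<Sum>j\<in>G. if {i, j} \<in> E then 1 else 0)"
  unfolding deg_in_def by (simp add: sum.If_cases Int_def)

lemma sum_deg_in_swap: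
  assumes "finite H" "finite G"
  shows "(\<Sum>i\<in>H. deg_in E G i) = (\<Sum>j\<in>G. deg_in E H j)"
  unfolding deg_in_eq_sum[OF assms(1)] deg_in_eq_sum[OF assms(2)]
  by (subst sum.swap) (simp add: insert_commute)

text \<open>The factor 2 is due to edges with both ends in \<open>H\<close> and in \<open>G\<close>,
  which are counted from each end.\<close>

lemma sum_deg_in_le:
  assumes "finite H" "finite G"
  shows "(\<Sum>i\<in>H. deg_in E G i) \<le> 2 * card (E \<inter> between H G)"
proof -
  let ?P = "SIGMA i:H. {j \<in> G. {i, j} \<in> E}"
  let ?f = "\<lambda>(i, j). {i, j} :: nat set"
  have fP: "finite ?P" using assms by auto
  have fb: "finite (between H G)"
  proof -
    have "between H G = ?f ` (H \<times> G)" by (auto simp: between_def image_iff)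
    then show ?thesis using assms by simp
  qed
  have "(\<Sum>i\<in>H. deg_in E G i) = card ?P"
    unfolding deg_in_def using assms by (subst card_SigmaI) auto
  also have "?P \<subseteq> (\<Union>e\<in>E \<inter> between H G. {x \<in> ?P. ?f x = e})"
    by (auto simp: between_def)
  then have "card ?P \<le> card (\<Union>e\<in>E \<inter> between H G. {x \<in> ?P. ?f x = e})"
    using fb fP by (intro card_mono finite_UN_I) (auto intro: finite_subset[OF _ fP])
  also have "\<dots> \<le> (\<Sum>e\<in>E \<inter> between H G. card {x \<in> ?P. ?f x = e})"
    using fb by (intro card_UN_le) auto
  also have "\<dots> \<le> (\<Sum>e\<in>E \<inter> between H G. 2)"
  proof (rule sum_mono)
    fix e assume "e \<in> E \<inter> between H G"
    then obtain a b where e: "e = {a, b}" by (auto simp: between_def)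
    have "{x \<in> ?P. ?f x = e} \<subseteq> {(a, b), (b, a)}" unfolding e by (clarsimp simp: doubleton_eq_iff)
    then have "card {x \<in> ?P. ?f x = e} \<le> card {(a, b), (b, a)}" by (rule card_mono[rotated]) simp
    also have "\<dots> \<le> 2" by (cases "a = b") auto
    finally show "card {x \<in> ?P. ?f x = e} \<le> 2" .
  qed
  finally show ?thesis by simp
qed

text \<open>
  Vertices with far more neighbours in \<open>G\<close> than expected are too few to matter: the density
  condition, applied to them and \<open>G\<close>, bounds the number of edges they send to \<open>G\<close>.
\<close>

lemma pseudo_random_set_step:
  assumes pr: "pseudo_random m p D lam E" and G: "G \<subseteq> {1..m}" and "0 \<le> p" "0 \<le> lam"
  obtains h :: "nat \<Rightarrow> real" where "\<And>i. 0 \<le> h i"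
    "\<And>i. i \<in> {1..m} \<Longrightarrow> real (deg_in E G i) \<le> 16 * p * real (card G) + h i"
    "(\<Sum>i\<in>{1..m}. (h i)\<^sup>2) \<le> 4 * lam * D * real (card G)"
proof -
  \<comment> \<open>The threshold is twice \<open>8 * p * card G + lam\<close> because
    \<open>sum_deg_in_le\<close> loses a factor 2. If \<open>H\<close> is nonempty, its edges to
    \<open>G\<close> then exceed both \<open>8 * p * card H * card G\<close> and
    \<open>lam * card H\<close>, so only the bound \<open>lam * card G\<close> can hold.\<close>
  define H where "H = {i \<in> {1..m}. real (deg_in E G i) > 16 * p * real (card G) + 2 * lam}"
  define h where "h = (\<lambda>i. if i \<in> H then real (deg_in E G i) else min (2 * lam) (real (deg_in E G i)))"
  have fG: "finite G" using finite_subset[OF G] by simp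
  have H: "H \<subseteq> {1..m}" "finite H" by (auto simp: H_def)
  have D: "real (deg_in E G i) \<le> D" if "i \<in> {1..m}" for i
  proof -
    have "real (deg_in E G i) \<le> real (deg_in E {1..m} i)" using deg_in_mono[OF _ G, of E i] by simp
    also have "\<dots> \<le> D" using pr that unfolding pseudo_random_def by blast
    finally show ?thesis .
  qed
  have D0: "0 \<le> D" if "G \<noteq> {}"
  proof -
    from that G obtain i where "i \<in> {1..m}" by blast
    then show ?thesis using D[of i] by linarith
  qed
  have h0: "0 \<le> h i" for i using assms(4) by (simp add: h_def)
  have h1: "real (deg_in E G i) \<le> 16 * p * real (card G) + h i" if "i \<in> {1..m}" for i
    using that assms(3,4) by (cases "i \<in> H") (auto simp: h_def H_def min_def)
  have h2: "(\<Sum>i\<in>{1..m}. (h i)\<^sup>2) \<le> 4 * lam * D * real (card G)"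
  proof (cases "G = {}")
    case True
    then have "deg_in E G i = 0" for i by (simp add: deg_in_def)
    then have "h i = 0" for i using assms(4) by (auto simp: h_def)
    then show ?thesis using True by simp
  next
    case False
    have e: "(\<Sum>i\<in>H. real (deg_in E G i)) \<le> 2 * lam * real (card G)"
    proof (cases "H = {}")
      case True
      then show ?thesis using assms(4) by simp
    next
      case ne: False
      have "(\<Sum>i\<in>H. 16 * p * real (card G) + 2 * lam) < (\<Sum>i\<in>H. real (deg_in E G i))"
        using ne H by (intro sum_strict_mono) (auto simp: H_def)
      also have le: "\<dots> \<le> 2 * real (card (E \<inter> between H G))"
        using sum_deg_in_le[of H G E] H fG by (simp flip: of_nat_sum)
      finally have lt: "real (card H) * (16 * p * real (card G) + 2 * lam) < 2 * real (card (E \<inter> between H G))"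
        by simp
      have mx: "real (card (E \<inter> between H G)) \<le>
          max (8 * p * real (card H) * real (card G)) (lam * real (max (card H) (card G)))"
        using pr H G unfolding pseudo_random_def by blast
      have lt': "8 * p * real (card H) * real (card G) + lam * real (card H) < real (card (E \<inter> between H G))"
        using lt by (simp add: algebra_simps)
      have nn: "0 \<le> lam * real (card H)" "0 \<le> 8 * p * real (card H) * real (card G)"
        using assms(3,4) by simp_all
      then have "real (card (E \<inter> between H G)) \<le> lam * real (max (card H) (card G))"
        using mx lt' by linarith
      then have "real (card (E \<inter> between H G)) \<le> lam * real (card G)"
        using nn lt' by (cases "card H \<le> card G") (simp_all add: max_def)
      then show ?thesis using le by simp
    qed
    \<comment> \<open>One factor of the square is bounded by its maximum, \<open>D\<close> on
      \<open>H\<close> and \<open>2 * lam\<close> off \<open>H\<close>; the other is at most the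
      degree, whose sum is under control.\<close>
    have "(h i)\<^sup>2 \<le> (if i \<in> H then D * real (deg_in E G i) else 0) + 2 * lam * real (deg_in E G i)"
      if i: "i \<in> {1..m}" for i
    proof (cases "i \<in> H")
      case True
      then show ?thesis using D[OF i] assms(4)
        by (auto simp: h_def power2_eq_square intro!: mult_right_mono add_increasing2)
    next
      case False
      then show ?thesis using h0[of i] assms(4)
        by (auto simp: h_def power2_eq_square intro!: mult_mono)
    qed
    then have "(\<Sum>i\<in>{1..m}. (h i)\<^sup>2) \<le>
       (\<Sum>i\<in>{1..m}. (if i \<in> H then D * real (deg_in E G i) else 0) + 2 * lam * real (deg_in E G i))"
      by (intro sum_mono) auto
    also have "\<dots> = D * (\<Sum>i\<in>H. real (deg_in E G i)) + 2 * lam * (\<Sum>i\<in>{1..m}. real (deg_in E G i))"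
      using H by (simp add: sum.distrib sum_distrib_left sum.If_cases Int_absorb1)
    also have "(\<Sum>i\<in>{1..m}. real (deg_in E G i)) = (\<Sum>j\<in>G. real (deg_in E {1..m} j))"
      using sum_deg_in_swap[of "{1..m}" G E] fG by (simp flip: of_nat_sum)
    also have "\<dots> \<le> (\<Sum>j\<in>G. D)"
      using pr G unfolding pseudo_random_def by (intro sum_mono) auto
    finally have "(\<Sum>i\<in>{1..m}. (h i)\<^sup>2) \<le>
        D * (\<Sum>i\<in>H. real (deg_in E G i)) + 2 * lam * (real (card G) * D)"
      using assms(4) by (auto simp: mult_left_mono)
    also have "\<dots> \<le> D * (2 * lam * real (card G)) + 2 * lam * (real (card G) * D)"
      using e D0[OF False] by (intro add_right_mono mult_left_mono) auto
    finally show ?thesis by (simp add: algebra_simps)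
  qed
  show ?thesis by (rule that[of h]) (use h0 h1 h2 in auto)
qed

lemma level_set_sum:
  fixes g :: nat
  assumes "g \<le> M"
  shows "(\<Sum>t\<in>{1..M}. if t \<le> g then 1 else 0) = g" "(\<Sum>t\<in>{1..M}. if t \<le> g then t else 0) \<le> g\<^sup>2"
proof -
  have eq: "{Suc 0..M} \<inter> {t. t \<le> g} = {Suc 0..g}" using assms by auto
  show "(\<Sum>t\<in>{1..M}. if t \<le> g then 1 else 0) = g" by (simp add: sum.If_cases eq)
  have "(\<Sum>t\<in>{Suc 0..g}. t) \<le> (\<Sum>t\<in>{Suc 0..g}. g)" by (intro sum_mono) auto
  then show "(\<Sum>t\<in>{1..M}. if t \<le> g then t else 0) \<le> g\<^sup>2"
    by (simp add: sum.If_cases eq power2_eq_square)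
qed

text \<open>
  Decomposing \<open>g\<close> into its level sets costs only a harmonic sum, by Cauchy--Schwarz with
  weights \<open>1 / t\<close> and \<open>t\<close>.
\<close>

lemma pseudo_random_fun_step:
  fixes g :: "nat \<Rightarrow> nat"
  assumes pr: "pseudo_random m p D lam E" and "0 \<le> p" "0 \<le> lam" and D: "0 \<le> D"
    and M: "\<And>j. j \<in> {1..m} \<Longrightarrow> g j \<le> M"
  obtains h :: "nat \<Rightarrow> real" where "\<And>i. 0 \<le> h i"
    "\<And>i. i \<in> {1..m} \<Longrightarrow> real (\<Sum>j\<in>{j \<in> {1..m}. {i, j} \<in> E}. g j) \<le> 16 * p * (\<Sum>j\<in>{1..m}. real (g j)) + h i"
    "(\<Sum>i\<in>{1..m}. (h i)\<^sup>2) \<le> 4 * lam * D * harm M * (\<Sum>j\<in>{1..m}. (real (g j))\<^sup>2)"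
proof -
  let ?I = "{1..m}"
  define G where "G = (\<lambda>t. {j \<in> ?I. t \<le> g j})"
  have "\<exists>h::nat \<Rightarrow> real. (\<forall>i. 0 \<le> h i) \<and>
     (\<forall>i\<in>?I. real (deg_in E (G t) i) \<le> 16 * p * real (card (G t)) + h i) \<and>
     (\<Sum>i\<in>?I. (h i)\<^sup>2) \<le> 4 * lam * D * real (card (G t))" for t
  proof -
    have "G t \<subseteq> ?I" by (auto simp: G_def)
    from pseudo_random_set_step[OF pr this assms(2,3)] obtain h :: "nat \<Rightarrow> real" where "\<And>i. 0 \<le> h i"
      "\<And>i. i \<in> ?I \<Longrightarrow> real (deg_in E (G t) i) \<le> 16 * p * real (card (G t)) + h i"
      "(\<Sum>i\<in>?I. (h i)\<^sup>2) \<le> 4 * lam * D * real (card (G t))" by blast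
    then show ?thesis by blast
  qed
  then obtain ht :: "nat \<Rightarrow> nat \<Rightarrow> real" where ht: "\<And>t i. 0 \<le> ht t i"
     "\<And>t i. i \<in> ?I \<Longrightarrow> real (deg_in E (G t) i) \<le> 16 * p * real (card (G t)) + ht t i"
     "\<And>t. (\<Sum>i\<in>?I. (ht t i)\<^sup>2) \<le> 4 * lam * D * real (card (G t))"
    by metis
  define h where "h = (\<lambda>i. \<Sum>t\<in>{1..M}. ht t i)"
  have lv: "(\<Sum>t\<in>{1..M}. if t \<le> g j then 1 else 0) = g j" if "j \<in> ?I" for j
    by (rule level_set_sum(1)[OF M[OF that]])
  have cardG: "card (G t) = (\<Sum>j\<in>?I. if t \<le> g j then 1 else 0)" for t
    by (simp add: G_def sum.If_cases Int_def)
  have sumG: "(\<Sum>t\<in>{1..M}. real (card (G t))) = (\<Sum>j\<in>?I. real (g j))"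
  proof -
    have "(\<Sum>t\<in>{1..M}. card (G t)) = (\<Sum>j\<in>?I. g j)"
      unfolding cardG by (subst sum.swap) (intro sum.cong refl lv)
    then show ?thesis by (simp flip: of_nat_sum)
  qed
  show ?thesis
  proof (rule that[of h])
    show "0 \<le> h i" for i by (auto simp: h_def ht sum_nonneg)
    fix i assume i: "i \<in> ?I"
    have "(\<Sum>j\<in>{j \<in> ?I. {i, j} \<in> E}. g j) = (\<Sum>j\<in>{j \<in> ?I. {i, j} \<in> E}. \<Sum>t\<in>{1..M}. if t \<le> g j then 1 else 0)"
      by (intro sum.cong refl lv[symmetric]) simp
    also have "\<dots> = (\<Sum>t\<in>{1..M}. deg_in E (G t) i)"
      by (subst sum.swap) (auto intro!: sum.cong arg_cong[where f=card] simp: deg_in_def G_def sum.If_cases Int_def)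
    finally have "real (\<Sum>j\<in>{j \<in> ?I. {i, j} \<in> E}. g j) = (\<Sum>t\<in>{1..M}. real (deg_in E (G t) i))" by simp
    also have "\<dots> \<le> (\<Sum>t\<in>{1..M}. 16 * p * real (card (G t)) + ht t i)"
      using ht(2)[OF i] by (intro sum_mono) auto
    also have "\<dots> = 16 * p * (\<Sum>j\<in>?I. real (g j)) + h i"
      unfolding sum.distrib h_def sum_distrib_left[symmetric] sumG ..
    finally show "real (\<Sum>j\<in>{j \<in> ?I. {i, j} \<in> E}. g j) \<le> 16 * p * (\<Sum>j\<in>?I. real (g j)) + h i" .
  next
    have "(h i)\<^sup>2 \<le> harm M * (\<Sum>t\<in>{1..M}. real t * (ht t i)\<^sup>2)" for i
    proof -
      have "h i = (\<Sum>t\<in>{1..M}. (1 / sqrt (real t)) * (sqrt (real t) * ht t i))"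
        unfolding h_def by (intro sum.cong) auto
      then have "(h i)\<^sup>2 \<le> (\<Sum>t\<in>{1..M}. (1 / sqrt (real t))\<^sup>2) * (\<Sum>t\<in>{1..M}. (sqrt (real t) * ht t i)\<^sup>2)"
        by (simp only: Cauchy_Schwarz_ineq_sum)
      then show ?thesis by (simp add: harm_def power_mult_distrib power_divide inverse_eq_divide)
    qed
    then have "(\<Sum>i\<in>?I. (h i)\<^sup>2) \<le> (\<Sum>i\<in>?I. harm M * (\<Sum>t\<in>{1..M}. real t * (ht t i)\<^sup>2))"
      by (intro sum_mono) auto
    also have "\<dots> = harm M * (\<Sum>t\<in>{1..M}. real t * (\<Sum>i\<in>?I. (ht t i)\<^sup>2))"
      by (subst sum_distrib_left[symmetric], subst sum.swap) (simp add: sum_distrib_left)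
    also have "\<dots> \<le> harm M * (\<Sum>t\<in>{1..M}. real t * (4 * lam * D * real (card (G t))))"
      using ht(3) by (intro mult_left_mono sum_mono) (auto simp: harm_nonneg)
    also have "(\<Sum>t\<in>{1..M}. real t * (4 * lam * D * real (card (G t)))) =
        4 * lam * D * real (\<Sum>t\<in>{1..M}. t * card (G t))"
      by (simp add: sum_distrib_left mult_ac)
    also have "(\<Sum>t\<in>{1..M}. t * card (G t)) = (\<Sum>j\<in>?I. \<Sum>t\<in>{1..M}. if t \<le> g j then t else 0)"
      unfolding cardG sum_distrib_left by (subst sum.swap) (auto intro!: sum.cong)
    also have "harm M * (4 * lam * D * real (\<Sum>j\<in>?I. \<Sum>t\<in>{1..M}. if t \<le> g j then t else 0)) \<le>
       harm M * (4 * lam * D * real (\<Sum>j\<in>?I. (g j)\<^sup>2))"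
      using assms by (intro mult_left_mono of_nat_mono sum_mono level_set_sum(2)) (auto simp: harm_nonneg)
    finally show "(\<Sum>i\<in>?I. (h i)\<^sup>2) \<le> 4 * lam * D * harm M * (\<Sum>j\<in>?I. (real (g j))\<^sup>2)"
      by (simp add: mult_ac)
  qed
qed

section \<open>Blow-ups along an equipartition and their adjacency operators\<close>

lemma equipartitionsD:
  assumes "V \<in> equipartitions n r"
  shows "\<And>i. i \<in> {1..n div r} \<Longrightarrow> V i \<subseteq> {1..n}" "\<And>i. i \<in> {1..n div r} \<Longrightarrow> card (V i) = r"
    "\<And>i. i \<in> {1..n div r} \<Longrightarrow> finite (V i)" "disjoint_family_on V {1..n div r}"
    "(\<Union>j\<in>{1..n div r}. V j) = {1..n}"
    "\<And>i j x. i \<in> {1..n div r} \<Longrightarrow> j \<in> {1..n div r} \<Longrightarrow> x \<in> V i \<Longrightarrow> x \<in> V j \<Longrightarrow> i = j"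
    "\<And>x. x \<in> {1..n} \<Longrightarrow> \<exists>i\<in>{1..n div r}. x \<in> V i"
proof -
  show 1: "\<And>i. i \<in> {1..n div r} \<Longrightarrow> V i \<subseteq> {1..n}" using assms by (auto simp: equipartitions_def)
  show "\<And>i. i \<in> {1..n div r} \<Longrightarrow> card (V i) = r" using assms by (auto simp: equipartitions_def)
  show 2: "disjoint_family_on V {1..n div r}" using assms by (auto simp: equipartitions_def)
  show 3: "(\<Union>j\<in>{1..n div r}. V j) = {1..n}" using assms by (simp add: equipartitions_def)
  show "\<And>i j x. i \<in> {1..n div r} \<Longrightarrow> j \<in> {1..n div r} \<Longrightarrow> x \<in> V i \<Longrightarrow> x \<in> V j \<Longrightarrow> i = j"
    using 2 by (meson disjoint_family_onD disjoint_iff)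
  show "\<And>x. x \<in> {1..n} \<Longrightarrow> \<exists>i\<in>{1..n div r}. x \<in> V i"
    using 3 by blast
  show "\<And>i. i \<in> {1..n div r} \<Longrightarrow> finite (V i)" using 1 finite_subset by blast
qed

lemma blow_up_iff:
  assumes V: "V \<in> equipartitions n r" and E: "E \<subseteq> nsets {1..n div r} 2"
    and "i \<in> {1..n div r}" "j \<in> {1..n div r}" "x \<in> V i" "y \<in> V j"
  shows "{x, y} \<in> blow_up V E \<longleftrightarrow> {i, j} \<in> E"
proof
  assume "{x, y} \<in> blow_up V E"
  then obtain i' j' x' y' where *: "{i', j'} \<in> E" "{x, y} = {x', y'}" "x' \<in> V i'" "y' \<in> V j'"
    by (auto simp: blow_up_def between_def)
  have ij: "i' \<in> {1..n div r}" "j' \<in> {1..n div r}" using *(1) E by (auto simp: nsets_def)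
  from *(2) consider "x = x'" "y = y'" | "x = y'" "y = x'" by (auto simp: doubleton_eq_iff)
  then show "{i, j} \<in> E"
  proof cases
    case 1
    then have "i = i'" "j = j'"
      using equipartitionsD(6)[OF V assms(3) ij(1) assms(5)] equipartitionsD(6)[OF V assms(4) ij(2) assms(6)] *(3,4) by auto
    then show ?thesis using *(1) by simp
  next
    case 2
    then have "i = j'" "j = i'"
      using equipartitionsD(6)[OF V assms(3) ij(2) assms(5)] equipartitionsD(6)[OF V assms(4) ij(1) assms(6)] *(3,4) by auto
    then show ?thesis using *(1) by (simp add: insert_commute)
  qed
next
  assume "{i, j} \<in> E"
  then show "{x, y} \<in> blow_up V E" using assms by (auto simp: blow_up_def between_def)
qed

lemma sum_equipartition:
  assumes "V \<in> equipartitions n r"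
  shows "(\<Sum>x\<in>{1..n}. f x) = (\<Sum>i\<in>{1..n div r}. \<Sum>x\<in>V i. f x)"
  using equipartitionsD(3,4,5)[OF assms] sum.UNION_disjoint[of "{1..n div r}" V f]
  by (auto simp: disjoint_family_on_def)

text \<open>The adjacency operator of the graph on \<open>A\<close>. It acts on functions with
  natural values so that \<open>pseudo_random_fun_step\<close> can slice them into integer level
  sets.\<close>

definition adj_sum :: "nat set \<Rightarrow> nat set set \<Rightarrow> (nat \<Rightarrow> nat) \<Rightarrow> nat \<Rightarrow> nat" where
  "adj_sum A E f v = (\<Sum>w\<in>{w \<in> A. {v, w} \<in> E}. f w)"

lemma adj_sum_mono:
  assumes "finite A" "E \<subseteq> E'" "\<And>w. w \<in> A \<Longrightarrow> f w \<le> f' w"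
  shows "adj_sum A E f v \<le> adj_sum A E' f' v"
proof -
  have "adj_sum A E f v \<le> (\<Sum>w\<in>{w \<in> A. {v, w} \<in> E}. f' w)"
    unfolding adj_sum_def using assms by (intro sum_mono) auto
  also have "\<dots> \<le> adj_sum A E' f' v"
    unfolding adj_sum_def using assms by (intro sum_mono2) auto
  finally show ?thesis .
qed

lemma adj_sum_Un_le:
  assumes "finite A"
  shows "adj_sum A (R \<union> B) f v \<le> adj_sum A R f v + adj_sum A B f v"
proof -
  have "{w \<in> A. {v, w} \<in> R \<union> B} = {w \<in> A. {v, w} \<in> R} \<union> {w \<in> A. {v, w} \<in> B}" by auto
  then show ?thesis unfolding adj_sum_def using assms
    by (simp add: sum_Un_nat)
qed

lemma neighbours_blow_up:
  assumes V: "V \<in> equipartitions n r" and E: "E \<subseteq> nsets {1..n div r} 2"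
    and i: "i \<in> {1..n div r}" "v \<in> V i"
  shows "{w \<in> {1..n}. {v, w} \<in> blow_up V E} = (\<Union>j\<in>{j \<in> {1..n div r}. {i, j} \<in> E}. V j)"
proof (intro equalityI subsetI)
  fix w assume w: "w \<in> {w \<in> {1..n}. {v, w} \<in> blow_up V E}"
  then obtain j where "j \<in> {1..n div r}" "w \<in> V j" using equipartitionsD(7)[OF V] by blast
  then show "w \<in> (\<Union>j\<in>{j \<in> {1..n div r}. {i, j} \<in> E}. V j)"
    using w blow_up_iff[OF V E i(1) _ i(2)] by blast
next
  fix w assume "w \<in> (\<Union>j\<in>{j \<in> {1..n div r}. {i, j} \<in> E}. V j)"
  then show "w \<in> {w \<in> {1..n}. {v, w} \<in> blow_up V E}"
    using blow_up_iff[OF V E i(1) _ i(2)] equipartitionsD(1)[OF V] by blast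
qed

lemma adj_sum_blow_up:
  assumes V: "V \<in> equipartitions n r" and E: "E \<subseteq> nsets {1..n div r} 2"
    and i: "i \<in> {1..n div r}" "v \<in> V i"
  shows "adj_sum {1..n} (blow_up V E) g v = (\<Sum>j\<in>{j \<in> {1..n div r}. {i, j} \<in> E}. \<Sum>w\<in>V j. g w)"
  unfolding adj_sum_def neighbours_blow_up[OF assms]
  using equipartitionsD(3,4)[OF V]
  by (intro sum.UNION_disjoint) (auto simp: disjoint_family_on_def)

lemma card_neighbours_blow_up:
  assumes V: "V \<in> equipartitions n r" and E: "E \<subseteq> nsets {1..n div r} 2"
    and i: "i \<in> {1..n div r}" "v \<in> V i"
  shows "card {w \<in> {1..n}. {v, w} \<in> blow_up V E} = r * deg_in E {1..n div r} i"
proof -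
  have "card {w \<in> {1..n}. {v, w} \<in> blow_up V E} = adj_sum {1..n} (blow_up V E) (\<lambda>_. 1) v"
    by (simp add: adj_sum_def)
  also have "\<dots> = (\<Sum>j\<in>{j \<in> {1..n div r}. {i, j} \<in> E}. card (V j))"
    using adj_sum_blow_up[OF assms, of "\<lambda>_. 1"] by simp
  also have "\<dots> = (\<Sum>j\<in>{j \<in> {1..n div r}. {i, j} \<in> E}. r)"
    using equipartitionsD(2)[OF V] by (intro sum.cong) auto
  finally show ?thesis by (simp add: deg_in_def)
qed

text \<open>The step for the reduced graph is applied to the sums of \<open>g\<close> over the
  parts. One factor \<open>r\<close> comes from Cauchy-Schwarz inside a part, the other from the
  remainder being constant on the \<open>r\<close> vertices of a part.\<close>

lemma blow_up_fun_step:
  fixes g :: "nat \<Rightarrow> nat"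
  assumes V: "V \<in> equipartitions n r" and pr: "pseudo_random (n div r) p D lam E"
    and "0 \<le> p" "0 \<le> lam" "0 \<le> D"
    and M: "(\<Sum>v\<in>{1..n}. g v) \<le> M"
  obtains h :: "nat \<Rightarrow> real" where "\<And>v. v \<in> {1..n} \<Longrightarrow> 0 \<le> h v"
    "\<And>v. v \<in> {1..n} \<Longrightarrow> real (adj_sum {1..n} (blow_up V E) g v) \<le> 16 * p * (\<Sum>w\<in>{1..n}. real (g w)) + h v"
    "(\<Sum>v\<in>{1..n}. (h v)\<^sup>2) \<le> 4 * lam * D * harm M * (real r)\<^sup>2 * (\<Sum>w\<in>{1..n}. (real (g w))\<^sup>2)"
proof -
  let ?I = "{1..n div r}"
  have E: "E \<subseteq> nsets ?I 2" using pr by (simp add: pseudo_random_def)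
  define gg where "gg = (\<lambda>j. \<Sum>w\<in>V j. g w)"
  have sgg: "(\<Sum>w\<in>{1..n}. g w) = (\<Sum>j\<in>?I. gg j)" unfolding gg_def by (rule sum_equipartition[OF V])
  have ggM: "gg j \<le> M" if "j \<in> ?I" for j
    using member_le_sum[of j ?I gg] that M sgg by simp
  obtain h :: "nat \<Rightarrow> real" where h: "\<And>i. 0 \<le> h i"
    "\<And>i. i \<in> ?I \<Longrightarrow> real (\<Sum>j\<in>{j \<in> ?I. {i, j} \<in> E}. gg j) \<le> 16 * p * (\<Sum>j\<in>?I. real (gg j)) + h i"
    "(\<Sum>i\<in>?I. (h i)\<^sup>2) \<le> 4 * lam * D * harm M * (\<Sum>j\<in>?I. (real (gg j))\<^sup>2)"
    by (rule pseudo_random_fun_step[OF pr assms(3-5), of gg M]) (erule ggM, rule that)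
  define pt where "pt = (\<lambda>v. SOME i. i \<in> ?I \<and> v \<in> V i)"
  have pt: "pt v \<in> ?I" "v \<in> V (pt v)" if "v \<in> {1..n}" for v
    using someI_ex[of "\<lambda>i. i \<in> ?I \<and> v \<in> V i"] equipartitionsD(7)[OF V that] unfolding pt_def by blast+
  have pt_eq: "pt v = i" if "i \<in> ?I" "v \<in> V i" for v i
  proof -
    have v: "v \<in> {1..n}" using that equipartitionsD(1)[OF V] by blast
    show ?thesis by (rule equipartitionsD(6)[OF V pt(1)[OF v] that(1) pt(2)[OF v] that(2)])
  qed
  show ?thesis
  proof (rule that[of "\<lambda>v. h (pt v)"])
    fix v assume v: "v \<in> {1..n}"
    have "adj_sum {1..n} (blow_up V E) g v = (\<Sum>j\<in>{j \<in> ?I. {pt v, j} \<in> E}. gg j)"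
      unfolding gg_def by (rule adj_sum_blow_up[OF V E pt[OF v]])
    then show "real (adj_sum {1..n} (blow_up V E) g v) \<le> 16 * p * (\<Sum>w\<in>{1..n}. real (g w)) + h (pt v)"
      using h(2)[OF pt(1)[OF v]] sgg by (simp flip: of_nat_sum)
  next
    have gg2: "(real (gg j))\<^sup>2 \<le> real r * (\<Sum>w\<in>V j. (real (g w))\<^sup>2)" if "j \<in> ?I" for j
      using sum_squared_le_sum_of_squares[of "\<lambda>w. real (g w)" "V j"] equipartitionsD(2)[OF V that]
      by (simp add: gg_def mult.commute)
    have "(\<Sum>v\<in>{1..n}. (h (pt v))\<^sup>2) = (\<Sum>i\<in>?I. \<Sum>v\<in>V i. (h (pt v))\<^sup>2)"
      by (rule sum_equipartition[OF V])
    also have "\<dots> = (\<Sum>i\<in>?I. real r * (h i)\<^sup>2)"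
      using equipartitionsD(2)[OF V] by (intro sum.cong refl) (simp add: pt_eq)
    also have "\<dots> \<le> real r * (4 * lam * D * harm M * (\<Sum>j\<in>?I. (real (gg j))\<^sup>2))"
      using h(3) by (simp add: mult_left_mono flip: sum_distrib_left)
    also have "\<dots> \<le> real r * (4 * lam * D * harm M * (\<Sum>j\<in>?I. real r * (\<Sum>w\<in>V j. (real (g w))\<^sup>2)))"
      using gg2 assms by (intro mult_left_mono sum_mono) (auto simp: harm_nonneg)
    also have "\<dots> = 4 * lam * D * harm M * (real r)\<^sup>2 * (\<Sum>w\<in>{1..n}. (real (g w))\<^sup>2)"
      unfolding sum_equipartition[OF V, of "\<lambda>w. (real (g w))\<^sup>2"]
      by (simp add: power2_eq_square mult_ac flip: sum_distrib_left)
    finally show "(\<Sum>v\<in>{1..n}. (h (pt v))\<^sup>2) \<le>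
        4 * lam * D * harm M * (real r)\<^sup>2 * (\<Sum>w\<in>{1..n}. (real (g w))\<^sup>2)" .
  qed (use h in auto)
qed

lemma two_blow_ups_fun_step:
  fixes g :: "nat \<Rightarrow> nat"
  assumes V: "V \<in> equipartitions n r" and prR: "pseudo_random (n div r) p D lam ER"
    and W: "W \<in> equipartitions n r" and prB: "pseudo_random (n div r) p D lam EB"
    and nn: "0 \<le> p" "0 \<le> lam" "0 \<le> D"
    and M: "(\<Sum>v\<in>{1..n}. g v) \<le> M"
  obtains h :: "nat \<Rightarrow> real" where "\<And>v. v \<in> {1..n} \<Longrightarrow> 0 \<le> h v"
    "\<And>v. v \<in> {1..n} \<Longrightarrow> real (adj_sum {1..n} (blow_up V ER \<union> blow_up W EB) g v) \<le> 32 * p * (\<Sum>w\<in>{1..n}. real (g w)) + h v"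
    "(\<Sum>v\<in>{1..n}. (h v)\<^sup>2) \<le> 16 * lam * D * harm M * (real r)\<^sup>2 * (\<Sum>w\<in>{1..n}. (real (g w))\<^sup>2)"
proof -
  obtain h1 :: "nat \<Rightarrow> real" where h1: "\<And>v. v \<in> {1..n} \<Longrightarrow> 0 \<le> h1 v"
    "\<And>v. v \<in> {1..n} \<Longrightarrow> real (adj_sum {1..n} (blow_up V ER) g v) \<le> 16 * p * (\<Sum>w\<in>{1..n}. real (g w)) + h1 v"
    "(\<Sum>v\<in>{1..n}. (h1 v)\<^sup>2) \<le> 4 * lam * D * harm M * (real r)\<^sup>2 * (\<Sum>w\<in>{1..n}. (real (g w))\<^sup>2)"
    by (rule blow_up_fun_step[OF V prR nn M]) (rule that)
  obtain h2 :: "nat \<Rightarrow> real" where h2: "\<And>v. v \<in> {1..n} \<Longrightarrow> 0 \<le> h2 v"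
    "\<And>v. v \<in> {1..n} \<Longrightarrow> real (adj_sum {1..n} (blow_up W EB) g v) \<le> 16 * p * (\<Sum>w\<in>{1..n}. real (g w)) + h2 v"
    "(\<Sum>v\<in>{1..n}. (h2 v)\<^sup>2) \<le> 4 * lam * D * harm M * (real r)\<^sup>2 * (\<Sum>w\<in>{1..n}. (real (g w))\<^sup>2)"
    by (rule blow_up_fun_step[OF W prB nn M]) (rule that)
  show ?thesis
  proof (rule that[of "\<lambda>v. h1 v + h2 v"])
    fix v assume v: "v \<in> {1..n}"
    show "0 \<le> h1 v + h2 v" using h1(1) h2(1) v by simp
    have "real (adj_sum {1..n} (blow_up V ER \<union> blow_up W EB) g v) \<le>
       real (adj_sum {1..n} (blow_up V ER) g v) + real (adj_sum {1..n} (blow_up W EB) g v)"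
      using adj_sum_Un_le[of "{1..n}"] by (metis finite_atLeastAtMost of_nat_add of_nat_mono)
    then show "real (adj_sum {1..n} (blow_up V ER \<union> blow_up W EB) g v) \<le>
        32 * p * (\<Sum>w\<in>{1..n}. real (g w)) + (h1 v + h2 v)"
      using h1(2)[OF v] h2(2)[OF v] by simp
  next
    have "(h1 v + h2 v)\<^sup>2 \<le> 2 * (h1 v)\<^sup>2 + 2 * (h2 v)\<^sup>2" for v
      using sum_squares_bound[of "h1 v" "h2 v"] by (simp add: power2_sum)
    then have "(\<Sum>v\<in>{1..n}. (h1 v + h2 v)\<^sup>2) \<le> (\<Sum>v\<in>{1..n}. 2 * (h1 v)\<^sup>2 + 2 * (h2 v)\<^sup>2)"
      by (intro sum_mono)
    also have "\<dots> = 2 * (\<Sum>v\<in>{1..n}. (h1 v)\<^sup>2) + 2 * (\<Sum>v\<in>{1..n}. (h2 v)\<^sup>2)"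
      by (simp add: sum.distrib sum_distrib_left)
    finally show "(\<Sum>v\<in>{1..n}. (h1 v + h2 v)\<^sup>2) \<le>
        16 * lam * D * harm M * (real r)\<^sup>2 * (\<Sum>w\<in>{1..n}. (real (g w))\<^sup>2)"
      using h1(3) h2(3) by simp
  qed
qed

section \<open>Walk counts as iterates of the adjacency operator\<close>

text \<open>The number of walks of length \<open>j\<close> from the last argument to
  \<open>S\<close>. Walks may repeat vertices, which makes the count an iterate of a linear
  operator.\<close>

definition walks :: "nat set \<Rightarrow> nat set set \<Rightarrow> nat \<Rightarrow> nat set \<Rightarrow> nat \<Rightarrow> nat" where
  "walks A E j S = (adj_sum A E ^^ j) (indicator S)"

lemma walks_0: "walks A E 0 S = indicator S"
  by (simp add: walks_def)

lemma walks_Suc: "walks A E (Suc j) S = adj_sum A E (walks A E j S)"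
  by (simp add: walks_def)

lemma sum_adj_sum_le:
  assumes "finite A" "\<And>v. v \<in> A \<Longrightarrow> real (card {w \<in> A. {v, w} \<in> E}) \<le> D"
  shows "(\<Sum>v\<in>A. real (adj_sum A E g v)) \<le> D * (\<Sum>v\<in>A. real (g v))"
proof -
  have "(\<Sum>v\<in>A. adj_sum A E g v) = (\<Sum>v\<in>A. \<Sum>w\<in>A. if {v, w} \<in> E then g w else 0)"
    using assms(1) by (simp add: adj_sum_def sum.If_cases Int_def)
  also have "\<dots> = (\<Sum>w\<in>A. \<Sum>v\<in>A. if {v, w} \<in> E then g w else 0)" by (rule sum.swap)
  also have "\<dots> = (\<Sum>w\<in>A. card {v \<in> A. {w, v} \<in> E} * g w)"
    using assms(1) by (simp add: sum.If_cases Int_def insert_commute)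
  finally have "(\<Sum>v\<in>A. real (adj_sum A E g v)) = (\<Sum>w\<in>A. real (card {v \<in> A. {w, v} \<in> E}) * real (g w))"
    by (simp flip: of_nat_sum of_nat_mult)
  also have "\<dots> \<le> (\<Sum>w\<in>A. D * real (g w))"
    using assms by (intro sum_mono mult_right_mono) auto
  finally show ?thesis by (simp add: sum_distrib_left)
qed

lemma sum_walks_le:
  assumes "finite A" "\<And>v. v \<in> A \<Longrightarrow> real (card {w \<in> A. {v, w} \<in> E}) \<le> D" "S \<subseteq> A" "0 \<le> D"
  shows "(\<Sum>v\<in>A. real (walks A E j S v)) \<le> D ^ j * real (card S)"
proof (induction j)
  case 0
  then show ?case using assms by (simp add: walks_0 indicator_def sum.If_cases Int_absorb1 flip: of_nat_sum)
next
  case (Suc j)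
  have "(\<Sum>v\<in>A. real (walks A E (Suc j) S v)) \<le> D * (\<Sum>v\<in>A. real (walks A E j S v))"
    unfolding walks_Suc by (rule sum_adj_sum_le[OF assms(1,2)])
  also have "\<dots> \<le> D * (D ^ j * real (card S))" using Suc assms by (intro mult_left_mono)
  finally show ?case by simp
qed

text \<open>
  The walk counts are split into a flat part, which carries the expected number of walks, and a
  remainder \<open>h\<close> that is controlled in the Euclidean norm.
\<close>

lemma walks_decomposition:
  fixes D q beta :: real
  assumes A: "finite A" and deg: "\<And>v. v \<in> A \<Longrightarrow> real (card {w \<in> A. {v, w} \<in> E}) \<le> D"
    and S: "S \<subseteq> A" and D: "1 \<le> D" and q: "0 \<le> q" "1 \<le> q * real (card S)" and M: "D ^ k * real (card S) \<le> real M"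
    and step: "\<And>g :: nat \<Rightarrow> nat. (\<Sum>v\<in>A. g v) \<le> M \<Longrightarrow> \<exists>h :: nat \<Rightarrow> real. \<forall>v\<in>A. 0 \<le> h v \<and>
        real (adj_sum A E g v) \<le> q * (\<Sum>w\<in>A. real (g w)) + h v \<and>
        (\<Sum>v\<in>A. (h v)\<^sup>2) \<le> beta\<^sup>2 * (\<Sum>w\<in>A. (real (g w))\<^sup>2)"
    and "j \<le> k"
  shows "\<exists>h :: nat \<Rightarrow> nat. (\<forall>v\<in>A. h v \<le> walks A E j S v) \<and>
     (\<forall>v\<in>A. real (walks A E j S v) \<le> 2 * real j * q * D ^ j * real (card S) / D + real (h v)) \<and>
     (\<Sum>v\<in>A. (real (h v))\<^sup>2) \<le> beta ^ (2 * j) * real (card S)"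
  using \<open>j \<le> k\<close>
proof (induction j)
  case 0
  have "(\<Sum>v\<in>A. (real (indicator S v))\<^sup>2) = (\<Sum>v\<in>A. if v \<in> S then 1 else 0 :: real)"
    by (intro sum.cong) (auto simp: indicator_def)
  then have "(\<Sum>v\<in>A. (real (indicator S v))\<^sup>2) = real (card S)"
    using A S by (simp add: sum.If_cases Int_absorb1)
  then show ?case by (intro exI[of _ "indicator S"]) (auto simp: walks_0)
next
  case (Suc j)
  let ?s = "real (card S)"
  from Suc obtain h :: "nat \<Rightarrow> nat" where h: "\<And>v. v \<in> A \<Longrightarrow> h v \<le> walks A E j S v"
     "\<And>v. v \<in> A \<Longrightarrow> real (walks A E j S v) \<le> 2 * real j * q * D ^ j * ?s / D + real (h v)"
     "(\<Sum>v\<in>A. (real (h v))\<^sup>2) \<le> beta ^ (2 * j) * ?s" by auto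
  define c where "c = 2 * real j * q * D ^ j * ?s / D"
  have c0: "0 \<le> c" using D q by (simp add: c_def)
  \<comment> \<open>The invariant that \<open>h\<close> stays below the walk counts is kept for this
    bound: it makes \<open>step\<close> applicable to \<open>h\<close> and limits the new flat
    part.\<close>
  have sh: "(\<Sum>v\<in>A. real (h v)) \<le> D ^ j * ?s"
  proof -
    have "(\<Sum>v\<in>A. real (h v)) \<le> (\<Sum>v\<in>A. real (walks A E j S v))"
      using h(1) by (intro sum_mono) auto
    also have "\<dots> \<le> D ^ j * ?s" using sum_walks_le[OF A deg S, of j] D by simp
    finally show ?thesis .
  qed
  also have "\<dots> \<le> D ^ k * ?s" using D Suc.prems by (intro mult_right_mono power_increasing) auto
  also have "\<dots> \<le> real M" by (rule M)
  finally have hM: "(\<Sum>v\<in>A. h v) \<le> M" by (simp flip: of_nat_sum)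
  obtain hh :: "nat \<Rightarrow> real" where hh: "\<And>v. v \<in> A \<Longrightarrow> 0 \<le> hh v"
     "\<And>v. v \<in> A \<Longrightarrow> real (adj_sum A E h v) \<le> q * (\<Sum>w\<in>A. real (h w)) + hh v"
     "A \<noteq> {} \<Longrightarrow> (\<Sum>v\<in>A. (hh v)\<^sup>2) \<le> beta\<^sup>2 * (\<Sum>w\<in>A. (real (h w))\<^sup>2)" using step[OF hM] by blast
  \<comment> \<open>The flat part is rounded up so that the remainder again has natural values;
    \<open>1 \<le> q * card S\<close> absorbs the rounding into the factor 2. The truncated
    difference \<open>h'\<close> is 0 wherever the flat part suffices.\<close>
  define X where "X = nat \<lceil>q * (\<Sum>w\<in>A. real (h w))\<rceil>"
  have X: "q * (\<Sum>w\<in>A. real (h w)) \<le> real X" "real X \<le> 2 * q * D ^ j * ?s"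
  proof -
    have nn: "0 \<le> q * (\<Sum>w\<in>A. real (h w))" using q by (simp add: sum_nonneg)
    then show "q * (\<Sum>w\<in>A. real (h w)) \<le> real X" unfolding X_def by linarith
    have "real X \<le> q * (\<Sum>w\<in>A. real (h w)) + 1" unfolding X_def using nn by linarith
    also have "\<dots> \<le> q * (D ^ j * ?s) + (q * ?s) * D ^ j"
    proof (intro add_mono mult_left_mono sh)
      have "1 * 1 \<le> (q * ?s) * D ^ j" using D q by (intro mult_mono) auto
      then show "1 \<le> (q * ?s) * D ^ j" by simp
    qed (use q in auto)
    finally show "real X \<le> 2 * q * D ^ j * ?s" by (simp add: algebra_simps)
  qed
  define h' where "h' = (\<lambda>v. adj_sum A E h v - X)"
  have "(\<Sum>v\<in>A. (real (h' v))\<^sup>2) \<le> (\<Sum>v\<in>A. (hh v)\<^sup>2)"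
  proof (intro sum_mono power_mono)
    fix v assume v: "v \<in> A"
    show "real (h' v) \<le> hh v" using hh(1,2)[OF v] X(1) by (auto simp: h'_def of_nat_diff_if)
  qed auto
  also have "\<dots> \<le> beta\<^sup>2 * (\<Sum>w\<in>A. (real (h w))\<^sup>2)" by (cases "A = {}") (use hh(3) in auto)
  also have "\<dots> \<le> beta\<^sup>2 * (beta ^ (2 * j) * ?s)" using h(3) by (intro mult_left_mono) auto
  finally have "(\<Sum>v\<in>A. (real (h' v))\<^sup>2) \<le> beta ^ (2 * Suc j) * ?s"
    by (simp add: power2_eq_square mult_ac)
  moreover have "h' v \<le> walks A E (Suc j) S v" if "v \<in> A" for v
  proof -
    have "h' v \<le> adj_sum A E h v" by (simp add: h'_def)
    also have "\<dots> \<le> adj_sum A E (walks A E j S) v" using A h(1) by (intro adj_sum_mono) auto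
    finally show ?thesis by (simp add: walks_Suc)
  qed
  moreover have "real (walks A E (Suc j) S v) \<le> 2 * real (Suc j) * q * D ^ Suc j * ?s / D + real (h' v)"
    if v: "v \<in> A" for v
  proof -
    have "real (walks A E (Suc j) S v) = (\<Sum>w\<in>{w \<in> A. {v, w} \<in> E}. real (walks A E j S w))"
      by (simp add: walks_Suc adj_sum_def)
    also have "\<dots> \<le> (\<Sum>w\<in>{w \<in> A. {v, w} \<in> E}. c + real (h w))"
      using h(2) unfolding c_def by (intro sum_mono) auto
    also have "\<dots> = real (card {w \<in> A. {v, w} \<in> E}) * c + real (adj_sum A E h v)"
      by (simp add: sum.distrib adj_sum_def)
    also have "\<dots> \<le> D * c + (real X + real (h' v))"
      using deg[OF v] c0 by (intro add_mono mult_right_mono) (auto simp: h'_def)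
    also have "\<dots> \<le> D * c + (2 * q * D ^ j * ?s + real (h' v))" using X(2) by simp
    also have "D * c + (2 * q * D ^ j * ?s + real (h' v)) = 2 * real (Suc j) * q * D ^ Suc j * ?s / D + real (h' v)"
      using D by (simp add: c_def field_simps)
    finally show ?thesis .
  qed
  ultimately show ?case by blast
qed

text \<open>Summing over both ends in \<open>S\<close>, the flat part contributes its maximum, and
  the remainder is handled by Cauchy-Schwarz on \<open>S\<close>.\<close>

lemma sum_walks_between_le:
  fixes D q beta :: real
  assumes "finite A" "\<And>v. v \<in> A \<Longrightarrow> real (card {w \<in> A. {v, w} \<in> E}) \<le> D"
    and S: "S \<subseteq> A" and "1 \<le> D" "0 \<le> q" "1 \<le> q * real (card S)" "D ^ k * real (card S) \<le> real M"
    and "\<And>g :: nat \<Rightarrow> nat. (\<Sum>v\<in>A. g v) \<le> M \<Longrightarrow> \<exists>h :: nat \<Rightarrow> real. \<forall>v\<in>A. 0 \<le> h v \<and>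
        real (adj_sum A E g v) \<le> q * (\<Sum>w\<in>A. real (g w)) + h v \<and>
        (\<Sum>v\<in>A. (h v)\<^sup>2) \<le> beta\<^sup>2 * (\<Sum>w\<in>A. (real (g w))\<^sup>2)"
    and beta: "0 \<le> beta"
  shows "(\<Sum>v\<in>S. real (walks A E k S v)) \<le>
     real (card S) * (2 * real k * q * D ^ k * real (card S) / D) + real (card S) * beta ^ k"
proof -
  from walks_decomposition[OF assms(1-8) order.refl] obtain h :: "nat \<Rightarrow> nat" where h:
    "\<And>v. v \<in> A \<Longrightarrow> real (walks A E k S v) \<le> 2 * real k * q * D ^ k * real (card S) / D + real (h v)"
    "(\<Sum>v\<in>A. (real (h v))\<^sup>2) \<le> beta ^ (2 * k) * real (card S)" by blast
  have "(\<Sum>v\<in>S. real (h v))\<^sup>2 \<le> (\<Sum>v\<in>S. (real (h v))\<^sup>2) * real (card S)"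
    using sum_squared_le_sum_of_squares[of "\<lambda>v. real (h v)" S] by (simp add: mult.commute)
  also have "\<dots> \<le> (beta ^ (2 * k) * real (card S)) * real (card S)"
    using h(2) sum_mono2[OF assms(1) S, of "\<lambda>v. (real (h v))\<^sup>2"] by (intro mult_right_mono) auto
  also have "\<dots> = (real (card S) * beta ^ k)\<^sup>2" by (simp add: power2_eq_square power_mult power_mult_distrib mult_ac)
  finally have sh: "(\<Sum>v\<in>S. real (h v)) \<le> real (card S) * beta ^ k"
    using beta by (simp add: power2_le_iff_abs_le)
  have "(\<Sum>v\<in>S. real (walks A E k S v)) \<le> (\<Sum>v\<in>S. 2 * real k * q * D ^ k * real (card S) / D + real (h v))"
    using h(1) S by (intro sum_mono) auto
  then show ?thesis using sh by (simp add: sum.distrib)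
qed

section \<open>Cycles as lists\<close>

fun path_edges :: "nat list \<Rightarrow> nat set set" where
  "path_edges (x # y # zs) = insert {x, y} (path_edges (y # zs))"
| "path_edges _ = {}"

fun num_actual :: "nat set set \<Rightarrow> nat list \<Rightarrow> nat" where
  "num_actual E (x # y # zs) = (if {x, y} \<in> E then 1 else 0) + num_actual E (y # zs)"
| "num_actual E _ = 0"

text \<open>Both halves keep the vertex \<open>y\<close>, so edges, counts and adjacency conditions
  split without a correction term. This is how cycles are cut below.\<close>

lemma path_edges_append: "path_edges (xs @ y # ys) = path_edges (xs @ [y]) \<union> path_edges (y # ys)"
proof (induction xs)
  case (Cons x xs)
  then show ?case by (cases xs) auto
qed auto

lemma num_actual_append: "num_actual E (xs @ y # ys) = num_actual E (xs @ [y]) + num_actual E (y # ys)"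
proof (induction xs)
  case (Cons x xs)
  then show ?case by (cases xs) auto
qed auto

lemma successively_append: "successively P (xs @ y # ys) \<longleftrightarrow> successively P (xs @ [y]) \<and> successively P (y # ys)"
proof (induction xs)
  case (Cons x xs)
  then show ?case by (cases xs) auto
qed auto

lemma path_edges_subset: "e \<in> path_edges xs \<Longrightarrow> e \<subseteq> set xs"
  by (induction xs rule: path_edges.induct) auto

lemma path_edges_rev: "path_edges (rev xs) = path_edges xs"
proof (induction xs rule: path_edges.induct)
  case (1 x y zs)
  have "path_edges (rev (x # y # zs)) = path_edges (rev zs @ y # [x])" by simp
  also have "\<dots> = path_edges (rev (y # zs)) \<union> {{y, x}}" by (subst path_edges_append) simp
  finally show ?case using 1 by (simp add: insert_commute)
qed auto

lemma path_edges_conv_nth: "path_edges xs = {{xs ! i, xs ! Suc i} | i. Suc i < length xs}"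
proof (induction xs rule: path_edges.induct)
  case (1 x y zs)
  have "{{(x # y # zs) ! i, (x # y # zs) ! Suc i} | i. Suc i < length (x # y # zs)} =
     insert {x, y} {{(y # zs) ! i, (y # zs) ! Suc i} | i. Suc i < length (y # zs)}" (is "?A = ?B")
  proof (intro equalityI subsetI)
    fix e assume "e \<in> ?A"
    then obtain i where i: "e = {(x # y # zs) ! i, (x # y # zs) ! Suc i}" "Suc i < length (x # y # zs)" by auto
    then show "e \<in> ?B" by (cases i) auto
  next
    fix e assume "e \<in> ?B"
    then consider "e = {x, y}" | i where "e = {(y # zs) ! i, (y # zs) ! Suc i}" "Suc i < length (y # zs)" by auto
    then show "e \<in> ?A"
    proof cases
      case 1
      then show ?thesis by (intro CollectI exI[of _ 0]) auto
    next
      case (2 i)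
      then show ?thesis by (intro CollectI exI[of _ "Suc i"]) auto
    qed
  qed
  then show ?case using 1 by simp
qed auto

lemma num_actual_conv_nth: "num_actual E xs = card {i. Suc i < length xs \<and> {xs ! i, xs ! Suc i} \<in> E}"
proof (induction xs rule: path_edges.induct)
  case (1 x y zs)
  let ?A = "{i. Suc i < length (y # zs) \<and> {(y # zs) ! i, (y # zs) ! Suc i} \<in> E}"
  have eq: "{i. Suc i < length (x # y # zs) \<and> {(x # y # zs) ! i, (x # y # zs) ! Suc i} \<in> E} =
     (if {x, y} \<in> E then {0} else {}) \<union> Suc ` ?A" (is "?L = ?R")
  proof (intro equalityI subsetI)
    fix i assume "i \<in> ?L"
    then show "i \<in> ?R" by (cases i) auto
  qed (auto split: if_splits)
  have "finite ?A" by simp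
  then have "card ?R = (if {x, y} \<in> E then 1 else 0) + card ?A"
    by (subst card_Un_disjoint) (auto simp: card_image)
  then show ?case using 1 eq by simp
qed auto

text \<open>Repeating the first vertex at the end turns a cyclic sequence into a path and removes
  the arithmetic modulo the length.\<close>

lemma nth_closed:
  assumes "i < length xs"
  shows "(xs @ [hd xs]) ! i = xs ! i" "(xs @ [hd xs]) ! Suc i = xs ! (Suc i mod length xs)"
proof -
  show "(xs @ [hd xs]) ! i = xs ! i" using assms by (simp add: nth_append)
  show "(xs @ [hd xs]) ! Suc i = xs ! (Suc i mod length xs)"
  proof (cases "Suc i = length xs")
    case True
    then show ?thesis by (metis hd_conv_nth length_0_conv mod_self nat.distinct(1) nth_append_length)
  next
    case False
    then show ?thesis using assms by (simp add: nth_append)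
  qed
qed

lemma cyc_edges_conv: "cyc_edges xs = path_edges (xs @ [hd xs])"
  unfolding cyc_edges_def cyc_edge_def path_edges_conv_nth
  by (auto simp: nth_closed image_iff) (metis nth_closed)+

lemma num_actual_closed: "card {i. i < length xs \<and> cyc_edge xs i \<in> E} = num_actual E (xs @ [hd xs])"
  unfolding num_actual_conv_nth cyc_edge_def
  by (intro arg_cong[where f=card]) (auto simp: nth_closed)

lemma successively_closed:
  "(\<forall>i<length xs. P (xs ! i) (xs ! (Suc i mod length xs))) \<longleftrightarrow> successively P (xs @ [hd xs])"
  unfolding successively_conv_nth by (auto simp: nth_closed)

lemma cyc_edges_rotate:
  "cyc_edges (xs @ ys) = cyc_edges (ys @ xs)"
proof (cases "xs = [] \<or> ys = []")
  case False
  then obtain a as b bs where "xs = a # as" "ys = b # bs" by (meson neq_Nil_conv)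
  then show ?thesis unfolding cyc_edges_conv
    using path_edges_append[of "a # as" b "bs @ [a]"] path_edges_append[of "b # bs" a "as @ [b]"] by auto
qed auto

lemma num_actual_rotate:
  "num_actual E ((xs @ ys) @ [hd (xs @ ys)]) = num_actual E ((ys @ xs) @ [hd (ys @ xs)])"
proof (cases "xs = [] \<or> ys = []")
  case False
  then obtain a as b bs where "xs = a # as" "ys = b # bs" by (meson neq_Nil_conv)
  then show ?thesis
    using num_actual_append[of E "a # as" b "bs @ [a]"] num_actual_append[of E "b # bs" a "as @ [b]"] by auto
qed auto

lemma successively_rotate:
  "successively P ((xs @ ys) @ [hd (xs @ ys)]) = successively P ((ys @ xs) @ [hd (ys @ xs)])"
proof (cases "xs = [] \<or> ys = []")
  case False
  then obtain a as b bs where "xs = a # as" "ys = b # bs" by (meson neq_Nil_conv)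
  then show ?thesis
    using successively_append[of P "a # as" b "bs @ [a]"] successively_append[of P "b # bs" a "as @ [b]"] by auto
qed auto

section \<open>Odd broken cycles\<close>

text \<open>The odd broken cycles of the vertex deletion, written as closed paths, with
  \<open>C\<close> in the role of lying in a common part. A step counts as broken exactly if it is
  not in \<open>E\<close>.\<close>

definition odd_broken :: "nat set set \<Rightarrow> (nat \<Rightarrow> nat \<Rightarrow> bool) \<Rightarrow> nat list \<Rightarrow> bool" where
  "odd_broken E C xs \<longleftrightarrow> distinct xs \<and> successively (\<lambda>x y. {x, y} \<in> E \<or> C x y) (xs @ [hd xs]) \<and>
     odd (num_actual E (xs @ [hd xs]))"

lemma odd_broken_iff:
  "broken_cycle n m V W E xs \<and> odd (card {i. i < length xs \<and> cyc_edge xs i \<in> E}) \<longleftrightarrow>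
     odd_broken E (common_part m V W) xs \<and> set xs \<subseteq> {1..n}"
  unfolding broken_cycle_def odd_broken_def num_actual_closed
    successively_closed[of xs "\<lambda>x y. {x, y} \<in> E \<or> common_part m V W x y", symmetric]
  by (auto simp: cyc_edge_def)

lemma odd_broken_rotate: "odd_broken E C (xs @ ys) \<Longrightarrow> odd_broken E C (ys @ xs)"
  unfolding odd_broken_def
  using num_actual_rotate[of E xs ys] successively_rotate[of "\<lambda>x y. {x, y} \<in> E \<or> C x y" xs ys] by auto

lemma odd_broken_start:
  assumes "odd_broken E C xs" "u \<in> set xs"
  obtains ys where "odd_broken E C (u # ys)" "set (u # ys) = set xs" "length (u # ys) = length xs"
    "cyc_edges (u # ys) = cyc_edges xs"
proof -
  obtain as bs where xs: "xs = as @ u # bs" using split_list[OF assms(2)] by blast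
  show ?thesis
    using that[of "bs @ as"] odd_broken_rotate[of E C as "u # bs"] assms(1) cyc_edges_rotate[of as "u # bs"]
    by (auto simp: xs)
qed

text \<open>The chord is broken, so it adds no actual edge to either of the two cycles that it cuts
  off. Their numbers of actual edges add up to an odd number, hence one of them is odd. Each is
  shorter because the chord is not an edge of the cycle.\<close>

lemma odd_broken_chord:
  assumes xs: "odd_broken E C xs" and C: "\<And>x y. C x y \<Longrightarrow> C y x"
    and uw: "u \<in> set xs" "w \<in> set xs" "u \<noteq> w" "{u, w} \<notin> cyc_edges xs" "{u, w} \<notin> E" "C u w"
  obtains zs where "odd_broken E C zs" "length zs < length xs" "set zs \<subseteq> set xs" "u \<in> set zs" "w \<in> set zs"
proof -
  obtain ts where ts: "odd_broken E C (u # ts)" "set (u # ts) = set xs" "length (u # ts) = length xs"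
    "cyc_edges (u # ts) = cyc_edges xs" using odd_broken_start[OF xs uw(1)] by metis
  have "w \<in> set ts" using ts(2) uw by (metis set_ConsD)
  then obtain ps qs where pq: "ts = ps @ w # qs" by (meson split_list)
  have e: "{u, w} \<notin> path_edges (u # ps @ w # qs @ [u])" using uw(4) ts(4) pq by (simp add: cyc_edges_conv)
  have ps: "ps \<noteq> []" using e by auto
  have qs: "qs \<noteq> []"
  proof
    assume "qs = []"
    then show False using e path_edges_append[of "u # ps" w "[u]"] by (auto simp: insert_commute)
  qed
  have uw': "{w, u} \<notin> E" "C w u" using uw(5,6) C by (auto simp: insert_commute)
  have d: "distinct (u # ps @ w # qs)" using ts(1) pq by (simp add: odd_broken_def)
  have succ: "successively (\<lambda>x y. {x, y} \<in> E \<or> C x y) (u # ps @ w # qs @ [u])"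
    and odd: "odd (num_actual E (u # ps @ w # qs @ [u]))" using ts(1) pq by (auto simp: odd_broken_def)
  have s1: "successively (\<lambda>x y. {x, y} \<in> E \<or> C x y) (u # ps @ [w])"
    and s2: "successively (\<lambda>x y. {x, y} \<in> E \<or> C x y) (w # qs @ [u])"
    using succ successively_append[of "\<lambda>x y. {x, y} \<in> E \<or> C x y" "u # ps" w "qs @ [u]"] by auto
  have n: "num_actual E (u # ps @ w # qs @ [u]) = num_actual E (u # ps @ [w]) + num_actual E (w # qs @ [u])"
    using num_actual_append[of E "u # ps" w "qs @ [u]"] by simp
  have n1: "num_actual E ((u # ps @ [w]) @ [u]) = num_actual E (u # ps @ [w])"
    using num_actual_append[of E "u # ps" w "[u]"] uw'(1) by simp
  have n2: "num_actual E ((w # qs @ [u]) @ [w]) = num_actual E (w # qs @ [u])"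
    using num_actual_append[of E "w # qs" u "[w]"] uw(5) by simp
  have c1: "successively (\<lambda>x y. {x, y} \<in> E \<or> C x y) ((u # ps @ [w]) @ [u])"
    using successively_append[of "\<lambda>x y. {x, y} \<in> E \<or> C x y" "u # ps" w "[u]"] s1 uw'(2) by simp
  have c2: "successively (\<lambda>x y. {x, y} \<in> E \<or> C x y) ((w # qs @ [u]) @ [w])"
    using successively_append[of "\<lambda>x y. {x, y} \<in> E \<or> C x y" "w # qs" u "[w]"] s2 uw(6) by simp
  have sub: "set (u # ps @ w # qs) = set xs" using ts(2) pq by simp
  have len: "length (u # ps @ w # qs) = length xs" using ts(3) pq by simp
  from odd n consider "odd (num_actual E (u # ps @ [w]))" | "odd (num_actual E (w # qs @ [u]))" by auto
  then show ?thesis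
  proof cases
    case 1
    show ?thesis
    proof (rule that[of "u # ps @ [w]"])
      show "odd_broken E C (u # ps @ [w])" unfolding odd_broken_def using d c1 n1 1 by auto
      show "length (u # ps @ [w]) < length xs" using qs len by (cases qs) auto
    qed (use sub in auto)
  next
    case 2
    show ?thesis
    proof (rule that[of "w # qs @ [u]"])
      show "odd_broken E C (w # qs @ [u])" unfolding odd_broken_def using d c2 n2 2 by auto
      show "length (w # qs @ [u]) < length xs" using ps len by (cases ps) auto
    qed (use sub in auto)
  qed
qed

lemma cycle_neighbour:
  assumes "a \<notin> set ys" "ys \<noteq> []" "{a, c} \<in> path_edges (a # ys @ [a])"
  shows "c = hd ys \<or> c = last ys"
proof -
  obtain b bs where ys: "ys = b # bs" using assms(2) by (cases ys) auto
  have "path_edges (ys @ [a]) = path_edges ys \<union> {{last ys, a}}"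
    using assms(2) by (cases ys rule: rev_cases) (simp_all add: path_edges_append[of _ _ "[a]"])
  then have "path_edges (a # ys @ [a]) = {{a, b}} \<union> path_edges ys \<union> {{last ys, a}}"
    by (auto simp: ys)
  moreover have "{a, c} \<notin> path_edges ys" using path_edges_subset[of "{a, c}" ys] assms(1) by auto
  ultimately show ?thesis using assms(3) ys by (auto simp: doubleton_eq_iff)
qed

text \<open>Around the broken edge \<open>{a, b}\<close> the cycle continues with actual edges to
  \<open>a'\<close> and \<open>b'\<close>. If these coincide or are joined by a broken edge, the
  cycle closes up as a triangle or a square with exactly two actual edges, an even number.\<close>

lemma triangle_or_square_even:
  assumes Z: "odd_broken E C Z" and in_cyc: "{a, b} \<in> cyc_edges Z" "{a, a'} \<in> cyc_edges Z" "{b, b'} \<in> cyc_edges Z"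
    and ne: "a \<noteq> b" "a' \<noteq> b" "b' \<noteq> a" and act: "{a, b} \<notin> E" "{a, a'} \<in> E" "{b, b'} \<in> E"
    and fin: "a' = b' \<or> ({a', b'} \<in> cyc_edges Z \<and> {a', b'} \<notin> E)"
  shows False
proof -
  have sub: "a \<in> set Z"
    using in_cyc(1) path_edges_subset[of "{a, b}" "Z @ [hd Z]"] hd_in_set[of Z]
    by (cases "Z = []") (auto simp: cyc_edges_conv)
  obtain ys where ys: "odd_broken E C (a # ys)" "cyc_edges (a # ys) = cyc_edges Z"
    using odd_broken_start[OF Z sub] by metis
  have d: "a \<notin> set ys" "distinct ys" using ys(1) by (auto simp: odd_broken_def)
  have pe: "cyc_edges Z = path_edges (a # ys @ [a])" using ys(2) by (simp add: cyc_edges_conv)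
  have yne: "ys \<noteq> []" using in_cyc(1) ne(1) pe by auto
  have ends: "b = hd ys \<or> b = last ys" "a' = hd ys \<or> a' = last ys"
    using cycle_neighbour[OF d(1) yne] in_cyc pe by auto
  text \<open>Reversing the cycle if necessary, \<open>b\<close> follows \<open>a\<close>.\<close>
  obtain zs where zs: "zs = ys \<or> zs = rev ys" "hd zs = b" "last zs = a'"
  proof (cases "b = hd ys")
    case True
    then show ?thesis using that[of ys] ends ne(2) by auto
  next
    case False
    then show ?thesis using that[of "rev ys"] ends ne(2) yne by (auto simp: hd_rev last_rev)
  qed
  have zne: "zs \<noteq> []" and dz: "a \<notin> set zs" "distinct zs" using zs(1) yne d by auto
  have pz: "cyc_edges Z = path_edges (a # zs @ [a])"
    using zs(1) pe path_edges_rev[of "a # ys @ [a]"] by auto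
  obtain rs where rs: "zs = b # rs" using zs(2) zne by (cases zs) auto
  have rne: "rs \<noteq> []" using zs(3) rs ne by auto
  have oddz: "odd (num_actual E (a # zs @ [a]))"
  proof -
    have rev_eq: "num_actual E (rev ts) = num_actual E ts" for ts
    proof (induction ts rule: path_edges.induct)
      case (1 x y ts)
      have "num_actual E (rev (x # y # ts)) = num_actual E (rev ts @ y # [x])" by simp
      also have "\<dots> = num_actual E (rev (y # ts)) + num_actual E [y, x]" by (subst num_actual_append) simp
      finally show ?case using 1 by (simp add: insert_commute)
    qed auto
    show ?thesis using zs(1) ys(1) rev_eq[of "a # ys @ [a]"] by (auto simp: odd_broken_def)
  qed
  have pb: "path_edges (b # (rs @ [a]) @ [b]) = cyc_edges Z"
    unfolding pz rs using cyc_edges_rotate[of "[a]" "b # rs"] by (simp add: cyc_edges_conv)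
  have "b' = hd rs"
  proof -
    have "b' = hd (rs @ [a]) \<or> b' = last (rs @ [a])"
      using cycle_neighbour[of b "rs @ [a]" b'] in_cyc(3) dz rs pb by auto
    then show ?thesis using ne(3) rne by auto
  qed
  then obtain ss where ss: "rs = b' # ss" using rne by (cases rs) auto
  show False
  proof (cases "ss = []")
    case True
    then have "a' = b'" using zs(3) rs ss by simp
    then show False using oddz act ss rs True by (simp add: insert_commute)
  next
    case False
    have a': "a' = last ss" using False zs(3) rs ss by simp
    have ab: "a' \<noteq> b'" using dz rs ss False a' last_in_set[of ss] by auto
    with fin have f: "{a', b'} \<in> cyc_edges Z" "{a', b'} \<notin> E" by auto
    have "path_edges (b' # (ss @ [a, b]) @ [b']) = cyc_edges Z"
      unfolding pz rs ss using cyc_edges_rotate[of "[a, b]" "b' # ss"] by (simp add: cyc_edges_conv)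
    then have "a' = hd (ss @ [a, b]) \<or> a' = last (ss @ [a, b])"
      using cycle_neighbour[of b' "ss @ [a, b]" a'] f dz rs ss by (auto simp: insert_commute)
    then have "a' = hd ss" using False ne(2) by auto
    then have "ss = [a']" using a' False dz rs ss
      by (cases ss) (auto split: if_splits simp: last_in_set)
    then show False using oddz act f(2) rs ss by (simp add: insert_commute)
  qed
qed

lemma cyc_edges_subset: "e \<in> cyc_edges xs \<Longrightarrow> e \<subseteq> set xs"
  by (cases "xs = []") (auto simp: cyc_edges_conv dest!: path_edges_subset subsetD)

lemma finite_cyc_edges: "finite (cyc_edges xs)"
  by (simp add: cyc_edges_def)

lemma common_part_sym: "common_part m V W x y \<Longrightarrow> common_part m V W y x"
  by (auto simp: common_part_def)

lemma between_sym: "between A B = between B A"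
  unfolding between_def by (metis (no_types, opaque_lifting) insert_commute)

lemma not_simple_witness:
  assumes "\<not> simple_wrt m V W H" "finite H"
  obtains P i j a a' b b' where "P = V \<or> P = W" "i \<in> {1..m}" "j \<in> {1..m}" "a \<in> P i" "a' \<in> P j" "b \<in> P i" "b' \<in> P j"
    "{a, a'} \<in> H" "{b, b'} \<in> H" "a \<noteq> b \<or> a' \<noteq> b'"
proof -
  from assms(1) obtain P i j where P: "P = V \<or> P = W" "i \<in> {1..m}" "j \<in> {1..m}"
    "\<not> card (H \<inter> between (P i) (P j)) \<le> 1"
    unfolding simple_wrt_def by blast
  then obtain e e' where e: "e \<in> H \<inter> between (P i) (P j)" "e' \<in> H \<inter> between (P i) (P j)" "e \<noteq> e'"
    using assms(2) card_le_Suc0_iff_eq[of "H \<inter> between (P i) (P j)"] by auto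
  then show ?thesis using that[OF P(1-3)] by (auto simp: between_def)
qed

text \<open>Assume there is no such pair. By induction no shorter odd broken cycle lives on the
  vertices of \<open>Z\<close>, so two vertices of \<open>Z\<close> in a common part are joined by a
  broken edge of \<open>Z\<close>, not by a chord. Two actual edges in one block, which exist since
  \<open>Z\<close> is not simple, therefore have corresponding ends that coincide or are joined by
  broken edges, and \<open>Z\<close> is an even triangle or square.\<close>

lemma odd_broken_bad_pair:
  assumes nonsimple: "\<And>Z. odd_broken E (common_part m V W) Z \<Longrightarrow> set Z \<subseteq> X \<Longrightarrow> length Z \<le> k \<Longrightarrow>
      \<not> simple_wrt m V W (cyc_edges Z \<inter> E)"
    and "odd_broken E (common_part m V W) Z" "set Z \<subseteq> X" "length Z \<le> k"
  shows "\<exists>x\<in>set Z. \<exists>y\<in>set Z. {x, y} \<in> E \<and> common_part m V W x y"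
  using assms(2-4)
proof (induction "length Z" arbitrary: Z rule: less_induct)
  case less
  let ?C = "common_part m V W"
  show ?case
  proof (rule ccontr)
    assume "\<not> ?case"
    then have nb: "{x, y} \<notin> E" if "x \<in> set Z" "y \<in> set Z" "?C x y" for x y using that by blast
    have H: "{u, w} \<in> cyc_edges Z" if uw: "u \<in> set Z" "w \<in> set Z" "u \<noteq> w" "?C u w" for u w
    proof (rule ccontr)
      assume nc: "{u, w} \<notin> cyc_edges Z"
      obtain zs where zs: "odd_broken E ?C zs" "length zs < length Z" "set zs \<subseteq> set Z"
        by (rule odd_broken_chord[OF less.prems(1) common_part_sym uw(1-3) nc nb[OF uw(1,2,4)] uw(4)])
      have "\<exists>x\<in>set zs. \<exists>y\<in>set zs. {x, y} \<in> E \<and> ?C x y"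
        by (rule less.hyps[OF zs(2,1)]) (use zs less.prems in auto)
      then show False using zs(3) nb by blast
    qed
    obtain P i j a a' b b' where w: "P = V \<or> P = W" "i \<in> {1..m}" "j \<in> {1..m}" "a \<in> P i" "a' \<in> P j" "b \<in> P i" "b' \<in> P j"
      "{a, a'} \<in> cyc_edges Z \<inter> E" "{b, b'} \<in> cyc_edges Z \<inter> E" "a \<noteq> b \<or> a' \<noteq> b'"
      by (rule not_simple_witness[OF nonsimple[OF less.prems] finite_Int[OF disjI1[OF finite_cyc_edges]]])
    have mem: "a \<in> set Z" "a' \<in> set Z" "b \<in> set Z" "b' \<in> set Z"
      using w(8,9) cyc_edges_subset by blast+
    have C: "?C a b" "?C a' b'" using w(1-7) by (auto simp: common_part_def)
    show False
    proof (cases "a = b")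
      case False
      have ab: "{a, b} \<in> cyc_edges Z" "{a, b} \<notin> E" using H[OF mem(1,3) False C(1)] nb[OF mem(1,3) C(1)] by auto
      have "a' = b' \<or> ({a', b'} \<in> cyc_edges Z \<and> {a', b'} \<notin> E)"
        using H[OF mem(2,4) _ C(2)] nb[OF mem(2,4) C(2)] by auto
      moreover have "a' \<noteq> b" "b' \<noteq> a" using ab w(8,9) by (auto simp: insert_commute)
      ultimately show False
        using triangle_or_square_even[OF less.prems(1) ab(1), of a' b'] w(8,9) False ab(2) by auto
    next
      case True
      \<comment> \<open>Here the two edges share the end \<open>a\<close>, which is the common
        neighbour of the ends of the broken edge \<open>{a', b'}\<close>: the triangle case.\<close>
      have ab: "a' \<noteq> b'" "{a', b'} \<in> cyc_edges Z" "{a', b'} \<notin> E"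
        using H[OF mem(2,4) _ C(2)] nb[OF mem(2,4) C(2)] True w(10) by auto
      moreover have "a \<noteq> b'" "a \<noteq> a'" using ab w(8,9) True by (auto simp: insert_commute)
      ultimately show False
        using triangle_or_square_even[OF less.prems(1) ab(2), of a a] w(8,9) True by (auto simp: insert_commute)
    qed
  qed
qed

section \<open>Distance from the exceptional vertices\<close>

text \<open>The exceptional vertices: in the application they are the ends of edges of one colour
  that fall inside a part of the other partition.\<close>

definition bad_vertices :: "nat \<Rightarrow> nat \<Rightarrow> (nat \<Rightarrow> nat set) \<Rightarrow> (nat \<Rightarrow> nat set) \<Rightarrow> nat set set \<Rightarrow> nat set" where
  "bad_vertices n m V W E = {x \<in> {1..n}. \<exists>y\<in>{1..n}. {x, y} \<in> E \<and> common_part m V W x y}"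

fun reach :: "nat set \<Rightarrow> (nat \<Rightarrow> nat \<Rightarrow> bool) \<Rightarrow> nat \<Rightarrow> nat set \<Rightarrow> nat set" where
  "reach A P 0 D = D"
| "reach A P (Suc j) D = reach A P j D \<union> {x \<in> A. \<exists>y\<in>reach A P j D. P x y}"

lemma reach_mono: "i \<le> j \<Longrightarrow> reach A P i D \<subseteq> reach A P j D"
  by (induction j) (auto simp: le_Suc_eq)

lemma reach_path:
  assumes "successively P (x # ps @ [a])" "a \<in> D" "set (x # ps) \<subseteq> A"
  shows "x \<in> reach A P (Suc (length ps)) D"
  using assms
proof (induction ps arbitrary: x)
  case (Cons y ps)
  then have "y \<in> reach A P (Suc (length ps)) D" by auto
  then show ?case using Cons.prems by auto
qed auto

lemma successively_sym: "(\<And>x y. P x y \<Longrightarrow> P y x) \<Longrightarrow> successively P xs \<Longrightarrow> successively P (rev xs)"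
  by (simp add: successively_rev) (metis (no_types, lifting) successively_mono)

text \<open>On a cycle of length at most \<open>2 * h + 2\<close> only the antipode of
  \<open>x\<close> can be \<open>h + 1\<close> steps away, so one of two distinct vertices of
  \<open>D\<close> is within \<open>h\<close> steps. The radius matters: for \<open>h = 1\<close>
  the size bound for balls of radius \<open>h + 1\<close> would be too large for
  \<open>bad_vertices_term\<close>.\<close>

lemma reach_cycle:
  assumes Z: "odd_broken E C Z" and A: "set Z \<subseteq> A" and len: "length Z \<le> 2 * h + 2" and x: "x \<in> set Z"
    and ab: "a \<in> set Z" "b \<in> set Z" "a \<in> D" "b \<in> D" "a \<noteq> b" and C: "\<And>x y. C x y \<Longrightarrow> C y x"
  shows "x \<in> reach A (\<lambda>x y. {x, y} \<in> E \<or> C x y) h D"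
proof (rule ccontr)
  let ?P = "\<lambda>x y. {x, y} \<in> E \<or> C x y"
  assume nx: "x \<notin> reach A ?P h D"
  have sym: "?P x y \<Longrightarrow> ?P y x" for x y using C by (auto simp: insert_commute)
  obtain ts where ts: "odd_broken E C (x # ts)" "set (x # ts) = set Z" "length (x # ts) = length Z"
    using odd_broken_start[OF Z x] by metis
  have suc: "successively ?P (x # ts @ [x])" using ts(1) by (auto simp: odd_broken_def)
  have xD: "x \<notin> D" using nx reach_mono[of 0 h A ?P D] by auto
  have opp: "length ps = h \<and> length qs = h" if "ts = ps @ c # qs" "c \<in> D" for ps c qs
  proof -
    have s1: "successively ?P (x # ps @ [c])"
      using suc successively_append[of ?P "x # ps" c "qs @ [x]"] that(1) by simp
    have s2: "successively ?P (c # qs @ [x])"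
      using suc successively_append[of ?P "x # ps" c "qs @ [x]"] that(1) by simp
    have sA: "set (x # ps) \<subseteq> A" "set (x # rev qs) \<subseteq> A" using ts(2) A that(1) by auto
    have "x \<in> reach A ?P (Suc (length ps)) D" by (rule reach_path[OF s1 that(2) sA(1)])
    then have 1: "h < Suc (length ps)" using nx reach_mono[of "Suc (length ps)" h A ?P D] by (meson in_mono not_le)
    have "successively ?P (x # rev qs @ [c])" using successively_sym[of ?P, OF sym s2] by simp
    then have "x \<in> reach A ?P (Suc (length (rev qs))) D" by (rule reach_path[OF _ that(2) sA(2)])
    then have 2: "h < Suc (length qs)"
      using nx reach_mono[of "Suc (length qs)" h A ?P D] by (cases "h < Suc (length qs)") auto
    show ?thesis using 1 2 len ts(3) that(1) by simp
  qed
  have "a \<noteq> x" "b \<noteq> x" using ab xD by auto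
  then have mem: "a \<in> set ts" "b \<in> set ts" using ab(1,2) unfolding ts(2)[symmetric] by auto
  obtain ps qs ps' qs' where s: "ts = ps @ a # qs" "ts = ps' @ b # qs'"
    using split_list[OF mem(1)] split_list[OF mem(2)] by blast
  have "ts ! h = a" using opp[OF s(1) ab(3)] s(1) by auto
  moreover have "ts ! h = b" using opp[OF s(2) ab(4)] s(2) by auto
  ultimately show False using ab by simp
qed

lemma card_reach_le:
  fixes K :: real
  assumes "finite A" "\<And>y. y \<in> A \<Longrightarrow> real (card {x \<in> A. P x y}) \<le> K" "D \<subseteq> A" "0 \<le> K"
  shows "real (card (reach A P j D)) \<le> (K + 1) ^ j * real (card D) \<and> reach A P j D \<subseteq> A"
proof (induction j)
  case 0
  then show ?case using assms by simp
next
  case (Suc j)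
  let ?B = "reach A P j D"
  have fB: "finite ?B" using Suc assms(1) finite_subset by blast
  have "{x \<in> A. \<exists>y\<in>?B. P x y} = (\<Union>y\<in>?B. {x \<in> A. P x y})" by auto
  then have "card {x \<in> A. \<exists>y\<in>?B. P x y} \<le> (\<Sum>y\<in>?B. card {x \<in> A. P x y})"
    using card_UN_le[OF fB] by simp
  then have "real (card {x \<in> A. \<exists>y\<in>?B. P x y}) \<le> (\<Sum>y\<in>?B. real (card {x \<in> A. P x y}))"
    by (simp flip: of_nat_sum)
  also have "\<dots> \<le> (\<Sum>y\<in>?B. K)" using assms(2) Suc by (intro sum_mono) auto
  finally have "real (card {x \<in> A. \<exists>y\<in>?B. P x y}) \<le> K * real (card ?B)" by (simp add: mult.commute)
  moreover have "card (reach A P (Suc j) D) \<le> card ?B + card {x \<in> A. \<exists>y\<in>?B. P x y}"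
    by (simp add: card_Un_le)
  ultimately have "real (card (reach A P (Suc j) D)) \<le> (K + 1) * real (card ?B)"
    by (simp add: algebra_simps)
  also have "\<dots> \<le> (K + 1) * ((K + 1) ^ j * real (card D))" using Suc assms(4) by (intro mult_left_mono) auto
  finally show ?case using Suc by auto
qed

section \<open>Walks through a replaceable vertex\<close>

lemma funpow_adj_sum_path:
  assumes "finite A" "q \<noteq> []" "set q \<subseteq> A" "path_edges q \<subseteq> E"
  shows "f (last q) \<le> (adj_sum A E ^^ (length q - 1)) f (hd q)"
  using assms(2-4)
proof (induction q rule: path_edges.induct)
  case (1 x y zs)
  have "f (last (y # zs)) \<le> (adj_sum A E ^^ (length (y # zs) - 1)) f y" using 1 by simp
  also have "\<dots> \<le> adj_sum A E ((adj_sum A E ^^ (length (y # zs) - 1)) f) x"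
    unfolding adj_sum_def using 1 assms(1) by (intro member_le_sum) auto
  finally show ?case by simp
qed auto

text \<open>Each member of \<open>Z\<close> may take the place of the inner vertex \<open>z\<close>.
  Even a member that already lies on the path is allowed, since walks may repeat vertices.\<close>

lemma walks_replaceable:
  assumes A: "finite A" and pth: "set (ps @ u # z # v # qs) \<subseteq> A" "path_edges (ps @ u # z # v # qs) \<subseteq> E"
    and Z: "Z \<subseteq> A" "\<And>z'. z' \<in> Z \<Longrightarrow> {u, z'} \<in> E \<and> {z', v} \<in> E"
  shows "card Z \<le> walks A E (length ps + length qs + 2) {last (v # qs)} (hd (ps @ [u]))"
proof -
  let ?f = "indicator {last (v # qs)} :: nat \<Rightarrow> nat"
  define g where "g = (adj_sum A E ^^ length qs) ?f"
  have p: "path_edges (ps @ [u]) \<subseteq> E" "path_edges (v # qs) \<subseteq> E"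
    using pth(2) path_edges_append[of ps u "z # v # qs"] by auto
  have gv: "1 \<le> g v"
    using funpow_adj_sum_path[OF A _ _ p(2), of ?f] pth(1) by (auto simp: g_def)
  have g1: "1 \<le> adj_sum A E g z'" if "z' \<in> Z" for z'
  proof -
    have "g v \<le> adj_sum A E g z'"
      unfolding adj_sum_def using Z(2)[OF that] A pth(1) by (intro member_le_sum) auto
    then show ?thesis using gv by simp
  qed
  have "card Z = (\<Sum>z'\<in>Z. 1)" by simp
  also have "\<dots> \<le> (\<Sum>z'\<in>Z. adj_sum A E g z')" using g1 by (intro sum_mono) auto
  also have "\<dots> \<le> adj_sum A E (adj_sum A E g) u"
    unfolding adj_sum_def[of A E "adj_sum A E g" u] using A Z by (intro sum_mono2) auto
  also have "\<dots> \<le> (adj_sum A E ^^ length ps) (adj_sum A E (adj_sum A E g)) (hd (ps @ [u]))"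
    using funpow_adj_sum_path[OF A _ _ p(1), of "adj_sum A E (adj_sum A E g)"] pth(1) by auto
  also have "(adj_sum A E ^^ length ps) (adj_sum A E (adj_sum A E g)) = (adj_sum A E ^^ (length ps + length qs + 2)) ?f"
  proof -
    have "length ps + length qs + 2 = length ps + Suc (Suc (length qs))" by simp
    then show ?thesis unfolding g_def by (simp only: funpow_add funpow.simps comp_apply)
  qed
  finally show ?thesis by (simp add: walks_def)
qed

lemma sum_walks_singletons:
  assumes "finite S"
  shows "(\<Sum>y\<in>S. walks A E j {y} v) = walks A E j S v"
proof (induction j arbitrary: v)
  case 0
  then show ?case using assms by (simp add: walks_0 indicator_def)
next
  case (Suc j)
  then show ?case by (simp add: walks_Suc adj_sum_def) (subst sum.swap, simp)
qed

lemma walks_mono: "finite A \<Longrightarrow> E \<subseteq> E' \<Longrightarrow> walks A E j S v \<le> walks A E' j S v"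
proof (induction j arbitrary: v)
  case (Suc j)
  show ?case unfolding walks_Suc using Suc.IH[OF Suc.prems] Suc.prems by (intro adj_sum_mono)
qed (simp add: walks_0)

section \<open>The order in which the blocks are revealed\<close>

definition pos :: "'a rel \<Rightarrow> 'a set \<Rightarrow> 'a \<Rightarrow> nat" where
  "pos L A e = card {f \<in> A. (f, e) \<in> L}"

lemma pos_less:
  assumes L: "linear_order_on A L" and "finite A" "e \<in> A" "f \<in> A" "(f, e) \<in> L" "f \<noteq> e"
  shows "pos L A f < pos L A e"
  unfolding pos_def
proof (rule psubset_card_mono)
  have t: "trans L" and a: "antisym L" and r: "refl_on A L"
    using L by (auto simp: linear_order_on_def partial_order_on_def preorder_on_def)
  have "e \<notin> {g \<in> A. (g, f) \<in> L}" using a assms(5,6) by (auto dest: antisymD)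
  moreover have "e \<in> {g \<in> A. (g, e) \<in> L}" using r assms(3) by (auto dest: refl_onD)
  moreover have "{g \<in> A. (g, f) \<in> L} \<subseteq> {g \<in> A. (g, e) \<in> L}" using t assms(5) by (auto dest: transD)
  ultimately show "{g \<in> A. (g, f) \<in> L} \<subset> {g \<in> A. (g, e) \<in> L}" by blast
qed (use assms in auto)

text \<open>A block is ranked by one representative edge. As blocks are consecutive, the order of
  the blocks does not depend on the representative.\<close>

definition pair_rank :: "nat \<Rightarrow> nat set rel \<Rightarrow> (nat \<Rightarrow> nat set) \<Rightarrow> nat set \<Rightarrow> nat" where
  "pair_rank n L V P = pos L (nsets {1..n} 2) ((\<lambda>i. Min (V i)) ` P)"

lemma nsets2E:
  assumes "P \<in> nsets A 2"
  obtains a b where "P = {a, b}" "a \<in> A" "b \<in> A" "a \<noteq> b"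
proof -
  from assms have "P \<subseteq> A" "card P = 2" by (auto simp: nsets_def)
  then show ?thesis using that by (auto simp: card_2_iff)
qed

lemma nsets2I: "a \<in> A \<Longrightarrow> b \<in> A \<Longrightarrow> a \<noteq> b \<Longrightarrow> {a, b} \<in> nsets A 2"
  by (auto simp: nsets_def)

lemma Min_part_in:
  assumes "V \<in> equipartitions n r" "0 < r" "i \<in> {1..n div r}"
  shows "Min (V i) \<in> V i"
proof -
  have "V i \<noteq> {}" using equipartitionsD(2)[OF assms(1,3)] assms(2) by auto
  then show ?thesis using equipartitionsD(3)[OF assms(1,3)] by simp
qed

lemma between_inject:
  assumes V: "V \<in> equipartitions n r"
    and "a \<in> {1..n div r}" "b \<in> {1..n div r}" "i \<in> {1..n div r}" "j \<in> {1..n div r}"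
    and f: "f \<in> between (V a) (V b)" "f \<in> between (V i) (V j)"
  shows "{a, b} = {i, j}"
proof -
  from f(1) obtain u v where uv: "f = {u, v}" "u \<in> V a" "v \<in> V b" unfolding between_def by blast
  from f(2) obtain u' v' where uv': "f = {u', v'}" "u' \<in> V i" "v' \<in> V j" unfolding between_def by blast
  note * = uv uv'
  from uv(1) uv'(1) consider "u = u'" "v = v'" | "u = v'" "v = u'" by (metis doubleton_eq_iff)
  then show ?thesis
  proof cases
    case 1
    then have "a = i" "b = j"
      using equipartitionsD(6)[OF V assms(2,4), of u] equipartitionsD(6)[OF V assms(3,5), of v] * by auto
    then show ?thesis by simp
  next
    case 2
    then have "a = j" "b = i"
      using equipartitionsD(6)[OF V assms(2,5), of u] equipartitionsD(6)[OF V assms(3,4), of v] * by auto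
    then show ?thesis by auto
  qed
qed

lemma rep_edge:
  assumes V: "V \<in> equipartitions n r" "0 < r" and ij: "i \<in> {1..n div r}" "j \<in> {1..n div r}" "i \<noteq> j"
  shows "(\<lambda>i. Min (V i)) ` {i, j} \<in> between (V i) (V j)" "(\<lambda>i. Min (V i)) ` {i, j} \<in> nsets {1..n} 2"
proof -
  note mi = Min_part_in[OF V ij(1)] Min_part_in[OF V ij(2)]
  show "(\<lambda>i. Min (V i)) ` {i, j} \<in> between (V i) (V j)" using mi by (auto simp: between_def)
  have "Min (V i) \<noteq> Min (V j)" using equipartitionsD(6)[OF V(1) ij(1,2) mi(1)] mi(2) ij(3) by auto
  then show "(\<lambda>i. Min (V i)) ` {i, j} \<in> nsets {1..n} 2"
    unfolding image_insert image_empty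
    by (rule nsets2I[OF subsetD[OF equipartitionsD(1)[OF V(1) ij(1)] mi(1)]
        subsetD[OF equipartitionsD(1)[OF V(1) ij(2)] mi(2)]])
qed

lemma block_consecutive:
  assumes "block_ordering n m V L" "i \<in> {1..m}" "j \<in> {1..m}" "i \<noteq> j"
    and "e \<in> between (V i) (V j)" "g \<in> between (V i) (V j)" "(e, f) \<in> L" "(f, g) \<in> L"
  shows "f \<in> between (V i) (V j)"
proof -
  have c: "\<forall>e\<in>between (V i) (V j). \<forall>g\<in>between (V i) (V j). \<forall>f. (e, f) \<in> L \<and> (f, g) \<in> L \<longrightarrow> f \<in> between (V i) (V j)"
    if "i \<in> {1..m}" "j \<in> {1..m}" "i < j" for i j
    by (rule mp[OF bspec[OF bspec[OF conjunct2[OF assms(1)[unfolded block_ordering_def]] that(1)] that(2)] that(3)])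
  show ?thesis
  proof (cases "i < j")
    case True
    from c[OF assms(2,3) this] show ?thesis using assms(5-8) by blast
  next
    case False
    then have "j < i" using assms(4) by simp
    have "between (V j) (V i) = between (V i) (V j)" by (rule between_sym)
    from c[OF assms(3,2) \<open>j < i\<close>, unfolded this] show ?thesis using assms(5-8) by blast
  qed
qed

text \<open>Blocks are disjoint intervals of the ordering. Suppose the representatives
  \<open>p\<close> and \<open>q\<close> were ordered against \<open>f\<close> and \<open>e\<close>.
  If \<open>e\<close> lies below \<open>p\<close>, it is caught between \<open>f\<close> and
  \<open>p\<close>, in the wrong block; otherwise \<open>p\<close> is caught between
  \<open>q\<close> and \<open>e\<close>.\<close>

lemma pair_rank_less:
  assumes V: "V \<in> equipartitions n r" "0 < r" and L: "block_ordering n (n div r) V L"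
    and ab: "a \<in> {1..n div r}" "b \<in> {1..n div r}" "a \<noteq> b"
    and ij: "i \<in> {1..n div r}" "j \<in> {1..n div r}" "i \<noteq> j"
    and ne: "{a, b} \<noteq> {i, j}"
    and f: "f \<in> between (V a) (V b)" and e: "e \<in> between (V i) (V j)"
    and nsets: "f \<in> nsets {1..n} 2" "e \<in> nsets {1..n} 2" and fe: "(f, e) \<in> L"
  shows "pair_rank n L V {a, b} < pair_rank n L V {i, j}"
proof -
  let ?A = "nsets {1..n} (2::nat)"
  have lin: "linear_order_on ?A L" using L by (simp add: block_ordering_def)
  have t: "trans L" and tot: "total_on ?A L"
    using lin by (auto simp: linear_order_on_def partial_order_on_def preorder_on_def)
  define p q where "p = (\<lambda>i. Min (V i)) ` {a, b}" and "q = (\<lambda>i. Min (V i)) ` {i, j}"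
  have p: "p \<in> between (V a) (V b)" "p \<in> ?A" using rep_edge[OF V ab] by (auto simp: p_def)
  have q: "q \<in> between (V i) (V j)" "q \<in> ?A" using rep_edge[OF V ij] by (auto simp: q_def)
  have disj: "g \<notin> between (V i) (V j)" if "g \<in> between (V a) (V b)" for g
    using between_inject[OF V(1) ab(1,2) ij(1,2) that] ne by blast
  have pq: "p \<noteq> q" using p q disj by blast
  have "(p, q) \<in> L"
  proof (rule ccontr)
    assume "(p, q) \<notin> L"
    then have qp: "(q, p) \<in> L" using tot pq p(2) q(2) by (auto simp: total_on_def)
    have "e \<noteq> p" using disj[OF p(1)] e by blast
    then consider "(e, p) \<in> L" | "(p, e) \<in> L" using tot p(2) nsets(2) by (auto simp: total_on_def)
    then show False
    proof cases
      case 1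
      then show False using block_consecutive[OF L ab f p(1) fe] disj e by blast
    next
      case 2
      then show False using block_consecutive[OF L ij q(1) e qp] disj p by blast
    qed
  qed
  then show ?thesis
    unfolding pair_rank_def p_def[symmetric] q_def[symmetric]
    using pos_less[OF lin finite_imp_finite_nsets[OF finite_atLeastAtMost] q(2) p(2) _ pq] by blast
qed

lemma inj_on_pair_rank:
  assumes V: "V \<in> equipartitions n r" "0 < r" and L: "block_ordering n (n div r) V L"
  shows "inj_on (pair_rank n L V) (nsets {1..n div r} 2)"
proof (rule inj_onI, rule ccontr)
  let ?A = "nsets {1..n} (2::nat)"
  fix P Q assume PQ: "P \<in> nsets {1..n div r} 2" "Q \<in> nsets {1..n div r} 2"
    and eq: "pair_rank n L V P = pair_rank n L V Q" and ne: "P \<noteq> Q"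
  obtain a b where ab: "P = {a, b}" "a \<in> {1..n div r}" "b \<in> {1..n div r}" "a \<noteq> b" by (rule nsets2E[OF PQ(1)])
  obtain i j where ij: "Q = {i, j}" "i \<in> {1..n div r}" "j \<in> {1..n div r}" "i \<noteq> j" by (rule nsets2E[OF PQ(2)])
  have lin: "linear_order_on ?A L" using L by (simp add: block_ordering_def)
  define p q where "p = (\<lambda>i. Min (V i)) ` {a, b}" and "q = (\<lambda>i. Min (V i)) ` {i, j}"
  have p: "p \<in> between (V a) (V b)" "p \<in> ?A" using rep_edge[OF V ab(2-4)] by (auto simp: p_def)
  have q: "q \<in> between (V i) (V j)" "q \<in> ?A" using rep_edge[OF V ij(2-4)] by (auto simp: q_def)
  have pq: "p \<noteq> q" using between_inject[OF V(1) ab(2,3) ij(2,3) p(1)] q(1) ne ab(1) ij(1) by auto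
  then have "(p, q) \<in> L \<or> (q, p) \<in> L"
    using lin p(2) q(2) by (auto simp: linear_order_on_def total_on_def)
  then have "pos L ?A p \<noteq> pos L ?A q"
    using pos_less[OF lin finite_imp_finite_nsets[OF finite_atLeastAtMost] q(2) p(2) _ pq] pos_less[OF lin finite_imp_finite_nsets[OF finite_atLeastAtMost] p(2) q(2) _ pq[symmetric]] by auto
  then show False using eq ab(1) ij(1) by (simp add: pair_rank_def p_def q_def)
qed

section \<open>The deletions destroy every cycle of length \<open>l\<close>\<close>

lemma ex_largest_edge:
  assumes "linear_order_on A L" "finite S" "S \<noteq> {}" "S \<subseteq> A"
  shows "\<exists>e. largest_edge L S e"
  using assms(2-4)
proof (induction S rule: finite_ne_induct)
  case (singleton x)
  then show ?case using assms(1)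
    by (auto simp: largest_edge_def linear_order_on_def partial_order_on_def preorder_on_def refl_on_def)
next
  case (insert x F)
  then obtain e where e: "e \<in> F" "\<And>f. f \<in> F \<Longrightarrow> (f, e) \<in> L" by (auto simp: largest_edge_def)
  have L: "refl_on A L" "trans L" "total_on A L"
    using assms(1) by (auto simp: linear_order_on_def partial_order_on_def preorder_on_def)
  show ?case
  proof (cases "(x, e) \<in> L")
    case True
    then show ?thesis using e by (auto simp: largest_edge_def intro!: exI[of _ e])
  next
    case False
    have "x \<noteq> e" using e(1) insert.hyps by auto
    then have "(e, x) \<in> L" using False L(3) e(1) insert.prems by (auto simp: total_on_def)
    then show ?thesis using e(2) L(1,2) insert.prems
      by (auto simp: largest_edge_def refl_on_def intro!: exI[of _ x] dest: transD)
  qed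
qed

text \<open>Two values cannot alternate around an odd cycle.\<close>

lemma odd_cycle_repeats:
  fixes P :: "nat \<Rightarrow> bool"
  assumes "odd (t::nat)"
  shows "\<exists>i<t. P i = P (Suc i mod t)"
proof (rule ccontr)
  assume "\<not> ?thesis"
  then have alt: "P i \<noteq> P (Suc i mod t)" if "i < t" for i using that by blast
  have "P i = (P 0 \<noteq> odd i)" if "i < t" for i
    using that
  proof (induction i)
    case (Suc i)
    have eq: "Suc i mod t = Suc i" using Suc.prems by simp
    have "P i \<noteq> P (Suc i)" by (rule alt[OF Suc_lessD[OF Suc.prems], unfolded eq])
    moreover have "P i = (P 0 \<noteq> odd i)" by (rule Suc.IH[OF Suc_lessD[OF Suc.prems]])
    ultimately show ?case unfolding even_Suc by argo
  qed simp
  from this[of "t - 1"] have "P (t - 1) = P 0" using assms by (cases t) simp_all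
  moreover have "0 < t" using assms by (cases t) simp_all
  ultimately show False using alt[of "t - 1"] by simp
qed

lemma incident_cyc_edges:
  assumes "distinct xs" "k < length xs"
  shows "incident (cyc_edges xs) (xs ! (Suc k mod length xs)) \<subseteq> {cyc_edge xs k, cyc_edge xs (Suc k mod length xs)}"
proof
  fix e assume "e \<in> incident (cyc_edges xs) (xs ! (Suc k mod length xs))"
  then obtain j where j: "j < length xs" "e = cyc_edge xs j" "xs ! (Suc k mod length xs) \<in> cyc_edge xs j"
    by (auto simp: incident_def cyc_edges_def)
  have lt: "Suc k mod length xs < length xs" "Suc j mod length xs < length xs"
    using j(1) by (intro mod_less_divisor; linarith)+
  then have "Suc k mod length xs = j \<or> Suc k mod length xs = Suc j mod length xs"
    using j assms(1) by (auto simp: cyc_edge_def nth_eq_iff_index_eq)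
  then show "e \<in> {cyc_edge xs k, cyc_edge xs (Suc k mod length xs)}"
  proof
    assume "Suc k mod length xs = Suc j mod length xs"
    then have "k = j" using assms(2) j(1) by (auto simp: mod_Suc split: if_splits)
    then show ?thesis using j by auto
  qed (use j in auto)
qed

text \<open>The apex is a \<open>Max\<close>, so it is meaningful only once some vertex is known to
  have two incident edges of one colour. This is where the length has to be odd.\<close>

lemma apex_incident:
  assumes d: "distinct xs" and odd: "odd (length xs)" and sub: "cyc_edges xs \<subseteq> R \<union> B"
  shows "apex R B (cyc_edges xs) \<in> set xs"
    "incident (cyc_edges xs) (apex R B (cyc_edges xs)) \<subseteq> R \<or> incident (cyc_edges xs) (apex R B (cyc_edges xs)) \<subseteq> B"
proof -
  let ?C = "cyc_edges xs"
  define T where "T = {v \<in> \<Union>?C. incident ?C v \<subseteq> R \<or> incident ?C v \<subseteq> B}"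
  have CRB: "cyc_edge xs i \<in> R \<union> B" if "i < length xs" for i
    using that sub by (auto simp: cyc_edges_def)
  \<comment> \<open>Edges are split into red and not red; those that are not red are blue, so edges
    with both colours cause no trouble.\<close>
  obtain i where i: "i < length xs" "(cyc_edge xs i \<in> R) = (cyc_edge xs (Suc i mod length xs) \<in> R)"
    using odd_cycle_repeats[OF odd, of "\<lambda>i. cyc_edge xs i \<in> R"] by auto
  have i': "Suc i mod length xs < length xs" using i(1) by (intro mod_less_divisor) linarith
  have "xs ! (Suc i mod length xs) \<in> cyc_edge xs (Suc i mod length xs)" by (simp add: cyc_edge_def)
  moreover have "cyc_edge xs (Suc i mod length xs) \<in> ?C" unfolding cyc_edges_def using i' by blast
  moreover have "incident ?C (xs ! (Suc i mod length xs)) \<subseteq> R \<or> incident ?C (xs ! (Suc i mod length xs)) \<subseteq> B"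
    using incident_cyc_edges[OF d i(1)] i(2) CRB[OF i(1)] CRB[OF i'] by blast
  ultimately have "xs ! (Suc i mod length xs) \<in> T" unfolding T_def by blast
  then have "T \<noteq> {}" by blast
  moreover have Txs: "T \<subseteq> set xs" using cyc_edges_subset[of _ xs] by (auto simp: T_def)
  then have "finite T" by (rule finite_subset) simp
  ultimately have "Max T \<in> T" by (intro Max_in)
  moreover have "apex R B ?C = Max T" by (simp add: apex_def T_def)
  ultimately have ap: "apex R B ?C \<in> T" by simp
  show "apex R B ?C \<in> set xs" using ap Txs by blast
  show "incident ?C (apex R B ?C) \<subseteq> R \<or> incident ?C (apex R B ?C) \<subseteq> B" using ap unfolding T_def by blast
qed

text \<open>A surviving cycle is a cycle of \<open>E\<close>, and whatever its colours one of the
  four rules deletes an edge of that very cycle.\<close>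

lemma no_cycle_after_deletion:
  assumes "odd l" and L: "linear_order_on (nsets A 2) LR" "linear_order_on (nsets A 2) LB"
    and E: "E \<subseteq> R \<union> B" "E \<subseteq> nsets A 2"
  shows "\<not> (length xs = l \<and> is_cycle (E - deleted_edges l LR LB R B E) xs)"
proof
  assume a: "length xs = l \<and> is_cycle (E - deleted_edges l LR LB R B E) xs"
  let ?C = "cyc_edges xs"
  have cyc: "is_cycle E xs" and len: "length xs = l" and d: "distinct xs" and CE: "?C \<subseteq> E" and C3: "3 \<le> length xs"
    using a by (auto simp: is_cycle_def)
  have fC: "finite ?C" by (rule finite_cyc_edges)
  have "cyc_edge xs 0 \<in> ?C" using C3 unfolding cyc_edges_def by (intro imageI lessThan_iff[THEN iffD2]) linarith
  then have ne: "?C \<noteq> {}" by blast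
  have CA: "?C \<subseteq> nsets A 2" using CE E by auto
  have key: "\<exists>e\<in>?C. e \<in> deleted_edges l LR LB R B E"
  proof (cases "?C \<subseteq> R \<or> ?C \<subseteq> B")
    case True
    obtain e1 e2 where "largest_edge LR ?C e1" "largest_edge LB ?C e2"
      using ex_largest_edge[OF L(1) fC ne CA] ex_largest_edge[OF L(2) fC ne CA] by blast
    moreover from this have "e1 \<in> ?C" "e2 \<in> ?C" by (auto simp: largest_edge_def)
    ultimately show ?thesis using True cyc len unfolding deleted_edges_def by blast
  next
    case False
    have ap: "incident ?C (apex R B ?C) \<subseteq> R \<or> incident ?C (apex R B ?C) \<subseteq> B"
      using apex_incident(2)[OF d, of R B] CE E(1) assms(1) len by blast
    have "?C \<inter> R \<noteq> {}" "?C \<inter> B \<noteq> {}" using False CE E(1) by auto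
    then obtain e1 e2 where e12: "largest_edge LR (?C \<inter> R) e1" "largest_edge LB (?C \<inter> B) e2"
      using ex_largest_edge[OF L(1), of "?C \<inter> R"] ex_largest_edge[OF L(2), of "?C \<inter> B"] fC CA by blast
    then have "e1 \<in> ?C" "e2 \<in> ?C" by (auto simp: largest_edge_def)
    then show ?thesis using e12 ap False cyc len unfolding deleted_edges_def by blast
  qed
  then show False using a by (auto simp: is_cycle_def)
qed

section \<open>A deleted edge has many walks between its ends\<close>

text \<open>Rotates the cycle so that the given edge closes it; \<open>q\<close> is the path that
  remains when this edge is removed.\<close>

lemma cycle_open:
  assumes "distinct xs" "3 \<le> length xs" "{x, y} \<in> cyc_edges xs"
  obtains q where "{hd q, last q} = {x, y}" "distinct q" "set q = set xs" "length q = length xs"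
    "cyc_edges xs = insert {x, y} (path_edges q)" "{x, y} \<notin> path_edges q"
proof -
  obtain k where k: "k < length xs" "{x, y} = cyc_edge xs k" using assms(3) by (auto simp: cyc_edges_def)
  define q where "q = drop (Suc k) xs @ take (Suc k) xs"
  have xs: "xs = take (Suc k) xs @ drop (Suc k) xs" by simp
  have len: "length q = length xs" using k by (simp add: q_def)
  have dq: "distinct q" and sq: "set q = set xs"
    using assms(1) xs unfolding q_def by (metis distinct_append inf_commute, metis set_append sup_commute)
  have lq: "last q = xs ! k" using k(1) by (simp add: q_def take_Suc_conv_app_nth)
  have hq: "hd q = xs ! (Suc k mod length xs)"
  proof (cases "Suc k = length xs")
    case True
    then show ?thesis using k(1) by (cases xs) (simp_all add: q_def)
  next
    case False
    then show ?thesis using k(1) by (simp add: q_def hd_drop_conv_nth hd_append)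
  qed
  have xy: "{hd q, last q} = {x, y}" using k(2) lq hq by (auto simp: cyc_edge_def)
  obtain a b cs where q: "q = a # b # cs" and cs: "cs \<noteq> []"
  proof -
    have "3 \<le> length q" using assms(2) len by simp
    then show ?thesis using that by (cases q; cases "tl q"; cases "tl (tl q)") auto
  qed
  have "cyc_edges xs = cyc_edges q" unfolding q_def using cyc_edges_rotate[of "take (Suc k) xs" "drop (Suc k) xs"] by simp
  also have "\<dots> = path_edges (butlast q @ last q # [hd q])"
    unfolding cyc_edges_conv using append_butlast_last_id[of q] q
    by (metis append.assoc append_Cons append_Nil list.distinct(1))
  also have "\<dots> = path_edges q \<union> {{last q, hd q}}"
    using path_edges_append[of "butlast q" "last q" "[hd q]"] append_butlast_last_id[of q] q by simp
  finally have "cyc_edges xs = insert {x, y} (path_edges q)" using xy by (auto simp: insert_commute)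
  moreover have "{x, y} \<notin> path_edges q"
  proof
    assume "{x, y} \<in> path_edges q"
    then have "{a, last cs} \<in> path_edges (a # b # cs)" using xy q cs by simp
    moreover have "a \<notin> set (b # cs)" "last cs \<noteq> b" using dq cs q by auto
    ultimately show False using path_edges_subset[of "{a, last cs}" "b # cs"] by (auto simp: doubleton_eq_iff)
  qed
  ultimately show ?thesis using that[OF xy dq sq len] by blast
qed

text \<open>All members of the part of \<open>z\<close> have the same neighbours in the
  blow-up.\<close>

lemma replace_in_blow_up:
  assumes V: "V \<in> equipartitions n r" and E: "E \<subseteq> nsets {1..n div r} 2" and uzv: "u \<in> {1..n}" "z \<in> {1..n}" "v \<in> {1..n}"
    and e: "{u, z} \<in> blow_up V E" "{z, v} \<in> blow_up V E"
  obtains Z where "Z \<subseteq> {1..n}" "card Z = r" "\<And>z'. z' \<in> Z \<Longrightarrow> {u, z'} \<in> blow_up V E \<and> {z', v} \<in> blow_up V E"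
proof -
  obtain a b c where p: "a \<in> {1..n div r}" "u \<in> V a" "b \<in> {1..n div r}" "z \<in> V b" "c \<in> {1..n div r}" "v \<in> V c"
    using equipartitionsD(7)[OF V] uzv by meson
  have "{a, b} \<in> E" "{b, c} \<in> E"
    using blow_up_iff[OF V E p(1,3,2,4)] blow_up_iff[OF V E p(3,5,4,6)] e by auto
  then show ?thesis
    using that[of "V b"] equipartitionsD(1,2)[OF V p(3)] blow_up_iff[OF V E p(1,3,2)] blow_up_iff[OF V E p(3,5) _ p(6)] by blast
qed

lemma blow_up_mono: "E \<subseteq> E' \<Longrightarrow> blow_up V E \<subseteq> blow_up V E'"
  by (auto simp: blow_up_def)

lemma blow_up_edgeE:
  assumes V: "V \<in> equipartitions n r" and E: "E \<subseteq> nsets {1..n div r} 2" and e: "e \<in> blow_up V E"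
  obtains a b u v where "a \<in> {1..n div r}" "b \<in> {1..n div r}" "a \<noteq> b" "{a, b} \<in> E" "u \<in> V a" "v \<in> V b" "e = {u, v}" "u \<noteq> v"
    "e \<in> nsets {1..n} 2"
proof -
  obtain a b u v where *: "{a, b} \<in> E" "u \<in> V a" "v \<in> V b" "e = {u, v}"
    using e by (auto simp: blow_up_def between_def)
  obtain a' b' where "{a, b} = {a', b'}" "a' \<in> {1..n div r}" "b' \<in> {1..n div r}" "a' \<noteq> b'"
    using nsets2E[of "{a, b}" "{1..n div r}"] * E by (metis in_mono)
  then have ab: "a \<in> {1..n div r}" "b \<in> {1..n div r}" "a \<noteq> b" by (auto simp: doubleton_eq_iff)
  then have "u \<noteq> v" using equipartitionsD(6)[OF V ab(1,2)] * by auto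
  moreover have "u \<in> {1..n}" "v \<in> {1..n}" using equipartitionsD(1)[OF V] * ab by blast+
  ultimately show ?thesis using that[OF ab *] *(4) nsets2I by auto
qed

lemma blow_up_nsets:
  assumes "V \<in> equipartitions n r" "E \<subseteq> nsets {1..n div r} 2"
  shows "blow_up V E \<subseteq> nsets {1..n} 2"
  using blow_up_edgeE[OF assms] by blast

lemma surviving_nonsimple:
  assumes "odd_broken E (common_part m V W) Z" "set Z \<subseteq> surviving l n m V W E" "length Z \<le> l - 1"
  shows "\<not> simple_wrt m V W (cyc_edges Z \<inter> E)"
proof
  assume s: "simple_wrt m V W (cyc_edges Z \<inter> E)"
  have "set Z \<subseteq> {1..n}" using assms(2) by (auto simp: surviving_def)
  then have b: "broken_cycle n m V W E Z" "odd (card {i. i < length Z \<and> cyc_edge Z i \<in> E})"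
    using odd_broken_iff[of n m V W E Z] assms(1) by blast+
  have "Z \<noteq> []" using b(2) by (cases Z) auto
  then have "hd Z \<in> set Z" by simp
  moreover have "set Z \<subseteq> \<Union>{set xs | xs. broken_cycle n m V W E xs \<and> simple_wrt m V W (cyc_edges xs \<inter> E) \<and>
     length xs \<le> l - 1 \<and> odd (card {i. i < length xs \<and> cyc_edge xs i \<in> E})}"
    using b s assms(3) by blast
  ultimately show False using assms(2) unfolding surviving_def by blast
qed

lemma cycle_odd_broken:
  assumes "is_cycle E xs" "odd (length xs)"
  shows "odd_broken E C xs"
proof -
  have e: "cyc_edge xs i \<in> E" if "i < length xs" for i
    using assms(1) that by (auto simp: is_cycle_def cyc_edges_def)
  then have "{i. i < length xs \<and> cyc_edge xs i \<in> E} = {..<length xs}" by auto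
  then have "odd (num_actual E (xs @ [hd xs]))" using assms(2) by (simp flip: num_actual_closed)
  moreover have "successively (\<lambda>x y. {x, y} \<in> E \<or> C x y) (xs @ [hd xs])"
    unfolding successively_closed[symmetric] using e by (auto simp: cyc_edge_def)
  ultimately show ?thesis using assms(1) by (simp add: odd_broken_def is_cycle_def)
qed

text \<open>
  A chord inside a common part splits an odd cycle; the odd half survives the vertex deletion
  only thanks to an exceptional pair, which is then close to the ends of the chord.
\<close>

lemma no_common_part_on_cycle:
  assumes cyc: "is_cycle E xs" "length xs = 2 * h + 3" and X: "set xs \<subseteq> surviving (2 * h + 3) n m V W E"
    and E: "E \<subseteq> nsets {1..n} 2" and xu: "x \<in> set xs" "u \<in> set xs" "x \<noteq> u" "common_part m V W x u"
    and far: "x \<notin> reach {1..n} (\<lambda>x y. {x, y} \<in> E \<or> common_part m V W x y) h (bad_vertices n m V W E)"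
  shows False
proof -
  let ?C = "common_part m V W" and ?D = "bad_vertices n m V W E"
  let ?X = "surviving (2 * h + 3) n m V W E"
  have Xn: "?X \<subseteq> {1..n}" by (auto simp: surviving_def)
  have bad: "x \<notin> ?D" using far reach_mono[of 0 h "{1..n}" "\<lambda>x y. {x, y} \<in> E \<or> ?C x y" ?D] by auto
  have "x \<in> {1..n}" "u \<in> {1..n}" using xu(1,2) X Xn by blast+
  then have ne: "{x, u} \<notin> E" using bad xu(4) by (auto simp: bad_vertices_def)
  have nc: "{x, u} \<notin> cyc_edges xs" using ne cyc(1) by (auto simp: is_cycle_def)
  have odd: "odd_broken E ?C xs" using cycle_odd_broken[OF cyc(1)] cyc(2) by simp
  obtain Z where Z: "odd_broken E ?C Z" "length Z < length xs" "set Z \<subseteq> set xs" "x \<in> set Z"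
    by (rule odd_broken_chord[OF odd common_part_sym xu(1-3) nc ne xu(4)])
  have len: "length Z \<le> 2 * h + 2" using Z(2) cyc(2) by simp
  have ZX: "set Z \<subseteq> ?X" using Z(3) X by blast
  have "\<exists>a\<in>set Z. \<exists>b\<in>set Z. {a, b} \<in> E \<and> ?C a b"
    by (rule odd_broken_bad_pair[OF surviving_nonsimple Z(1) ZX len]) auto
  then obtain a b where ab: "a \<in> set Z" "b \<in> set Z" "{a, b} \<in> E" "?C a b" by blast
  have abn: "a \<in> {1..n}" "b \<in> {1..n}" using ab(1,2) ZX Xn by blast+
  have "a \<noteq> b" using ab(3) E by (auto simp: nsets_def)
  moreover have "a \<in> ?D" using abn ab(3,4) by (auto simp: bad_vertices_def)
  moreover have "b \<in> ?D" using abn ab(3) common_part_sym[OF ab(4)] by (auto simp: bad_vertices_def insert_commute)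
  moreover have "set Z \<subseteq> {1..n}" using ZX Xn by blast
  ultimately have "x \<in> reach {1..n} (\<lambda>x y. {x, y} \<in> E \<or> ?C x y) h ?D"
    using reach_cycle[OF Z(1) _ len Z(4) ab(1,2) _ _ _ common_part_sym] by blast
  then show False using far by blast
qed

lemma distinct_interior:
  assumes "z \<in> set q" "z \<noteq> hd q" "z \<noteq> last q"
  obtains ps u v qs where "q = ps @ u # z # v # qs"
proof -
  obtain as bs where q: "q = as @ z # bs" using split_list[OF assms(1)] by blast
  have "as \<noteq> []" using q assms(2) by auto
  then obtain ps u where "as = ps @ [u]" by (metis rev_exhaust)
  moreover have "bs \<noteq> []" using q assms(3) by auto
  then obtain v qs where "bs = v # qs" by (cases bs) auto
  ultimately show ?thesis using q that by auto
qed

lemma path_edges_middle: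
  "{u, z} \<in> path_edges (ps @ u # z # v # qs)" "{z, v} \<in> path_edges (ps @ u # z # v # qs)"
  using path_edges_append[of ps u "z # v # qs"] by auto

text \<open>The contrapositive says that an edge on an open pair survives. The graph
  \<open>low\<close> contains all blue edges, which are revealed beforehand, but only the red blocks
  preceding that of \<open>{i, j}\<close>; this is what makes openness adapted. The conclusion is a
  disjunction because the walks are found in the direction in which the cycle is traversed.\<close>

lemma deleted_red_edge_walks:
  assumes V: "V \<in> equipartitions n r" and W: "W \<in> equipartitions n r" and r: "0 < r" and m: "m = n div r"
    and ER: "ER \<subseteq> nsets {1..m} 2" and EB: "EB \<subseteq> nsets {1..m} 2"
    and LR: "block_ordering n m V LR" and l: "l = 2 * h + 3" "5 \<le> l"
    and R: "R = blow_up V ER" and B: "B = blow_up W EB"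
    and E: "E = (R \<union> B) \<inter> nsets (surviving l n m V W (R \<union> B)) 2"
    and D: "D = reach {1..n} (\<lambda>x y. {x, y} \<in> R \<union> B \<or> common_part m V W x y) h (bad_vertices n m V W (R \<union> B))"
    and xy: "x \<notin> D" "y \<notin> D" "i \<in> {1..m}" "j \<in> {1..m}" "x \<in> V i" "y \<in> V j" "{i, j} \<in> ER" "{x, y} \<notin> B"
    and del: "{x, y} \<in> deleted_edges l LR LB R B E"
    and low: "low = blow_up V {P \<in> ER. pair_rank n LR V P < pair_rank n LR V {i, j}} \<union> B"
  shows "r \<le> walks {1..n} low (l - 1) {y} x \<or> r \<le> walks {1..n} low (l - 1) {x} y"
proof -
  let ?e = "{x, y}" and ?X = "surviving l n m V W (R \<union> B)"
  let ?lowR = "{P \<in> ER. pair_rank n LR V P < pair_rank n LR V {i, j}}"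
  note ER' = ER[unfolded m] and EB' = EB[unfolded m] and LR' = LR[unfolded m]
  have lowR: "?lowR \<subseteq> nsets {1..n div r} 2" using ER' by blast
  have ij: "i \<noteq> j" using xy(7) ER by (auto simp: nsets_def)
  have Rn: "R \<subseteq> nsets {1..n} 2" unfolding R by (rule blow_up_nsets[OF V ER'])
  have Bn: "B \<subseteq> nsets {1..n} 2" unfolding B by (rule blow_up_nsets[OF W EB'])
  have RBn: "R \<union> B \<subseteq> nsets {1..n} 2" using Rn Bn by blast
  from del obtain xs where cyc: "length xs = l" "is_cycle E xs"
    and which: "\<not> cyc_edges xs \<subseteq> R \<and> \<not> cyc_edges xs \<subseteq> B \<and> incident (cyc_edges xs) (apex R B (cyc_edges xs)) \<subseteq> R \<and> largest_edge LB (cyc_edges xs \<inter> B) ?e \<or>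
      \<not> cyc_edges xs \<subseteq> R \<and> \<not> cyc_edges xs \<subseteq> B \<and> incident (cyc_edges xs) (apex R B (cyc_edges xs)) \<subseteq> B \<and> largest_edge LR (cyc_edges xs \<inter> R) ?e \<or>
      cyc_edges xs \<subseteq> R \<and> largest_edge LR (cyc_edges xs) ?e \<or>
      cyc_edges xs \<subseteq> B \<and> largest_edge LB (cyc_edges xs) ?e"
    unfolding deleted_edges_def by blast
  let ?C = "cyc_edges xs"
  have CE: "?C \<subseteq> E" and dist: "distinct xs" and l3: "3 \<le> length xs" using cyc by (auto simp: is_cycle_def)
  have eC: "?e \<in> ?C" using which by (auto simp: largest_edge_def)
  \<comment> \<open>The first and the last deletion rule delete blue edges, and
    \<open>{x, y}\<close> is not blue.\<close>
  have kinds: "(incident ?C (apex R B ?C) \<subseteq> B \<and> \<not> ?C \<subseteq> R) \<or> ?C \<subseteq> R"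
    and larg: "\<And>f. f \<in> ?C \<Longrightarrow> f \<in> R \<Longrightarrow> (f, ?e) \<in> LR"
    using which xy(8) by (auto simp: largest_edge_def)
  have sX: "set xs \<subseteq> ?X"
  proof
    fix v assume "v \<in> set xs"
    then obtain k where k: "k < length xs" "v = xs ! k" by (metis in_set_conv_nth)
    then have "cyc_edge xs k \<in> ?C" "v \<in> cyc_edge xs k" by (auto simp: cyc_edges_def cyc_edge_def)
    then show "v \<in> ?X" using CE E by (auto simp: nsets_def)
  qed
  have cyc': "is_cycle (R \<union> B) xs" using cyc(2) E by (auto simp: is_cycle_def)
  have ee: "?e \<in> R" using blow_up_iff[OF V ER' xy(3)[unfolded m] xy(4)[unfolded m] xy(5,6)] xy(7) R by simp
  obtain q where q: "{hd q, last q} = {x, y}" "distinct q" "set q = set xs" "length q = length xs"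
    "?C = insert ?e (path_edges q)" "?e \<notin> path_edges q"
    by (rule cycle_open[OF dist l3 eC])
  have xym: "x \<in> set xs" "y \<in> set xs" using cyc_edges_subset[OF eC] by auto
  have cl: "length xs = 2 * h + 3" using cyc(1) l by simp
  have X': "set xs \<subseteq> surviving (2 * h + 3) n m V W (R \<union> B)" using sX l by simp
  have noc: "False" if "w \<in> {x, y}" "u \<in> set xs" "w \<noteq> u" "k \<in> {1..m}" "w \<in> V k" "u \<in> V k" for w u k
  proof (rule no_common_part_on_cycle[OF cyc' cl X' RBn _ that(2,3)])
    show "w \<in> set xs" using that xym by auto
    show "common_part m V W w u" using that unfolding common_part_def by blast
    show "w \<notin> reach {1..n} (\<lambda>x y. {x, y} \<in> R \<union> B \<or> common_part m V W x y) h (bad_vertices n m V W (R \<union> B))"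
      using that(1) xy(1,2) D by blast
  qed
  have plow: "f \<in> blow_up V ?lowR" if f: "f \<in> path_edges q" "f \<in> R" for f
  proof -
    obtain a b u v where ab: "a \<in> {1..n div r}" "b \<in> {1..n div r}" "a \<noteq> b" "{a, b} \<in> ER"
      "u \<in> V a" "v \<in> V b" "f = {u, v}" "u \<noteq> v" "f \<in> nsets {1..n} 2"
      using f(2) unfolding R by (rule blow_up_edgeE[OF V ER'])
    have fC: "f \<in> ?C" using f(1) q(5) by blast
    have fe: "f \<noteq> ?e" using f(1) q(6) by blast
    have uv: "u \<in> set xs" "v \<in> set xs" using cyc_edges_subset[OF fC] ab(7) by auto
    \<comment> \<open>A further cycle edge in the block of \<open>{x, y}\<close> would have an end
      that shares a part with \<open>x\<close> or with \<open>y\<close> without being equal to it,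
      contrary to \<open>noc\<close>.\<close>
    have "{a, b} \<noteq> {i, j}"
    proof
      assume "{a, b} = {i, j}"
      then consider "a = i" "b = j" | "a = j" "b = i" by (auto simp: doubleton_eq_iff)
      then show False
      proof cases
        case 1
        then have "x \<noteq> u \<or> y \<noteq> v" using fe ab(7) by auto
        then show False using noc[of x u i] noc[of y v j] uv xy(3-6) ab(5,6) 1 by auto
      next
        case 2
        then have "x \<noteq> v \<or> y \<noteq> u" using fe ab(7) by auto
        then show False using noc[of x v i] noc[of y u j] uv xy(3-6) ab(5,6) 2 by auto
      qed
    qed
    moreover have "f \<in> between (V a) (V b)" "?e \<in> between (V i) (V j)"
      using ab(5-7) xy(5,6) by (auto simp: between_def)
    moreover have "?e \<in> nsets {1..n} 2" using ee Rn by blast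
    ultimately have "pair_rank n LR V {a, b} < pair_rank n LR V {i, j}"
      using pair_rank_less[OF V r LR' ab(1-3) xy(3)[unfolded m] xy(4)[unfolded m] ij] larg[OF fC f(2)] ab(9) by blast
    then show ?thesis
      using blow_up_iff[OF V lowR ab(1,2,5,6)] ab(4,7) by simp
  qed
  have qlow: "path_edges q \<subseteq> low"
  proof
    fix f assume f: "f \<in> path_edges q"
    then have "f \<in> R \<union> B" using q(5) CE E by auto
    then show "f \<in> low" using plow[OF f] low by auto
  qed
  have qn: "set q \<subseteq> {1..n}" using q(3) sX by (auto simp: surviving_def)
  have rep: "r \<le> walks {1..n} low (l - 1) {last q} (hd q)"
    if pq: "q = ps @ u # z # v # qs" and P: "P \<in> equipartitions n r" "F \<subseteq> nsets {1..n div r} 2" "blow_up P F \<subseteq> low"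
      and uz: "{u, z} \<in> blow_up P F" "{z, v} \<in> blow_up P F" for ps u z v qs P F
  proof -
    have mem: "u \<in> {1..n}" "z \<in> {1..n}" "v \<in> {1..n}" using qn pq by auto
    obtain Z where Z: "Z \<subseteq> {1..n}" "card Z = r" "\<And>z'. z' \<in> Z \<Longrightarrow> {u, z'} \<in> blow_up P F \<and> {z', v} \<in> blow_up P F"
      by (rule replace_in_blow_up[OF P(1,2) mem uz]) (rule that)
    have "card Z \<le> walks {1..n} low (length ps + length qs + 2) {last (v # qs)} (hd (ps @ [u]))"
    proof (rule walks_replaceable)
      show "{u, z'} \<in> low \<and> {z', v} \<in> low" if "z' \<in> Z" for z' using Z(3)[OF that] P(3) by blast
    qed (use qn qlow pq Z(1) in auto)
    moreover have "last (v # qs) = last q" "hd (ps @ [u]) = hd q" using pq by (auto simp: hd_append)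
    moreover have "length ps + length qs + 2 = l - 1" using q(4) cyc(1) pq by simp
    ultimately show ?thesis using Z(2) by simp
  qed
  have "r \<le> walks {1..n} low (l - 1) {last q} (hd q)"
    using kinds
  proof
    assume "?C \<subseteq> R"
    then have qR: "path_edges q \<subseteq> blow_up V ?lowR" using plow q(5) by blast
    obtain u z v qs where pq: "q = [] @ u # z # v # qs"
    proof -
      have "5 \<le> length q" using q(4) cyc(1) l by simp
      then show ?thesis using that by (cases q; cases "tl q"; cases "tl (tl q)") auto
    qed
    have "{u, z} \<in> path_edges q" "{z, v} \<in> path_edges q"
      unfolding pq by (rule path_edges_middle)+
    then show ?thesis using rep[OF pq V lowR] low qR by blast
  next
    assume *: "incident ?C (apex R B ?C) \<subseteq> B \<and> \<not> ?C \<subseteq> R"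
    define z where "z = apex R B ?C"
    have inc: "incident ?C z \<subseteq> B" using * by (simp add: z_def)
    \<comment> \<open>Both cycle edges at the apex are blue while \<open>{x, y}\<close> is not, so
      the apex is an inner vertex of \<open>q\<close> and can be moved.\<close>
    have zne: "z \<notin> ?e" using inc eC xy(8) unfolding incident_def by blast
    have "?C \<subseteq> R \<union> B" using cyc' by (simp add: is_cycle_def)
    then have "z \<in> set q" using apex_incident(1)[OF dist, of R B] cl q(3) by (simp add: z_def)
    moreover have "z \<noteq> hd q" "z \<noteq> last q" using zne q(1) by auto
    ultimately obtain ps u v qs where pq: "q = ps @ u # z # v # qs" by (rule distinct_interior)
    have "{u, z} \<in> path_edges q" "{z, v} \<in> path_edges q"
      unfolding pq by (rule path_edges_middle)+
    then have "{u, z} \<in> B" "{z, v} \<in> B" using inc q(5) unfolding incident_def by auto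
    then show ?thesis using rep[OF pq W EB'] low B by blast
  qed
  moreover have "(hd q = x \<and> last q = y) \<or> (hd q = y \<and> last q = x)" using q(1) by (auto simp: doubleton_eq_iff)
  ultimately show ?thesis by auto
qed

section \<open>Symmetry of the construction under interchanging the colours\<close>

lemma common_part_swap: "common_part m V W = common_part m W V"
  by (intro ext) (auto simp: common_part_def)

lemma surviving_swap: "surviving l n m V W E = surviving l n m W V E"
proof -
  have "simple_wrt m V W = simple_wrt m W V" by (intro ext) (auto simp: simple_wrt_def)
  then show ?thesis by (simp add: surviving_def broken_cycle_def common_part_swap[of m V W])
qed

lemma deleted_edges_swap: "deleted_edges l LR LB R B E = deleted_edges l LB LR B R E"
proof -
  have "apex R B C = apex B R C" for C unfolding apex_def by (metis (no_types, lifting))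
  then show ?thesis unfolding deleted_edges_def by (intro Collect_cong) (simp only:, blast)
qed

section \<open>Two random equipartitions\<close>

lemma finite_equipartitions: "finite (equipartitions n r)"
  by (rule finite_subset[of _ "{1..n div r} \<rightarrow>\<^sub>E Pow {1..n}"]) (auto simp: equipartitions_def intro: finite_PiE)

lemma equipartitions_nonempty:
  assumes "0 < r" "r dvd n"
  shows "equipartitions n r \<noteq> {}"
proof -
  define V where "V = (\<lambda>i\<in>{1..n div r}. {(i - 1) * r + 1..i * r})"
  have part: "x \<in> V i \<longleftrightarrow> (x - 1) div r = i - 1 \<and> 1 \<le> x" if i: "i \<in> {1..n div r}" for i x
  proof -
    obtain j where j: "i = Suc j" using i by (cases i) auto
    have "x \<in> V i \<longleftrightarrow> j * r + 1 \<le> x \<and> x \<le> (j + 1) * r" using i by (simp add: V_def j)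
    also have "\<dots> \<longleftrightarrow> 1 \<le> x \<and> j * r \<le> x - 1 \<and> x - 1 < (j + 1) * r" using assms(1) by auto
    also have "\<dots> \<longleftrightarrow> 1 \<le> x \<and> (x - 1) div r = j"
      using less_eq_div_iff_mult_less_eq[OF assms(1), of j "x - 1"] div_less_iff_less_mult[OF assms(1), of "x - 1" "j + 1"]
      by (auto simp del: mult_Suc)
    finally show ?thesis by (auto simp: j)
  qed
  have n: "n div r * r = n" using assms by simp
  have "V \<in> equipartitions n r"
    unfolding equipartitions_def
  proof (intro CollectI conjI)
    have le: "i * r \<le> n" if "i \<in> {1..n div r}" for i
      using that n mult_le_mono1[of i "n div r" r] by simp
    show "V \<in> {1..n div r} \<rightarrow>\<^sub>E Pow {1..n}"
    proof (rule PiE_I)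
      fix i assume i: "i \<in> {1..n div r}"
      have "i * r \<le> n" by (rule le[OF i])
      then show "V i \<in> Pow {1..n}" using i by (auto simp: V_def)
    qed (auto simp: V_def)
    show "disjoint_family_on V {1..n div r}"
      unfolding disjoint_family_on_def using part by (fastforce simp: set_eq_iff)
    show "(\<Union>j\<in>{1..n div r}. V j) = {1..n}"
    proof (intro equalityI subsetI)
      fix x assume "x \<in> (\<Union>j\<in>{1..n div r}. V j)"
      then obtain i where i: "i \<in> {1..n div r}" "x \<in> V i" by blast
      then show "x \<in> {1..n}" using le[OF i(1)] by (auto simp: V_def)
    next
      fix x assume x: "x \<in> {1..n}"
      have "(x - 1) div r < n div r"
        using x n assms(1) by (intro div_less_dividend[THEN less_le_trans] less_mult_imp_div_less) auto
      then have "Suc ((x - 1) div r) \<in> {1..n div r}" by simp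
      moreover from this have "x \<in> V (Suc ((x - 1) div r))" using part x by simp
      ultimately show "x \<in> (\<Union>j\<in>{1..n div r}. V j)" by blast
    qed
    show "\<forall>j\<in>{1..n div r}. card (V j) = r"
    proof
      fix j assume j: "j \<in> {1..n div r}"
      then have "card (V j) = Suc (j * r) - ((j - 1) * r + 1)" by (simp add: V_def)
      also have "\<dots> = j * r - (j - 1) * r" by simp
      also have "\<dots> = r" using j by (cases j) auto
      finally show "card (V j) = r" .
    qed
  qed
  then show ?thesis by blast
qed

lemma ex_bij_mapping_subset:
  assumes "finite N" "K \<subseteq> N" "K' \<subseteq> N" "card K = card K'"
  obtains f where "bij_betw f N N" "f ` K = K'"
proof -
  have fin: "finite K" "finite K'" "finite (N - K)" "finite (N - K')" using assms finite_subset by auto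
  obtain g where g: "bij_betw g K K'" using finite_same_card_bij[OF fin(1,2) assms(4)] by blast
  have "card (N - K) = card (N - K')" using assms fin by (simp add: card_Diff_subset)
  then obtain h where h: "bij_betw h (N - K) (N - K')" using finite_same_card_bij[OF fin(3,4)] by blast
  define f where "f = (\<lambda>x. if x \<in> K then g x else h x)"
  have f1: "bij_betw f K K'" using g by (rule bij_betw_cong[THEN iffD1, rotated]) (simp add: f_def)
  have f2: "bij_betw f (N - K) (N - K')" using h by (rule bij_betw_cong[THEN iffD1, rotated]) (simp add: f_def)
  have "bij_betw f (K \<union> (N - K)) (K' \<union> (N - K'))" by (rule bij_betw_combine[OF f1 f2]) auto
  then have "bij_betw f N N" using assms(2,3) by (simp add: Un_absorb1)
  moreover have "f ` K = K'" using f1 by (simp add: bij_betw_def)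
  ultimately show ?thesis using that by blast
qed

lemma equipartition_image:
  assumes V: "V \<in> equipartitions n r" and f: "bij_betw f {1..n} {1..n}"
  shows "(\<lambda>i\<in>{1..n div r}. f ` V i) \<in> equipartitions n r"
proof -
  have inj: "inj_on f {1..n}" and im: "f ` {1..n} = {1..n}" using f by (auto simp: bij_betw_def)
  note VD = equipartitionsD[OF V]
  show ?thesis
    unfolding equipartitions_def
  proof (intro CollectI conjI)
    show "(\<lambda>i\<in>{1..n div r}. f ` V i) \<in> {1..n div r} \<rightarrow>\<^sub>E Pow {1..n}"
    proof (rule restrict_PiE_iff[THEN iffD2], rule ballI)
      fix i assume "i \<in> {1..n div r}"
      then have "f ` V i \<subseteq> f ` {1..n}" using VD(1) by blast
      then show "f ` V i \<in> Pow {1..n}" using im by simp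
    qed
    show "disjoint_family_on (\<lambda>i\<in>{1..n div r}. f ` V i) {1..n div r}"
      unfolding disjoint_family_on_def
    proof (intro ballI impI)
      fix i j assume ij: "i \<in> {1..n div r}" "j \<in> {1..n div r}" "i \<noteq> j"
      have "V i \<inter> V j = {}" using VD(4) ij by (auto simp: disjoint_family_on_def)
      then have "f ` V i \<inter> f ` V j = {}"
        using inj_on_image_Int[OF inj VD(1)[OF ij(1)] VD(1)[OF ij(2)]] by simp
      then show "(\<lambda>i\<in>{1..n div r}. f ` V i) i \<inter> (\<lambda>i\<in>{1..n div r}. f ` V i) j = {}" using ij by simp
    qed
    have "(\<Union>j\<in>{1..n div r}. f ` V j) = f ` (\<Union>j\<in>{1..n div r}. V j)" by (simp add: image_UN)
    then show "(\<Union>j\<in>{1..n div r}. (\<lambda>i\<in>{1..n div r}. f ` V i) j) = {1..n}" using VD(5) im by simp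
    show "\<forall>j\<in>{1..n div r}. card ((\<lambda>i\<in>{1..n div r}. f ` V i) j) = r"
    proof
      fix j assume j: "j \<in> {1..n div r}"
      have "card (f ` V j) = card (V j)" using inj_on_subset[OF inj VD(1)[OF j]] by (rule card_image)
      then show "card ((\<lambda>i\<in>{1..n div r}. f ` V i) j) = r" using VD(2)[OF j] j by simp
    qed
  qed
qed

text \<open>A permutation of the vertices that carries \<open>K\<close> to \<open>K'\<close> acts
  injectively on equipartitions. Applied in both directions, the inequality becomes an
  equality.\<close>

lemma card_equipartitions_covering_le:
  assumes "K \<subseteq> {1..n}" "K' \<subseteq> {1..n}" "card K = card K'" "J \<subseteq> {1..n div r}"
  shows "card {W \<in> equipartitions n r. K \<subseteq> (\<Union>j\<in>J. W j)} \<le> card {W \<in> equipartitions n r. K' \<subseteq> (\<Union>j\<in>J. W j)}"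
proof -
  obtain f where f: "bij_betw f {1..n} {1..n}" "f ` K = K'"
    using ex_bij_mapping_subset[OF finite_atLeastAtMost assms(1-3)] by blast
  define F where "F = (\<lambda>W. \<lambda>i\<in>{1..n div r}. f ` (W i :: nat set))"
  have inj: "inj_on f {1..n}" using f by (simp add: bij_betw_def)
  show ?thesis
  proof (rule card_inj_on_le[of F])
    show "inj_on F {W \<in> equipartitions n r. K \<subseteq> (\<Union>j\<in>J. W j)}"
    proof (rule inj_onI)
      fix W W' assume W: "W \<in> {W \<in> equipartitions n r. K \<subseteq> (\<Union>j\<in>J. W j)}"
        and W': "W' \<in> {W \<in> equipartitions n r. K \<subseteq> (\<Union>j\<in>J. W j)}" and eq: "F W = F W'"
      show "W = W'"
      proof
        fix i
        show "W i = W' i"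
        proof (cases "i \<in> {1..n div r}")
          case True
          then have "f ` W i = f ` W' i" using fun_cong[OF eq, of i] by (simp add: F_def)
          then show ?thesis
            using inj_on_image_eq_iff[OF inj, of "W i" "W' i"] equipartitionsD(1)[OF _ True] W W' by auto
        next
          case False
          \<comment> \<open>Equipartitions are extensional functions, so two of them also agree
            outside the index set.\<close>
          have "U i = undefined" if "U \<in> equipartitions n r" for U
          proof -
            have "U \<in> {1..n div r} \<rightarrow>\<^sub>E Pow {1..n}" using that by (simp add: equipartitions_def)
            then show ?thesis using False by (rule PiE_arb)
          qed
          from this[of W] this[of W'] show ?thesis using W W' by simp
        qed
      qed
    qed
    show "F ` {W \<in> equipartitions n r. K \<subseteq> (\<Union>j\<in>J. W j)} \<subseteq> {W \<in> equipartitions n r. K' \<subseteq> (\<Union>j\<in>J. W j)}"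
    proof
      fix U assume "U \<in> F ` {W \<in> equipartitions n r. K \<subseteq> (\<Union>j\<in>J. W j)}"
      then obtain W where UW: "U = F W" and "W \<in> {W \<in> equipartitions n r. K \<subseteq> (\<Union>j\<in>J. W j)}"
        by (rule imageE)
      then have W: "U = F W" "W \<in> equipartitions n r" "K \<subseteq> (\<Union>j\<in>J. W j)" by simp_all
      have Uj: "U j = f ` W j" if "j \<in> J" for j
        using subsetD[OF assms(4) that] unfolding UW F_def by simp
      have "K' = f ` K" by (simp only: f(2))
      also have "\<dots> \<subseteq> f ` (\<Union>j\<in>J. W j)" by (rule image_mono[OF W(3)])
      also have "\<dots> = (\<Union>j\<in>J. U j)" using Uj by (simp add: image_UN)
      finally have "K' \<subseteq> (\<Union>j\<in>J. U j)" .
      moreover have "U \<in> equipartitions n r" unfolding W(1) F_def by (rule equipartition_image[OF W(2) f(1)])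
      ultimately show "U \<in> {W \<in> equipartitions n r. K' \<subseteq> (\<Union>j\<in>J. W j)}" by blast
    qed
    show "finite {W \<in> equipartitions n r. K' \<subseteq> (\<Union>j\<in>J. W j)}" using finite_equipartitions by simp
  qed
qed

lemma card_Union_parts:
  assumes "W \<in> equipartitions n r" "J \<subseteq> {1..n div r}"
  shows "card (\<Union>j\<in>J. W j) = card J * r" "(\<Union>j\<in>J. W j) \<subseteq> {1..n}"
proof -
  note WD = equipartitionsD[OF assms(1)]
  have "finite J" using finite_subset[OF assms(2)] by simp
  moreover have "W i \<inter> W j = {}" if "i \<in> J" "j \<in> J" "i \<noteq> j" for i j
    using WD(4) that assms(2) unfolding disjoint_family_on_def by blast
  moreover have "finite (W j)" if "j \<in> J" for j using WD(3) that assms(2) by blast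
  ultimately have "card (\<Union>j\<in>J. W j) = (\<Sum>j\<in>J. card (W j))" by (intro card_UN_disjoint) auto
  also have "\<dots> = (\<Sum>j\<in>J. r)" using WD(2) assms(2) by (intro sum.cong) auto
  finally show "card (\<Union>j\<in>J. W j) = card J * r" by simp
  show "(\<Union>j\<in>J. W j) \<subseteq> {1..n}" using WD(1) assms(2) by blast
qed

text \<open>All \<open>k\<close>-sets are equally likely to be covered, so double counting gives the probability.\<close>

lemma card_equipartitions_covering:
  assumes J: "J \<subseteq> {1..n div r}" and K: "K \<in> nsets {1..n} k"
  shows "(n choose k) * card {W \<in> equipartitions n r. K \<subseteq> (\<Union>j\<in>J. W j)} =
     card (equipartitions n r) * (card J * r choose k)"
proof -
  let ?Q = "equipartitions n r"
  let ?U = "\<lambda>W. \<Union>j\<in>J. (W j :: nat set)"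
  have fN: "finite (nsets {1..n} k)" by (rule finite_imp_finite_nsets) simp
  have eq: "card {W \<in> ?Q. K' \<subseteq> ?U W} = card {W \<in> ?Q. K \<subseteq> ?U W}" if "K' \<in> nsets {1..n} k" for K'
    using that K J by (intro antisym card_equipartitions_covering_le) (auto simp: nsets_def)
  have "(n choose k) * card {W \<in> ?Q. K \<subseteq> ?U W} = (\<Sum>K'\<in>nsets {1..n} k. card {W \<in> ?Q. K' \<subseteq> ?U W})"
    using eq by (simp add: card_nsets)
  also have "\<dots> = (\<Sum>K'\<in>nsets {1..n} k. \<Sum>W\<in>?Q. if K' \<subseteq> ?U W then 1 else 0)"
    using finite_equipartitions by (simp add: sum.If_cases Int_def)
  also have "\<dots> = (\<Sum>W\<in>?Q. \<Sum>K'\<in>nsets {1..n} k. if K' \<subseteq> ?U W then 1 else 0)" by (rule sum.swap)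
  also have "\<dots> = (\<Sum>W\<in>?Q. card (nsets (?U W) k))"
  proof (rule sum.cong[OF refl])
    fix W assume W: "W \<in> ?Q"
    have "nsets (?U W) k = {K' \<in> nsets {1..n} k. K' \<subseteq> ?U W}"
      using card_Union_parts(2)[OF W J] by (auto simp: nsets_def)
    then show "(\<Sum>K'\<in>nsets {1..n} k. if K' \<subseteq> ?U W then 1 else 0) = card (nsets (?U W) k)"
      using fN by (simp add: sum.If_cases Int_def)
  qed
  also have "\<dots> = (\<Sum>W\<in>?Q. (card J * r choose k))"
    using card_Union_parts(1)[OF _ J] by (intro sum.cong refl) (simp add: card_nsets)
  finally show ?thesis by simp
qed

text \<open>The probability is a ratio of two binomial coefficients. Bounding the upper one by
  \<open>(exp 1 * c / k) ^ k\<close> and the lower one by \<open>(n / k) ^ k\<close> makes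
  \<open>k\<close> cancel.\<close>

lemma prob_equipartition_covering:
  assumes "0 < r" "r dvd n" and J: "J \<subseteq> {1..n div r}" and K: "K \<in> nsets {1..n} k" and k: "0 < k" "k \<le> n"
  shows "measure_pmf.prob (pmf_of_set (equipartitions n r)) {W. K \<subseteq> (\<Union>j\<in>J. W j)} \<le>
    (exp 1 * real (card J * r) / real n) ^ k"
proof -
  let ?Q = "equipartitions n r" and ?c = "card J * r"
  let ?A = "{W \<in> ?Q. K \<subseteq> (\<Union>j\<in>J. W j)}"
  have ne: "?Q \<noteq> {}" by (rule equipartitions_nonempty[OF assms(1,2)])
  have Q0: "0 < card ?Q" using ne finite_equipartitions by (simp add: card_gt_0_iff)
  have nk: "0 < real (n choose k)" using k by simp
  have "measure_pmf.prob (pmf_of_set ?Q) {W. K \<subseteq> (\<Union>j\<in>J. W j)} = real (card ?A) / real (card ?Q)"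
    using ne finite_equipartitions by (simp add: measure_pmf_of_set Int_def)
  also have "\<dots> = real (?c choose k) / real (n choose k)"
  proof -
    have "real (n choose k) * real (card ?A) = real (card ?Q) * real (?c choose k)"
      using arg_cong[OF card_equipartitions_covering[OF J K], of real] by (simp only: of_nat_mult)
    then show ?thesis using Q0 nk by (simp add: field_simps)
  qed
  also have "\<dots> \<le> (exp 1 * real ?c / real k) ^ k / (real n / real k) ^ k"
    using binomial_le_exp_power[OF k(1), of ?c] binomial_ge_n_over_k_pow_k[OF k(2), where 'a=real] k
    by (intro frac_le) auto
  also have "\<dots> = (exp 1 * real ?c / real n) ^ k"
    unfolding power_divide[symmetric] using k by simp
  finally show ?thesis .
qed

text \<open>Only \<open>W\<close> is random. For each choice of indices the union of the parts of
  \<open>V\<close> is a fixed set of \<open>s * r\<close> vertices, and a union bound runs over its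
  \<open>k\<close>-subsets.\<close>

lemma prob_large_intersection:
  assumes r: "0 < r" "r dvd n" and V: "V \<in> equipartitions n r" and k: "0 < k" "k \<le> n"
  shows "measure_pmf.prob (pmf_of_set (equipartitions n r))
     {W. \<exists>I J. I \<in> nsets {1..n div r} s \<and> J \<in> nsets {1..n div r} s \<and> k \<le> card ((\<Union>i\<in>I. V i) \<inter> (\<Union>j\<in>J. W j))} \<le>
    real n ^ (2 * s) * (exp 2 * (real (s * r))\<^sup>2 / (real k * real n)) ^ k"
proof -
  let ?P = "pmf_of_set (equipartitions n r)" and ?N = "nsets {1..n div r} s"
  have fN: "finite ?N" by (rule finite_imp_finite_nsets) simp
  have one: "measure_pmf.prob ?P {W. k \<le> card ((\<Union>i\<in>fst IJ. V i) \<inter> (\<Union>j\<in>snd IJ. W j))} \<le>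
     (exp 2 * (real (s * r))\<^sup>2 / (real k * real n)) ^ k" if IJ: "IJ \<in> ?N \<times> ?N" for IJ
  proof -
    obtain I J where ij: "IJ = (I, J)" by (cases IJ)
    have I: "I \<subseteq> {1..n div r}" "card I = s" and J: "J \<subseteq> {1..n div r}" "card J = s"
      using IJ ij by (auto simp: nsets_def)
    define U where "U = (\<Union>i\<in>I. V i)"
    have U: "card U = s * r" "U \<subseteq> {1..n}" using card_Union_parts[OF V I(1)] I(2) by (auto simp: U_def)
    have fU: "finite U" using finite_subset[OF U(2)] by simp
    have "measure_pmf.prob ?P {W. k \<le> card (U \<inter> (\<Union>j\<in>J. W j))} \<le>
       measure_pmf.prob ?P {W. \<exists>K\<in>nsets U k. K \<subseteq> (\<Union>j\<in>J. W j)}"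
    proof (rule measure_pmf.finite_measure_mono)
      show "{W. k \<le> card (U \<inter> (\<Union>j\<in>J. W j))} \<subseteq> {W. \<exists>K\<in>nsets U k. K \<subseteq> (\<Union>j\<in>J. W j)}"
      proof clarify
        fix W :: "nat \<Rightarrow> nat set" assume "k \<le> card (U \<inter> (\<Union>j\<in>J. W j))"
        then obtain T where "T \<subseteq> U \<inter> (\<Union>j\<in>J. W j)" "card T = k" "finite T" using obtain_subset_with_card_n by metis
        then show "\<exists>K\<in>nsets U k. K \<subseteq> (\<Union>j\<in>J. W j)" by (auto simp: nsets_def intro!: bexI[of _ T])
      qed
    qed simp
    also have "\<dots> \<le> (\<Sum>K\<in>nsets U k. (exp 1 * real (s * r) / real n) ^ k)"
    proof (rule prob_UN_le)
      show "finite (nsets U k)" using fU by (rule finite_imp_finite_nsets)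
      fix K assume "K \<in> nsets U k"
      then have "K \<in> nsets {1..n} k" using U(2) by (auto simp: nsets_def)
      from prob_equipartition_covering[OF r J(1) this k]
      show "measure_pmf.prob ?P {W. K \<subseteq> (\<Union>j\<in>J. W j)} \<le> (exp 1 * real (s * r) / real n) ^ k" by (simp only: J(2))
    qed
    also have "\<dots> = real (s * r choose k) * (exp 1 * real (s * r) / real n) ^ k" by (simp add: card_nsets U(1))
    also have "\<dots> \<le> (exp 1 * real (s * r) / real k) ^ k * (exp 1 * real (s * r) / real n) ^ k"
      by (intro mult_right_mono binomial_le_exp_power k) simp
    also have "\<dots> = (exp 2 * (real (s * r))\<^sup>2 / (real k * real n)) ^ k"
      by (simp add: power_mult_distrib[symmetric] power2_eq_square mult_ac flip: exp_add)
    finally show ?thesis by (simp add: ij U_def)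
  qed
  have "{W. \<exists>I J. I \<in> ?N \<and> J \<in> ?N \<and> k \<le> card ((\<Union>i\<in>I. V i) \<inter> (\<Union>j\<in>J. W j))} =
     {W. \<exists>IJ\<in>?N \<times> ?N. k \<le> card ((\<Union>i\<in>fst IJ. V i) \<inter> (\<Union>j\<in>snd IJ. W j))}" by auto
  then have "measure_pmf.prob ?P {W. \<exists>I J. I \<in> ?N \<and> J \<in> ?N \<and> k \<le> card ((\<Union>i\<in>I. V i) \<inter> (\<Union>j\<in>J. W j))} \<le>
     (\<Sum>IJ\<in>?N \<times> ?N. (exp 2 * (real (s * r))\<^sup>2 / (real k * real n)) ^ k)"
    using prob_UN_le[of "?N \<times> ?N" ?P "\<lambda>IJ W. k \<le> card ((\<Union>i\<in>fst IJ. V i) \<inter> (\<Union>j\<in>snd IJ. W j))", OF _ one] fN by simp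
  also have "\<dots> = (real (n div r choose s))\<^sup>2 * (exp 2 * (real (s * r))\<^sup>2 / (real k * real n)) ^ k"
    by (simp add: card_cartesian_product card_nsets power2_eq_square)
  also have "\<dots> \<le> (real n ^ s)\<^sup>2 * (exp 2 * (real (s * r))\<^sup>2 / (real k * real n)) ^ k"
  proof (intro mult_right_mono power_mono)
    have "(n div r) choose s \<le> (n div r) ^ s"
      using binomial_fact_pow[of "n div r" s] by (metis fact_ge_1 le_trans mult.right_neutral mult_le_mono2)
    also have "\<dots> \<le> n ^ s" by (intro power_mono) auto
    finally show "real (n div r choose s) \<le> real n ^ s" by (metis of_nat_le_iff of_nat_power)
  qed auto
  finally show ?thesis by (simp add: power_mult mult.commute[of 2])
qed

section \<open>Pseudo-randomness of the binomial random graph\<close>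

lemma sum_Pow_power_card:
  fixes y :: real
  assumes "finite A"
  shows "(\<Sum>H\<in>Pow A. y ^ card H) = (1 + y) ^ card A"
  using assms
proof (induction A rule: finite_induct)
  case (insert x F)
  have inj: "inj_on (insert x) (Pow F)"
  proof (rule inj_onI)
    fix H K assume "H \<in> Pow F" "K \<in> Pow F" "insert x H = insert x K"
    then show "H = K" using insert.hyps(2) insert_ident[of x H K] by auto
  qed
  have disj: "Pow F \<inter> insert x ` Pow F = {}"
  proof (rule equals0I)
    fix H assume "H \<in> Pow F \<inter> insert x ` Pow F"
    then have "x \<in> H" "H \<subseteq> F" by auto
    then show False using insert.hyps(2) by auto
  qed
  have "(\<Sum>H\<in>Pow (insert x F). y ^ card H) = (\<Sum>H\<in>Pow F. y ^ card H) + (\<Sum>H\<in>insert x ` Pow F. y ^ card H)"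
    unfolding Pow_insert using insert.hyps(1) disj by (intro sum.union_disjoint) auto
  also have "(\<Sum>H\<in>insert x ` Pow F. y ^ card H) = (\<Sum>H\<in>Pow F. y ^ card (insert x H))"
    by (simp add: sum.reindex[OF inj])
  also have "\<dots> = (\<Sum>H\<in>Pow F. y * y ^ card H)"
  proof (rule sum.cong[OF refl])
    fix H assume "H \<in> Pow F"
    then have "finite H" "x \<notin> H" using insert.hyps finite_subset[of H F] by auto
    then show "y ^ card (insert x H) = y * y ^ card H" by simp
  qed
  also have "(\<Sum>H\<in>Pow F. y ^ card H) + \<dots> = (1 + y) * (\<Sum>H\<in>Pow F. y ^ card H)"
    by (simp add: distrib_right sum_distrib_left sum.distrib)
  finally show ?case using insert.IH insert.hyps by simp
qed simp

text \<open>The source of the constant 8 in \<open>pseudo_random\<close>: exceeding the mean by this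
  factor makes the base of the tail in \<open>prob_gnp_many_edges\<close> at most
  \<open>exp (- 1)\<close>.\<close>

lemma exp_1_le: "exp (1::real) * exp 1 \<le> 8"
proof -
  have e: "exp (1::real) \<le> 2.72" using abs_le_D1[OF e_approx_32] by simp
  have "exp (1::real) * exp 1 \<le> 2.72 * 2.72" by (intro mult_mono e) auto
  then show ?thesis by simp
qed

lemma prob_gnp_many_edges_exp:
  assumes F: "F \<subseteq> nsets {1..m} 2" and p: "0 \<le> p" "p \<le> 1" and t: "8 * p * real c \<le> t" "real (card F) \<le> real c" and "0 \<le> t"
  shows "measure_pmf.prob (gnp m p) {E. t < real (card (F \<inter> E))} \<le> exp (- t)"
proof -
  \<comment> \<open>The least integer above \<open>t\<close>, so that \<open>t < card\<close> means
    \<open>q \<le> card\<close>.\<close>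
  define q where "q = nat \<lfloor>t\<rfloor> + 1"
  have f0: "0 \<le> \<lfloor>t\<rfloor>" using assms(6) by simp
  then have q: "0 < q" "t \<le> real q" unfolding q_def by linarith+
  have sub: "{E. t < real (card (F \<inter> E))} \<subseteq> {E. q \<le> card (F \<inter> E)}"
  proof clarify
    fix E assume "t < real (card (F \<inter> E))"
    then have "\<lfloor>t\<rfloor> < int (card (F \<inter> E))" by linarith
    then show "q \<le> card (F \<inter> E)" using f0 unfolding q_def by linarith
  qed
  have "measure_pmf.prob (gnp m p) {E. t < real (card (F \<inter> E))} \<le> measure_pmf.prob (gnp m p) {E. q \<le> card (F \<inter> E)}"
    by (rule measure_pmf.finite_measure_mono[OF sub]) simp
  also have "\<dots> \<le> (exp 1 * real (card F) * p / real q) ^ q" by (rule prob_gnp_many_edges[OF F p q(1)])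
  also have "\<dots> \<le> (exp (- 1)) ^ q"
  proof (rule power_mono)
    have "exp 1 * real (card F) * p * exp 1 \<le> 8 * (real c * p)"
    proof -
      have "exp 1 * exp 1 * (real (card F) * p) \<le> 8 * (real c * p)"
        using exp_1_le t(2) p by (intro mult_mono) auto
      then show ?thesis by (simp add: mult_ac)
    qed
    also have "\<dots> \<le> real q" using t(1) q(2) by (simp add: mult_ac)
    finally show "exp 1 * real (card F) * p / real q \<le> exp (- 1)"
      using q(1) by (simp add: field_simps exp_minus)
  qed (use p in auto)
  also have "\<dots> = exp (- real q)" by (simp flip: exp_of_nat_mult)
  also have "\<dots> \<le> exp (- t)" using q(2) by simp
  finally show ?thesis .
qed

text \<open>The exponent \<open>5 * L * max\<close> is at least half of \<open>5 * L\<close> for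
  each vertex of \<open>H\<close> and of \<open>G\<close>. The union bound over all pairs then
  factors into the square of one sum over sets, where every vertex costs
  \<open>exp (- (5 / 2 * L))\<close> against at most \<open>exp L\<close> choices.\<close>

lemma prob_gnp_not_pseudo_random:
  assumes p: "0 \<le> p" "p \<le> 1" and m: "real m \<le> exp L" and L: "0 \<le> L"
  shows "measure_pmf.prob (gnp m p) {E. \<not> pseudo_random m p (8 * real m * p) (5 * L) E} \<le>
     real m * exp (- (8 * real m * p)) + ((1 + exp (- (5 / 2 * L))) ^ m - 1)\<^sup>2"
proof -
  let ?M = "gnp m p" and ?I = "{1..m}"
  \<comment> \<open>Empty sets send no edges and cannot violate the condition. Leaving them out
    removes the term 1, so that the sum can tend to 0.\<close>
  define S where "S = Pow ?I - {{}}"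
  define star where "star = (\<lambda>i. {{i, j} | j. j \<in> ?I \<and> j \<noteq> i})"
  define bt where "bt = (\<lambda>HG. between (fst HG) (snd HG) \<inter> nsets ?I 2)"
  define t where "t = (\<lambda>HG :: nat set \<times> nat set. max (8 * p * real (card (fst HG)) * real (card (snd HG))) (5 * L * real (max (card (fst HG)) (card (snd HG)))))"
  define A1 where "A1 = {E. \<exists>i\<in>?I. 8 * real m * p < real (card (star i \<inter> E))}"
  define A2 where "A2 = {E. \<exists>HG\<in>S \<times> S. t HG < real (card (bt HG \<inter> E))}"
  have inc: "E \<in> A1 \<union> A2" if E: "E \<subseteq> nsets ?I 2" and n: "\<not> pseudo_random m p (8 * real m * p) (5 * L) E" for E
  proof -
    from E n consider i where "i \<in> ?I" "8 * real m * p < real (deg_in E ?I i)"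
      | H G where "H \<subseteq> ?I" "G \<subseteq> ?I" "t (H, G) < real (card (E \<inter> between H G))"
      unfolding pseudo_random_def t_def fst_conv snd_conv not_le[symmetric] by blast
    then show ?thesis
    proof cases
      case 1
      have "deg_in E ?I i \<le> card (star i \<inter> E)"
        unfolding deg_in_def
      proof (rule card_inj_on_le[of "\<lambda>j. {i, j}"])
        show "inj_on (\<lambda>j. {i, j}) {j \<in> ?I. {i, j} \<in> E}" by (auto simp: inj_on_def doubleton_eq_iff)
        show "(\<lambda>j. {i, j}) ` {j \<in> ?I. {i, j} \<in> E} \<subseteq> star i \<inter> E"
        proof
          fix e assume "e \<in> (\<lambda>j. {i, j}) ` {j \<in> ?I. {i, j} \<in> E}"
          then obtain j where j: "e = {i, j}" "j \<in> ?I" "{i, j} \<in> E" by blast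
          have "card {i, j} = 2" using j(3) E by (auto simp: nsets_def)
          then have "j \<noteq> i" by auto
          then show "e \<in> star i \<inter> E" using j unfolding star_def by blast
        qed
        have "star i = (\<lambda>j. {i, j}) ` {j \<in> ?I. j \<noteq> i}" unfolding star_def by blast
        then show "finite (star i \<inter> E)" by simp
      qed
      then have "8 * real m * p < real (card (star i \<inter> E))" using 1(2) by linarith
      then show ?thesis using 1(1) by (auto simp: A1_def)
    next
      case 2
      have eq: "bt (H, G) \<inter> E = E \<inter> between H G" using E by (auto simp: bt_def)
      have "E \<inter> between H G \<noteq> {}"
      proof
        assume "E \<inter> between H G = {}"
        then have "t (H, G) < 0" using 2(3) by simp
        moreover have "0 \<le> t (H, G)" using L by (simp add: t_def le_max_iff_disj)
        ultimately show False by linarith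
      qed
      then have "H \<noteq> {}" "G \<noteq> {}" by (auto simp: between_def)
      then have "(H, G) \<in> S \<times> S" using 2 by (auto simp: S_def)
      moreover have "t (H, G) < real (card (bt (H, G) \<inter> E))" using 2(3) eq by simp
      ultimately have "E \<in> A2" unfolding A2_def by blast
      then show ?thesis by simp
    qed
  qed
  have "measure_pmf.prob ?M {E. \<not> pseudo_random m p (8 * real m * p) (5 * L) E} \<le> measure_pmf.prob ?M (A1 \<union> A2)"
  proof (rule measure_pmf.finite_measure_mono_AE)
    have "E \<in> A1 \<union> A2" if "E \<in> set_pmf ?M" "\<not> pseudo_random m p (8 * real m * p) (5 * L) E" for E
      using inc[OF PowD[OF subsetD[OF set_pmf_gnp that(1)]] that(2)] .
    then show "AE E in ?M. E \<in> {E. \<not> pseudo_random m p (8 * real m * p) (5 * L) E} \<longrightarrow> E \<in> A1 \<union> A2"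
      unfolding AE_measure_pmf_iff by blast
  qed simp
  also have "\<dots> \<le> measure_pmf.prob ?M A1 + measure_pmf.prob ?M A2"
    by (rule measure_Un_le) auto
  also have "measure_pmf.prob ?M A1 \<le> (\<Sum>i\<in>?I. exp (- (8 * real m * p)))"
    unfolding A1_def
  proof (rule prob_UN_le)
    fix i assume i: "i \<in> ?I"
    have sub: "star i \<subseteq> nsets ?I 2" using i by (auto simp: star_def nsets_def card_insert_if)
    have "star i = (\<lambda>j. {i, j}) ` {j \<in> ?I. j \<noteq> i}" by (auto simp: star_def)
    then have "card (star i) \<le> card {j \<in> ?I. j \<noteq> i}" by (simp add: card_image_le)
    also have "\<dots> \<le> card ?I" by (intro card_mono) auto
    finally have "real (card (star i)) \<le> real m" by simp
    then show "measure_pmf.prob ?M {E. 8 * real m * p < real (card (star i \<inter> E))} \<le> exp (- (8 * real m * p))"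
      using p by (intro prob_gnp_many_edges_exp[OF sub p, where c=m]) (auto simp: mult_ac)
  qed simp
  also have "(\<Sum>i\<in>?I. exp (- (8 * real m * p))) = real m * exp (- (8 * real m * p))" by simp
  also have "measure_pmf.prob ?M A2 \<le> (\<Sum>HG\<in>S \<times> S. exp (- (5 / 2 * L)) ^ card (fst HG) * exp (- (5 / 2 * L)) ^ card (snd HG))"
    unfolding A2_def
  proof (rule prob_UN_le)
    show "finite (S \<times> S)" by (simp add: S_def)
    fix HG assume HG: "HG \<in> S \<times> S"
    let ?h = "card (fst HG)" and ?g = "card (snd HG)"
    have "fst HG \<in> S" "snd HG \<in> S" using HG by (auto simp: mem_Times_iff)
    then have sub: "fst HG \<subseteq> ?I" "snd HG \<subseteq> ?I" unfolding S_def by blast+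
    have fin: "finite (fst HG)" "finite (snd HG)" by (rule finite_subset[OF sub(1)], simp, rule finite_subset[OF sub(2)], simp)
    have "bt HG \<subseteq> (\<lambda>(a, b). {a, b}) ` (fst HG \<times> snd HG)" by (auto simp: bt_def between_def)
    then have "card (bt HG) \<le> card ((\<lambda>(a, b). {a, b}) ` (fst HG \<times> snd HG))"
      using fin by (intro card_mono) auto
    also have "\<dots> \<le> ?h * ?g" using fin card_image_le[of "fst HG \<times> snd HG"] by (simp add: card_cartesian_product)
    finally have c: "real (card (bt HG)) \<le> real (?h * ?g)" by (rule of_nat_mono)
    have "measure_pmf.prob ?M {E. t HG < real (card (bt HG \<inter> E))} \<le> exp (- t HG)"
    proof (rule prob_gnp_many_edges_exp[OF _ p _ c])
      show "bt HG \<subseteq> nsets ?I 2" by (simp add: bt_def)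
      show "8 * p * real (?h * ?g) \<le> t HG" by (simp add: t_def mult_ac)
      show "0 \<le> t HG" using L by (simp add: t_def le_max_iff_disj)
    qed
    also have "\<dots> \<le> exp (- (5 / 2 * L * real ?h + 5 / 2 * L * real ?g))"
    proof -
      have "5 / 2 * L * (real ?h + real ?g) \<le> 5 / 2 * L * (2 * real (max ?h ?g))"
        using L by (intro mult_left_mono) (auto simp: max_def)
      also have "\<dots> \<le> t HG" unfolding t_def by simp
      finally show ?thesis by (simp add: algebra_simps)
    qed
    also have "\<dots> = exp (- (5 / 2 * L)) ^ ?h * exp (- (5 / 2 * L)) ^ ?g"
      by (simp add: exp_add[symmetric] algebra_simps flip: exp_of_nat_mult)
    finally show "measure_pmf.prob ?M {E. t HG < real (card (bt HG \<inter> E))} \<le> exp (- (5 / 2 * L)) ^ ?h * exp (- (5 / 2 * L)) ^ ?g" .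
  qed
  also have "(\<Sum>HG\<in>S \<times> S. exp (- (5 / 2 * L)) ^ card (fst HG) * exp (- (5 / 2 * L)) ^ card (snd HG)) =
      (\<Sum>H\<in>S. exp (- (5 / 2 * L)) ^ card H)\<^sup>2"
    by (simp add: power2_eq_square sum_product sum.cartesian_product case_prod_unfold)
  also have "(\<Sum>H\<in>S. exp (- (5 / 2 * L)) ^ card H) = (1 + exp (- (5 / 2 * L))) ^ m - 1"
    using sum_Pow_power_card[of ?I "exp (- (5 / 2 * L))"] by (simp add: S_def sum_diff1)
  finally show ?thesis by simp
qed

section \<open>The expected number of short odd broken cycles\<close>

lemma prob_card_ge:
  assumes "finite T" "0 < c"
  shows "measure_pmf.prob M {x. c \<le> real (card {t \<in> T. Q t x})} \<le> (\<Sum>t\<in>T. measure_pmf.prob M {x. Q t x}) / c"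
proof -
  have int: "integrable M (\<lambda>x. \<Sum>t\<in>T. indicator {x. Q t x} x :: real)"
    by (intro Bochner_Integration.integrable_sum) (auto intro!: measure_pmf.integrable_const_bound[where B=1])
  have card: "real (card {t \<in> T. Q t x}) = (\<Sum>t\<in>T. indicator {x. Q t x} x)" for x
    using assms(1) by (simp add: indicator_def sum.If_cases Int_def)
  have "measure_pmf.prob M {x. c \<le> real (card {t \<in> T. Q t x})} =
     measure_pmf.prob M {x \<in> space M. c \<le> (\<Sum>t\<in>T. indicator {x. Q t x} x :: real)}"
    by (simp add: card)
  also have "\<dots> \<le> measure_pmf.expectation M (\<lambda>x. \<Sum>t\<in>T. indicator {x. Q t x} x :: real) / c"
    using int assms(2) by (intro integral_Markov_inequality_measure[where A="{}"]) (auto intro!: sum_nonneg)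
  also have "measure_pmf.expectation M (\<lambda>x. \<Sum>t\<in>T. indicator {x. Q t x} x :: real) =
     (\<Sum>t\<in>T. measure_pmf.prob M {x. Q t x})"
    by (subst Bochner_Integration.integral_sum) (auto intro!: measure_pmf.integrable_const_bound[where B=1])
  finally show ?thesis .
qed

definition block_of :: "nat \<Rightarrow> (nat \<Rightarrow> nat set) \<Rightarrow> nat set \<Rightarrow> nat set" where
  "block_of m V e = (SOME P. \<exists>a b. P = {a, b} \<and> a \<in> {1..m} \<and> b \<in> {1..m} \<and> a \<noteq> b \<and> e \<in> between (V a) (V b))"

lemma block_of_eq:
  assumes V: "V \<in> equipartitions n r" and "a \<in> {1..n div r}" "b \<in> {1..n div r}" "a \<noteq> b" "e \<in> between (V a) (V b)"
  shows "block_of (n div r) V e = {a, b}"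
  unfolding block_of_def
proof (rule some_equality)
  show "\<exists>a' b'. {a, b} = {a', b'} \<and> a' \<in> {1..n div r} \<and> b' \<in> {1..n div r} \<and> a' \<noteq> b' \<and> e \<in> between (V a') (V b')"
    using assms by blast
  fix P assume "\<exists>a b. P = {a, b} \<and> a \<in> {1..n div r} \<and> b \<in> {1..n div r} \<and> a \<noteq> b \<and> e \<in> between (V a) (V b)"
  then show "P = {a, b}" using between_inject[OF V _ _ assms(2,3) _ assms(5)] by blast
qed

text \<open>Edges in different blocks of the partition are present independently.\<close>

lemma prob_subset_blow_up:
  assumes V: "V \<in> equipartitions n r" and p: "0 \<le> p" "p \<le> 1" and fin: "finite F"
    and simple: "\<And>a b. a \<in> {1..n div r} \<Longrightarrow> b \<in> {1..n div r} \<Longrightarrow> a \<noteq> b \<Longrightarrow> card (F \<inter> between (V a) (V b)) \<le> 1"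
  shows "measure_pmf.prob (gnp (n div r) p) {E. F \<subseteq> blow_up V E} \<le> p ^ card F"
proof (cases "\<forall>e\<in>F. \<exists>a\<in>{1..n div r}. \<exists>b\<in>{1..n div r}. a \<noteq> b \<and> e \<in> between (V a) (V b)")
  case False
  have "F \<subseteq> blow_up V E \<Longrightarrow> E \<in> set_pmf (gnp (n div r) p) \<Longrightarrow> False" for E
  proof -
    assume sub: "F \<subseteq> blow_up V E" and "E \<in> set_pmf (gnp (n div r) p)"
    then have E: "E \<subseteq> nsets {1..n div r} 2" using set_pmf_gnp by blast
    have "\<exists>a\<in>{1..n div r}. \<exists>b\<in>{1..n div r}. a \<noteq> b \<and> e \<in> between (V a) (V b)" if e: "e \<in> F" for e
    proof -
      have eb: "e \<in> blow_up V E" using sub e by blast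
      obtain a b u v where "a \<in> {1..n div r}" "b \<in> {1..n div r}" "a \<noteq> b" "{a, b} \<in> E" "u \<in> V a" "v \<in> V b" "e = {u, v}"
        by (rule blow_up_edgeE[OF V E eb])
      then show ?thesis unfolding between_def by blast
    qed
    then show False using False by blast
  qed
  then have "measure_pmf.prob (gnp (n div r) p) {E. F \<subseteq> blow_up V E} = 0"
    by (auto simp: measure_pmf_zero_iff)
  then show ?thesis using p by simp
next
  case True
  let ?\<phi> = "block_of (n div r) V"
  have "\<forall>e\<in>F. \<exists>a b. a \<in> {1..n div r} \<and> b \<in> {1..n div r} \<and> a \<noteq> b \<and> e \<in> between (V a) (V b) \<and> ?\<phi> e = {a, b}"
  proof
    fix e assume "e \<in> F"
    then obtain a b where ab: "a \<in> {1..n div r}" "b \<in> {1..n div r}" "a \<noteq> b" "e \<in> between (V a) (V b)"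
      using True by blast
    show "\<exists>a b. a \<in> {1..n div r} \<and> b \<in> {1..n div r} \<and> a \<noteq> b \<and> e \<in> between (V a) (V b) \<and> ?\<phi> e = {a, b}"
      using ab block_of_eq[OF V ab] by (intro exI conjI)
  qed
  then obtain a b where ab: "\<And>e. e \<in> F \<Longrightarrow> a e \<in> {1..n div r} \<and> b e \<in> {1..n div r} \<and> a e \<noteq> b e \<and>
      e \<in> between (V (a e)) (V (b e)) \<and> ?\<phi> e = {a e, b e}" by metis
  \<comment> \<open>Simplicity puts different edges of \<open>F\<close> into different blocks, so
    they depend on \<open>card F\<close> different coins.\<close>
  have inj: "inj_on ?\<phi> F"
  proof (rule inj_onI)
    fix e f assume ef: "e \<in> F" "f \<in> F" "?\<phi> e = ?\<phi> f"
    have "between (V (a f)) (V (b f)) = between (V (a e)) (V (b e))"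
    proof -
      have "{a f, b f} = {a e, b e}" using ab[OF ef(1)] ab[OF ef(2)] ef(3) by simp
      then consider "a f = a e" "b f = b e" | "a f = b e" "b f = a e" by (auto simp: doubleton_eq_iff)
      then show ?thesis by cases (simp, simp only: between_sym[of "V (b e)"])
    qed
    then have "e \<in> F \<inter> between (V (a e)) (V (b e))" "f \<in> F \<inter> between (V (a e)) (V (b e))"
      using ab[OF ef(1)] ab[OF ef(2)] ef by auto
    moreover have "card (F \<inter> between (V (a e)) (V (b e))) \<le> Suc 0" using simple ab[OF ef(1)] by simp
    ultimately show "e = f" using card_le_Suc0_iff_eq[of "F \<inter> between (V (a e)) (V (b e))"] fin by blast
  qed
  have sub: "?\<phi> ` F \<subseteq> nsets {1..n div r} 2"
  proof
    fix P assume "P \<in> ?\<phi> ` F"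
    then obtain e where e: "e \<in> F" "P = ?\<phi> e" by blast
    show "P \<in> nsets {1..n div r} 2" using ab[OF e(1)] e(2) nsets2I[of "a e" "{1..n div r}" "b e"] by auto
  qed
  have "measure_pmf.prob (gnp (n div r) p) {E. F \<subseteq> blow_up V E} \<le> measure_pmf.prob (gnp (n div r) p) {E. ?\<phi> ` F \<subseteq> E}"
  proof (rule measure_pmf.finite_measure_mono_AE)
    have "?\<phi> ` F \<subseteq> E" if E: "E \<in> set_pmf (gnp (n div r) p)" and sE: "F \<subseteq> blow_up V E" for E
    proof
      fix P assume "P \<in> ?\<phi> ` F"
      then obtain e where e: "e \<in> F" "P = ?\<phi> e" by blast
      have En: "E \<subseteq> nsets {1..n div r} 2" using E set_pmf_gnp by blast
      have eb: "e \<in> blow_up V E" using sE e by blast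
      obtain a b u v where uv: "a \<in> {1..n div r}" "b \<in> {1..n div r}" "a \<noteq> b" "{a, b} \<in> E" "u \<in> V a" "v \<in> V b" "e = {u, v}"
        by (rule blow_up_edgeE[OF V En eb])
      have "?\<phi> e = {a, b}" by (rule block_of_eq[OF V uv(1-3)]) (use uv(5-7) in \<open>auto simp: between_def\<close>)
      then show "P \<in> E" using e(2) uv(4) by simp
    qed
    then show "AE E in gnp (n div r) p. E \<in> {E. F \<subseteq> blow_up V E} \<longrightarrow> E \<in> {E. ?\<phi> ` F \<subseteq> E}"
      unfolding AE_measure_pmf_iff by blast
  qed simp
  also have "\<dots> = p ^ card (?\<phi> ` F)" by (rule prob_gnp_supset[OF sub p])
  also have "card (?\<phi> ` F) = card F" by (rule card_image[OF inj])
  finally show ?thesis .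
qed

lemma simple_wrtD:
  assumes "simple_wrt m V W F" "a \<in> {1..m}" "b \<in> {1..m}" "a \<noteq> b"
  shows "card (F \<inter> between (V a) (V b)) \<le> 1" "card (F \<inter> between (W a) (W b)) \<le> 1"
proof -
  have *: "card (F \<inter> between (V a) (V b)) \<le> 1 \<and> card (F \<inter> between (W a) (W b)) \<le> 1"
    if "a \<in> {1..m}" "b \<in> {1..m}" "a < b" for a b
    by (rule mp[OF bspec[OF bspec[OF assms(1)[unfolded simple_wrt_def] that(1)] that(2)] that(3)])
  show "card (F \<inter> between (V a) (V b)) \<le> 1" "card (F \<inter> between (W a) (W b)) \<le> 1"
    using *[OF assms(2,3)] *[OF assms(3,2)] assms(4)
    by (cases "a < b"; simp add: between_sym[of "V a" "V b"] between_sym[of "W a" "W b"])+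
qed

text \<open>Each edge has to be red or blue. The union bound over the \<open>2 ^ card F\<close>
  colourings uses the independence of the two reduced graphs and costs a factor 2 per edge.\<close>

lemma prob_simple_subset:
  assumes V: "V \<in> equipartitions n r" and W: "W \<in> equipartitions n r" and p: "0 \<le> p" "p \<le> 1" and fin: "finite F"
    and simple: "simple_wrt (n div r) V W F"
  shows "measure_pmf.prob (pair_pmf (gnp (n div r) p) (gnp (n div r) p)) {(ER, EB). F \<subseteq> blow_up V ER \<union> blow_up W EB} \<le> (2 * p) ^ card F"
proof -
  let ?G = "gnp (n div r) p" and ?P = "pair_pmf (gnp (n div r) p) (gnp (n div r) p)"
  have "measure_pmf.prob ?P {(ER, EB). F \<subseteq> blow_up V ER \<union> blow_up W EB} \<le>
     measure_pmf.prob ?P {x. \<exists>F1\<in>Pow F. F1 \<subseteq> blow_up V (fst x) \<and> F - F1 \<subseteq> blow_up W (snd x)}"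
  proof (rule measure_pmf.finite_measure_mono)
    show "{(ER, EB). F \<subseteq> blow_up V ER \<union> blow_up W EB} \<subseteq> {x. \<exists>F1\<in>Pow F. F1 \<subseteq> blow_up V (fst x) \<and> F - F1 \<subseteq> blow_up W (snd x)}"
    proof clarify
      fix ER EB assume "F \<subseteq> blow_up V ER \<union> blow_up W EB"
      then show "\<exists>F1\<in>Pow F. F1 \<subseteq> blow_up V (fst (ER, EB)) \<and> F - F1 \<subseteq> blow_up W (snd (ER, EB))"
        by (intro bexI[of _ "F \<inter> blow_up V ER"]) auto
    qed
  qed simp
  also have "\<dots> \<le> (\<Sum>F1\<in>Pow F. p ^ card F)"
  proof (rule prob_UN_le)
    show "finite (Pow F)" using fin by simp
    fix F1 assume "F1 \<in> Pow F"
    then have F1: "F1 \<subseteq> F" by simp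
    have fF1: "finite F1" "finite (F - F1)" using fin F1 finite_subset by auto
    have mono: "card (F' \<inter> B) \<le> 1" if "F' \<subseteq> F" "card (F \<inter> B) \<le> 1" for F' B :: "nat set set"
      using card_mono[of "F \<inter> B" "F' \<inter> B"] that fin by (meson Int_mono finite_Int order_refl order_trans)
    have "measure_pmf.prob ?P {x. F1 \<subseteq> blow_up V (fst x) \<and> F - F1 \<subseteq> blow_up W (snd x)} =
       measure_pmf.prob ?P ({E. F1 \<subseteq> blow_up V E} \<times> {E. F - F1 \<subseteq> blow_up W E})"
      by (intro arg_cong[where f="measure_pmf.prob _"]) auto
    \<comment> \<open>Intersecting with the supports makes both sides of the rectangle countable, as
      the product formula requires.\<close>
    also have "\<dots> = measure_pmf.prob ?P (({E. F1 \<subseteq> blow_up V E} \<inter> set_pmf ?G) \<times> ({E. F - F1 \<subseteq> blow_up W E} \<inter> set_pmf ?G))"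
      by (intro measure_prob_cong_0) (auto simp: pmf_eq_0_set_pmf)
    also have "\<dots> = measure_pmf.prob ?G {E. F1 \<subseteq> blow_up V E} * measure_pmf.prob ?G {E. F - F1 \<subseteq> blow_up W E}"
      by (subst measure_pmf_prob_product) (auto simp: measure_Int_set_pmf)
    also have "\<dots> \<le> p ^ card F1 * p ^ card (F - F1)"
    proof (intro mult_mono prob_subset_blow_up p V W fF1)
      fix a b assume ab: "a \<in> {1..n div r}" "b \<in> {1..n div r}" "a \<noteq> b"
      show "card (F1 \<inter> between (V a) (V b)) \<le> 1" by (rule mono[OF F1 simple_wrtD(1)[OF simple ab]])
      show "card ((F - F1) \<inter> between (W a) (W b)) \<le> 1" by (rule mono[OF Diff_subset simple_wrtD(2)[OF simple ab]])
    qed (use p in auto)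
    also have "\<dots> = p ^ card F"
    proof -
      have "card F = card F1 + card (F - F1)" using F1 fin fF1 by (simp add: card_Diff_subset card_mono)
      then show ?thesis by (simp add: power_add)
    qed
    finally show "measure_pmf.prob ?P {x. F1 \<subseteq> blow_up V (fst x) \<and> F - F1 \<subseteq> blow_up W (snd x)} \<le> p ^ card F" .
  qed
  also have "\<dots> = (2 * p) ^ card F" using fin by (simp add: card_Pow power_mult_distrib)
  finally show ?thesis .
qed

lemma common_part_card:
  assumes V: "V \<in> equipartitions n r" and W: "W \<in> equipartitions n r"
  shows "card {x \<in> {1..n}. common_part (n div r) V W x y} \<le> 2 * r"
proof (cases "\<exists>x\<in>{1..n}. common_part (n div r) V W x y")
  case False
  then have "{x \<in> {1..n}. common_part (n div r) V W x y} = {}" by blast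
  then show ?thesis by (simp only: card.empty)
next
  case True
  obtain k where k: "k \<in> {1..n div r}" "y \<in> V k \<or> y \<in> W k" using True unfolding common_part_def by blast
  then have y: "y \<in> {1..n}" using equipartitionsD(1)[OF V k(1)] equipartitionsD(1)[OF W k(1)] by blast
  obtain i j where ij: "i \<in> {1..n div r}" "y \<in> V i" "j \<in> {1..n div r}" "y \<in> W j"
    using equipartitionsD(7)[OF V y] equipartitionsD(7)[OF W y] by blast
  have "{x \<in> {1..n}. common_part (n div r) V W x y} \<subseteq> V i \<union> W j"
  proof
    fix x assume "x \<in> {x \<in> {1..n}. common_part (n div r) V W x y}"
    then obtain k where k: "k \<in> {1..n div r}" "x \<in> V k \<and> y \<in> V k \<or> x \<in> W k \<and> y \<in> W k"
      unfolding common_part_def by blast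
    then show "x \<in> V i \<union> W j"
      using equipartitionsD(6)[OF V ij(1) k(1) ij(2)] equipartitionsD(6)[OF W ij(3) k(1) ij(4)] by blast
  qed
  then have "card {x \<in> {1..n}. common_part (n div r) V W x y} \<le> card (V i \<union> W j)"
    using equipartitionsD(3)[OF V ij(1)] equipartitionsD(3)[OF W ij(3)] by (intro card_mono) auto
  also have "\<dots> \<le> card (V i) + card (W j)" by (rule card_Un_le)
  also have "\<dots> = 2 * r" using equipartitionsD(2)[OF V ij(1)] equipartitionsD(2)[OF W ij(3)] by simp
  finally show ?thesis .
qed

text \<open>
  A pattern \<open>bs\<close> tells which steps of a path are actual edges; the other steps stay in a common
  part and hence leave few choices.
\<close>

fun fits :: "(nat \<Rightarrow> nat \<Rightarrow> bool) \<Rightarrow> bool list \<Rightarrow> nat list \<Rightarrow> bool" where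
  "fits C [] [x] = True"
| "fits C (b # bs) (x # y # zs) = ((b \<or> C x y) \<and> fits C bs (y # zs))"
| "fits C _ _ = False"

fun selected_edges :: "bool list \<Rightarrow> nat list \<Rightarrow> nat set set" where
  "selected_edges (b # bs) (x # y # zs) = (if b then {{x, y}} else {}) \<union> selected_edges bs (y # zs)"
| "selected_edges _ _ = {}"

fun pattern :: "nat set set \<Rightarrow> nat list \<Rightarrow> bool list" where
  "pattern E (x # y # zs) = ({x, y} \<in> E) # pattern E (y # zs)"
| "pattern E _ = []"

lemma selected_edges_pattern: "selected_edges (pattern E xs) xs = path_edges xs \<inter> E"
  by (induction xs rule: path_edges.induct) auto

lemma num_actual_pattern: "num_actual E xs = length (filter id (pattern E xs))"
  by (induction xs rule: path_edges.induct) auto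

lemma length_pattern: "length (pattern E xs) = length xs - 1"
  by (induction xs rule: path_edges.induct) auto

lemma fits_pattern: "xs \<noteq> [] \<Longrightarrow> successively (\<lambda>x y. {x, y} \<in> E \<or> C x y) xs \<Longrightarrow> fits C (pattern E xs) xs"
  by (induction xs rule: path_edges.induct) auto

lemma fits_length: "fits C bs xs \<Longrightarrow> length xs = Suc (length bs)"
  by (induction C bs xs rule: fits.induct) auto

text \<open>The list is built from its end: the last vertex is free, and each vertex put in front
  has \<open>n\<close> or \<open>k\<close> choices according to the pattern.\<close>

lemma card_fits:
  assumes C: "\<And>y. card {x \<in> {1..n}. C x y} \<le> k"
  shows "finite {xs. set xs \<subseteq> {1..n} \<and> fits C bs xs} \<and>
    card {xs. set xs \<subseteq> {1..n} \<and> fits C bs xs} \<le> n ^ Suc (length (filter id bs)) * k ^ length (filter Not bs)"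
proof (induction bs)
  case Nil
  have "{xs. set xs \<subseteq> {1..n} \<and> fits C [] xs} = (\<lambda>x. [x]) ` {1..n}"
  proof (intro equalityI subsetI)
    fix xs assume "xs \<in> {xs. set xs \<subseteq> {1..n} \<and> fits C [] xs}"
    then show "xs \<in> (\<lambda>x. [x]) ` {1..n}" by (cases xs; cases "tl xs") auto
  qed auto
  then show ?case by (simp add: card_image inj_on_def)
next
  case (Cons b bs)
  let ?L = "\<lambda>bs. {xs. set xs \<subseteq> {1..n} \<and> fits C bs xs}"
  let ?S = "SIGMA ys:?L bs. {x \<in> {1..n}. b \<or> C x (hd ys)}"
  have fin: "finite ?S" using Cons by auto
  have "?L (b # bs) \<subseteq> (\<lambda>(ys, x). x # ys) ` ?S"
  proof
    fix xs assume "xs \<in> ?L (b # bs)"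
    then show "xs \<in> (\<lambda>(ys, x). x # ys) ` ?S"
      by (cases xs; cases "tl xs") (auto intro!: image_eqI[of _ _ "(tl xs, hd xs)"])
  qed
  then have 1: "finite (?L (b # bs))" "card (?L (b # bs)) \<le> card ?S"
    using fin by (auto intro: finite_subset surj_card_le)
  have "card ?S = (\<Sum>ys\<in>?L bs. card {x \<in> {1..n}. b \<or> C x (hd ys)})"
    using Cons by (intro card_SigmaI) auto
  also have "\<dots> \<le> (\<Sum>ys\<in>?L bs. if b then n else k)"
  proof (rule sum_mono)
    fix ys
    show "card {x \<in> {1..n}. b \<or> C x (hd ys)} \<le> (if b then n else k)"
    proof (cases b)
      case True
      have "card {x \<in> {1..n}. b \<or> C x (hd ys)} \<le> card {1..n}" by (intro card_mono) auto
      then show ?thesis using True by simp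
    next
      case False
      then show ?thesis using C[of "hd ys"] by simp
    qed
  qed
  also have "\<dots> \<le> (n ^ Suc (length (filter id bs)) * k ^ length (filter Not bs)) * (if b then n else k)"
    unfolding sum_constant of_nat_id by (rule mult_le_mono1[OF conjunct2[OF Cons]])
  also have "\<dots> = n ^ Suc (length (filter id (b # bs))) * k ^ length (filter Not (b # bs))" by simp
  finally have 2: "card ?S \<le> n ^ Suc (length (filter id (b # bs))) * k ^ length (filter Not (b # bs))" .
  show ?case by (rule conjI[OF 1(1) order.trans[OF 1(2) 2]])
qed

lemma rotate_ends:
  assumes "k < length xs"
  shows "last (drop (Suc k) xs @ take (Suc k) xs) = xs ! k"
    "hd (drop (Suc k) xs @ take (Suc k) xs) = xs ! (Suc k mod length xs)"
proof -
  show "last (drop (Suc k) xs @ take (Suc k) xs) = xs ! k" using assms by (simp add: take_Suc_conv_app_nth)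
  show "hd (drop (Suc k) xs @ take (Suc k) xs) = xs ! (Suc k mod length xs)"
  proof (cases "Suc k = length xs")
    case True
    then show ?thesis using assms by (cases xs) simp_all
  next
    case False
    then show ?thesis using assms by (simp add: hd_drop_conv_nth hd_append)
  qed
qed

text \<open>Turns a count of positions into a count of edges. It needs three vertices: in a cycle of
  length two both positions carry the same edge.\<close>

lemma inj_on_cyc_edge:
  assumes d: "distinct xs" and l: "3 \<le> length xs"
  shows "inj_on (cyc_edge xs) {..<length xs}"
proof (rule inj_onI)
  fix i j assume i: "i \<in> {..<length xs}" and j: "j \<in> {..<length xs}" and eq: "cyc_edge xs i = cyc_edge xs j"
  have lt: "Suc i mod length xs < length xs" "Suc j mod length xs < length xs"
    using l by (intro mod_less_divisor; linarith)+
  have e: "{xs ! i, xs ! (Suc i mod length xs)} = {xs ! j, xs ! (Suc j mod length xs)}" using eq by (simp add: cyc_edge_def)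
  have "{i, Suc i mod length xs} = {j, Suc j mod length xs}"
    using e i j lt nth_eq_iff_index_eq[OF d] unfolding doubleton_eq_iff lessThan_iff by metis
  then consider "i = j" | "i = Suc j mod length xs" "j = Suc i mod length xs" by (auto simp: doubleton_eq_iff)
  then show "i = j"
  proof cases
    case 2
    show ?thesis
    proof (cases "Suc i < length xs")
      case True
      then have ji: "j = Suc i" using 2(2) by simp
      show ?thesis
      proof (cases "Suc j < length xs")
        case True
        then have "i = Suc j" using 2(1) mod_less by metis
        then show ?thesis using ji by linarith
      next
        case False
        then have t: "Suc j = length xs" using j by simp
        then have "i = 0" using 2(1) mod_self by metis
        then show ?thesis using ji t l by linarith
      qed
    next
      case False
      then have t: "Suc i = length xs" using i by simp
      then have "j = 0" using 2(2) mod_self by metis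
      then have "i = Suc 0 mod length xs" using 2(1) by metis
      also have "\<dots> = Suc 0" using l by (intro mod_less) linarith
      finally show ?thesis using t l by linarith
    qed
  qed
qed

text \<open>The edges that a pattern forces to be present, when the list is rotated so that its
  closing edge is actual.\<close>

definition closing_edges :: "bool list \<Rightarrow> nat list \<Rightarrow> nat set set" where
  "closing_edges bs xs = insert {last xs, hd xs} (selected_edges bs xs)"

text \<open>An odd number of actual edges is not zero, so the cycle can be rotated to close with an
  actual edge. All broken edges then lie on the open path, where \<open>card_fits\<close> gains a
  factor from each; a broken closing edge would restrict no choice in that count.\<close>

lemma odd_broken_rotated_pattern:
  assumes xs: "odd_broken E C xs" and E: "E \<subseteq> nsets A 2"
  obtains ys where "distinct ys" "set ys = set xs" "length ys = length xs" "fits C (pattern E ys) ys"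
    "odd (Suc (length (filter id (pattern E ys))))" "closing_edges (pattern E ys) ys = cyc_edges xs \<inter> E"
    "card (closing_edges (pattern E ys) ys) = Suc (length (filter id (pattern E ys)))"
proof -
  have odd: "odd (num_actual E (xs @ [hd xs]))" and d: "distinct xs" using xs by (auto simp: odd_broken_def)
  \<comment> \<open>A loop is never in \<open>E\<close>, and in a cycle of length two the same pair
    is counted twice, so shorter lists have an even number of actual edges.\<close>
  have len: "3 \<le> length xs"
  proof (rule ccontr)
    assume "\<not> 3 \<le> length xs"
    then consider "xs = []" | x where "xs = [x]" | x y where "xs = [x, y]"
      by (cases xs; cases "tl xs"; cases "tl (tl xs)") auto
    then show False
    proof cases
      case 2
      have "{x, x} \<notin> E" using E by (auto simp: nsets_def)
      then show False using odd 2 by simp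
    next
      case 3
      then show False using odd by (simp add: insert_commute split: if_splits)
    qed (use odd in simp)
  qed
  have "{i. i < length xs \<and> cyc_edge xs i \<in> E} \<noteq> {}"
    using odd unfolding num_actual_closed[symmetric] by (metis card.empty even_zero)
  then obtain k where k: "k < length xs" "cyc_edge xs k \<in> E" by blast
  define ys where "ys = drop (Suc k) xs @ take (Suc k) xs"
  have xs_eq: "xs = take (Suc k) xs @ drop (Suc k) xs" by simp
  have ob: "odd_broken E C ys" unfolding ys_def by (rule odd_broken_rotate) (use xs in simp)
  have cy: "cyc_edges ys = cyc_edges xs" unfolding ys_def by (subst cyc_edges_rotate) simp
  have sy: "set ys = set xs"
  proof -
    have "set ys = set (take (Suc k) xs @ drop (Suc k) xs)" unfolding ys_def set_append by (rule Un_commute)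
    then show ?thesis by simp
  qed
  have ly: "length ys = length xs" using k(1) by (simp add: ys_def)
  have dy: "distinct ys" using ob by (simp add: odd_broken_def)
  have yne: "ys \<noteq> []" using ly len by auto
  have le: "{last ys, hd ys} \<in> E"
    using k(2) rotate_ends[OF k(1)] unfolding ys_def cyc_edge_def by simp
  have bl: "ys = butlast ys @ [last ys]" using yne by simp
  have pe: "path_edges (ys @ [hd ys]) = path_edges ys \<union> {{last ys, hd ys}}"
  proof -
    have "path_edges (ys @ [hd ys]) = path_edges (butlast ys @ last ys # [hd ys])"
      using yne by (metis append_butlast_last_id append.assoc append_Cons append_Nil)
    also have "\<dots> = path_edges (butlast ys @ [last ys]) \<union> {{last ys, hd ys}}"
      by (subst path_edges_append) simp
    finally show ?thesis using yne by simp
  qed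
  have na: "num_actual E (ys @ [hd ys]) = Suc (num_actual E ys)"
  proof -
    have "num_actual E (ys @ [hd ys]) = num_actual E (butlast ys @ last ys # [hd ys])"
      using yne by (metis append_butlast_last_id append.assoc append_Cons append_Nil)
    also have "\<dots> = num_actual E (butlast ys @ [last ys]) + 1"
      using le by (subst num_actual_append) simp
    finally show ?thesis using yne by simp
  qed
  have ce: "closing_edges (pattern E ys) ys = cyc_edges ys \<inter> E"
    unfolding closing_edges_def selected_edges_pattern cyc_edges_conv pe using le by auto
  show ?thesis
  proof (rule that[of ys])
    have "successively (\<lambda>x y. {x, y} \<in> E \<or> C x y) (ys @ [hd ys])" using ob by (simp add: odd_broken_def)
    then have "successively (\<lambda>x y. {x, y} \<in> E \<or> C x y) ys" by (simp add: successively_append_iff)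
    then show "fits C (pattern E ys) ys" by (rule fits_pattern[OF yne])
    show "odd (Suc (length (filter id (pattern E ys))))"
      using ob na by (simp add: odd_broken_def num_actual_pattern)
    show "closing_edges (pattern E ys) ys = cyc_edges xs \<inter> E" using ce cy by simp
    have "cyc_edges ys \<inter> E = cyc_edge ys ` {i. i < length ys \<and> cyc_edge ys i \<in> E}" by (auto simp: cyc_edges_def)
    moreover have "inj_on (cyc_edge ys) {i. i < length ys \<and> cyc_edge ys i \<in> E}"
      by (rule inj_on_subset[OF inj_on_cyc_edge[OF dy]]) (use ly len in auto)
    ultimately have "card (cyc_edges ys \<inter> E) = card {i. i < length ys \<and> cyc_edge ys i \<in> E}" by (simp add: card_image)
    then show "card (closing_edges (pattern E ys) ys) = Suc (length (filter id (pattern E ys)))"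
      by (simp only: ce num_actual_closed na num_actual_pattern[of E ys])
  qed (rule dy sy ly)+
qed

lemma finite_selected_edges: "finite (selected_edges bs xs)"
  by (induction bs xs rule: selected_edges.induct) auto

text \<open>Here \<open>x\<close> is the weight of an actual edge and \<open>y\<close> that of a
  broken one. As \<open>l - 1\<close> is even, a cycle of that length with an odd number of actual
  edges has a broken edge; the worst case is length \<open>l - 1\<close> with exactly one.\<close>

lemma pattern_weight_le:
  fixes x y :: real
  assumes "1 \<le> y" "y \<le> x" "odd l" "odd a" "a \<le> t" "t \<le> l - 1"
  shows "x ^ a * y ^ (t - a) \<le> x ^ (l - 2) * y"
proof (cases "a = t")
  case True
  have "t \<noteq> l - 1" using True assms(3,4) by (cases l) auto
  then have "t \<le> l - 2" using assms(6) by simp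
  then have "x ^ t * 1 \<le> x ^ (l - 2) * y" using assms by (intro mult_mono power_increasing) auto
  then show ?thesis using True by simp
next
  case False
  then obtain d where d: "t = a + Suc d" using assms(5) by (metis le_neq_implies_less less_imp_Suc_add add_Suc_right)
  have "x ^ a * y ^ (t - a) = x ^ a * y ^ d * y" by (simp add: d)
  also have "\<dots> \<le> x ^ a * x ^ d * y" using assms by (intro mult_mono power_mono) auto
  also have "\<dots> = x ^ (a + d) * y" by (simp add: power_add)
  also have "\<dots> \<le> x ^ (l - 2) * y" using assms d by (intro mult_right_mono power_increasing) auto
  finally show ?thesis .
qed

lemma sum_two_powers: "(\<Sum>i\<le>k. (2::nat) ^ i) \<le> 2 ^ Suc k"
proof -
  have "(\<Sum>i\<le>k. (2::nat) ^ i) + 1 = 2 ^ Suc k" by (induction k) auto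
  then show ?thesis by linarith
qed

text \<open>Each deleted vertex lies on a list of at most \<open>l\<close> vertices whose forced
  edges are all present, so Markov's inequality applies to the number of such lists. The factor
  \<open>2 ^ l\<close> bounds the number of patterns.\<close>

lemma prob_many_deleted_vertices:
  assumes V: "V \<in> equipartitions n r" and W: "W \<in> equipartitions n r" and r: "0 < r" and p: "0 \<le> p" "p \<le> 1"
    and l: "odd l" "5 \<le> l" and rd: "real r \<le> real n * p" and c: "0 < c"
  shows "measure_pmf.prob (pair_pmf (gnp (n div r) p) (gnp (n div r) p))
      {(ER, EB). c * real l \<le> real (card ({1..n} - surviving l n (n div r) V W (blow_up V ER \<union> blow_up W EB)))} \<le>
    2 ^ l * ((2 * (real n * p)) ^ (l - 2) * (2 * real r)) / c"
proof -
  let ?P = "pair_pmf (gnp (n div r) p) (gnp (n div r) p)" and ?C = "common_part (n div r) V W"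
  let ?E = "\<lambda>x. blow_up V (fst x) \<union> blow_up W (snd x)"
  \<comment> \<open>The \<open>Suc\<close> accounts for the closing edge, which the pattern omits;
    for the same reason patterns have length at most \<open>l - 2\<close>.\<close>
  define a where "a = (\<lambda>bs. Suc (length (filter id bs)))"
  define BS where "BS = {bs :: bool list. length bs \<le> l - 2 \<and> odd (a bs)}"
  define XS where "XS = (\<lambda>bs. {xs. set xs \<subseteq> {1..n} \<and> fits ?C bs xs})"
  define T where "T = {\<tau> \<in> Sigma BS XS. card (closing_edges (fst \<tau>) (snd \<tau>)) = a (fst \<tau>) \<and>
      simple_wrt (n div r) V W (closing_edges (fst \<tau>) (snd \<tau>))}"
  have all_lists: "{bs :: bool list. length bs \<le> l - 2} = {bs. set bs \<subseteq> UNIV \<and> length bs \<le> l - 2}" by simp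
  have fBS: "finite BS" "card BS \<le> 2 ^ l"
  proof -
    have sub: "BS \<subseteq> {bs. set bs \<subseteq> UNIV \<and> length bs \<le> l - 2}" by (auto simp: BS_def)
    have fin: "finite {bs :: bool list. set bs \<subseteq> UNIV \<and> length bs \<le> l - 2}" by (rule finite_lists_length_le) simp
    show "finite BS" by (rule finite_subset[OF sub fin])
    have "card BS \<le> card {bs :: bool list. set bs \<subseteq> UNIV \<and> length bs \<le> l - 2}" by (rule card_mono[OF fin sub])
    also have "\<dots> = (\<Sum>i\<le>l - 2. 2 ^ i)" by (subst card_lists_length_le) auto
    also have "\<dots> \<le> 2 ^ Suc (l - 2)" by (rule sum_two_powers)
    also have "\<dots> \<le> 2 ^ l" using l by (intro power_increasing) auto
    finally show "card BS \<le> 2 ^ l" .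
  qed
  have fXS: "finite (XS bs)" "card (XS bs) \<le> n ^ a bs * (2 * r) ^ length (filter Not bs)" for bs
    using card_fits[of n ?C "2 * r" bs, OF common_part_card[OF V W]] unfolding XS_def a_def by blast+
  have fS: "finite (Sigma BS XS)" using fBS(1) fXS(1) by (intro finite_SigmaI)
  have fT: "finite T" using fS by (simp add: T_def)
  have det: "card ({1..n} - surviving l n (n div r) V W (?E x)) \<le> l * card {\<tau> \<in> T. closing_edges (fst \<tau>) (snd \<tau>) \<subseteq> ?E x}"
    if x: "x \<in> set_pmf ?P" for x
  proof -
    have E: "?E x \<subseteq> nsets {1..n} 2"
    proof -
      have "fst x \<in> set_pmf (gnp (n div r) p)" "snd x \<in> set_pmf (gnp (n div r) p)" using x by auto
      then have "fst x \<subseteq> nsets {1..n div r} 2" "snd x \<subseteq> nsets {1..n div r} 2"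
        using set_pmf_gnp by blast+
      then show ?thesis using blow_up_nsets[OF V] blow_up_nsets[OF W] by blast
    qed
    let ?H = "{\<tau> \<in> T. closing_edges (fst \<tau>) (snd \<tau>) \<subseteq> ?E x}"
    have "{1..n} - surviving l n (n div r) V W (?E x) \<subseteq> (\<Union>\<tau>\<in>?H. set (snd \<tau>))"
    proof
      fix v assume "v \<in> {1..n} - surviving l n (n div r) V W (?E x)"
      then obtain xs where xs: "v \<in> set xs" "broken_cycle n (n div r) V W (?E x) xs"
        "simple_wrt (n div r) V W (cyc_edges xs \<inter> ?E x)" "length xs \<le> l - 1"
        "odd (card {i. i < length xs \<and> cyc_edge xs i \<in> ?E x})"
        unfolding surviving_def by blast
      have ob: "odd_broken (?E x) ?C xs" "set xs \<subseteq> {1..n}"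
        using odd_broken_iff[of n "n div r" V W "?E x" xs] xs(2,5) by blast+
      obtain ys where ys: "distinct ys" "set ys = set xs" "length ys = length xs" "fits ?C (pattern (?E x) ys) ys"
        "odd (Suc (length (filter id (pattern (?E x) ys))))" "closing_edges (pattern (?E x) ys) ys = cyc_edges xs \<inter> ?E x"
        "card (closing_edges (pattern (?E x) ys) ys) = Suc (length (filter id (pattern (?E x) ys)))"
        by (rule odd_broken_rotated_pattern[OF ob(1) E])
      have "(pattern (?E x) ys, ys) \<in> ?H"
        using ys xs(3,4) ob(2) by (simp add: T_def BS_def XS_def a_def length_pattern)
      then show "v \<in> (\<Union>\<tau>\<in>?H. set (snd \<tau>))" using xs(1) ys(2) by (intro UN_I[of "(pattern (?E x) ys, ys)"]) simp_all
    qed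
    then have "card ({1..n} - surviving l n (n div r) V W (?E x)) \<le> card (\<Union>\<tau>\<in>?H. set (snd \<tau>))"
      using fT by (intro card_mono) auto
    also have "\<dots> \<le> (\<Sum>\<tau>\<in>?H. card (set (snd \<tau>)))" using fT by (intro card_UN_le) auto
    also have "\<dots> \<le> (\<Sum>\<tau>\<in>?H. l)"
    proof (rule sum_mono)
      fix \<tau> assume "\<tau> \<in> ?H"
      then have "fits ?C (fst \<tau>) (snd \<tau>)" "length (fst \<tau>) \<le> l - 2" by (auto simp: T_def BS_def XS_def)
      then have "length (snd \<tau>) \<le> l" using fits_length l by fastforce
      then show "card (set (snd \<tau>)) \<le> l" using card_length le_trans by blast
    qed
    finally show ?thesis by (simp add: mult.commute)
  qed
  have "measure_pmf.prob ?P {(ER, EB). c * real l \<le> real (card ({1..n} - surviving l n (n div r) V W (blow_up V ER \<union> blow_up W EB)))} \<le>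
     measure_pmf.prob ?P {x. c \<le> real (card {\<tau> \<in> T. closing_edges (fst \<tau>) (snd \<tau>) \<subseteq> ?E x})}"
  proof (rule measure_pmf.finite_measure_mono_AE)
    have "c \<le> real (card {\<tau> \<in> T. closing_edges (fst \<tau>) (snd \<tau>) \<subseteq> ?E x})"
      if x: "x \<in> set_pmf ?P" and ge: "c * real l \<le> real (card ({1..n} - surviving l n (n div r) V W (?E x)))" for x
    proof -
      have "c * real l \<le> real (l * card {\<tau> \<in> T. closing_edges (fst \<tau>) (snd \<tau>) \<subseteq> ?E x})"
        using ge det[OF x] of_nat_mono order_trans by blast
      then show ?thesis using l by simp
    qed
    then show "AE x in ?P. x \<in> {(ER, EB). c * real l \<le> real (card ({1..n} - surviving l n (n div r) V W (blow_up V ER \<union> blow_up W EB)))} \<longrightarrow>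
        x \<in> {x. c \<le> real (card {\<tau> \<in> T. closing_edges (fst \<tau>) (snd \<tau>) \<subseteq> ?E x})}"
      unfolding AE_measure_pmf_iff by (simp add: case_prod_unfold)
  qed simp
  also have "\<dots> \<le> (\<Sum>\<tau>\<in>T. measure_pmf.prob ?P {x. closing_edges (fst \<tau>) (snd \<tau>) \<subseteq> ?E x}) / c"
    by (rule prob_card_ge[OF fT c])
  also have "\<dots> \<le> (\<Sum>\<tau>\<in>T. (2 * p) ^ a (fst \<tau>)) / c"
  proof (intro divide_right_mono sum_mono)
    fix \<tau> assume \<tau>: "\<tau> \<in> T"
    have "measure_pmf.prob ?P {(ER, EB). closing_edges (fst \<tau>) (snd \<tau>) \<subseteq> blow_up V ER \<union> blow_up W EB} \<le>
       (2 * p) ^ card (closing_edges (fst \<tau>) (snd \<tau>))"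
      by (rule prob_simple_subset[OF V W p]) (use \<tau> in \<open>auto simp: T_def closing_edges_def finite_selected_edges\<close>)
    then show "measure_pmf.prob ?P {x. closing_edges (fst \<tau>) (snd \<tau>) \<subseteq> ?E x} \<le> (2 * p) ^ a (fst \<tau>)"
      using \<tau> by (simp add: T_def case_prod_unfold)
  qed (use c in simp)
  also have "\<dots> \<le> (\<Sum>\<tau>\<in>Sigma BS XS. (2 * p) ^ a (fst \<tau>)) / c"
    using c p fS by (intro divide_right_mono sum_mono2) (auto simp: T_def)
  also have "(\<Sum>\<tau>\<in>Sigma BS XS. (2 * p) ^ a (fst \<tau>)) = (\<Sum>bs\<in>BS. real (card (XS bs)) * (2 * p) ^ a bs)"
    using sum.Sigma[of BS XS "\<lambda>bs xs. (2 * p) ^ a bs"] fBS(1) fXS(1) by (simp add: case_prod_unfold)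
  also have "\<dots> \<le> (\<Sum>bs\<in>BS. (2 * (real n * p)) ^ (l - 2) * (2 * real r))"
  proof (rule sum_mono)
    fix bs assume bs: "bs \<in> BS"
    let ?t = "Suc (length bs)"
    have len: "length (filter Not bs) = ?t - a bs"
      using sum_length_filter_compl[of id bs] by (simp add: a_def comp_def)
    have le: "a bs \<le> ?t" by (simp add: a_def)
    have tl: "?t \<le> l - 1" using bs l by (auto simp: BS_def)
    have "real (card (XS bs)) \<le> real (n ^ a bs * (2 * r) ^ (?t - a bs))"
      using fXS(2)[of bs] unfolding len by (rule of_nat_mono)
    then have "real (card (XS bs)) * (2 * p) ^ a bs \<le> real (n ^ a bs * (2 * r) ^ (?t - a bs)) * (2 * p) ^ a bs"
      using p by (intro mult_right_mono) auto
    also have "\<dots> = (2 * (real n * p)) ^ a bs * (2 * real r) ^ (?t - a bs)"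
      by (simp add: power_mult_distrib mult_ac)
    also have "\<dots> \<le> (2 * (real n * p)) ^ (l - 2) * (2 * real r)"
      using r rd bs le tl l by (intro pattern_weight_le) (auto simp: BS_def)
    finally show "real (card (XS bs)) * (2 * p) ^ a bs \<le> (2 * (real n * p)) ^ (l - 2) * (2 * real r)" .
  qed
  also have "\<dots> = real (card BS) * ((2 * (real n * p)) ^ (l - 2) * (2 * real r))" by simp
  also have "\<dots> \<le> 2 ^ l * ((2 * (real n * p)) ^ (l - 2) * (2 * real r))"
  proof (rule mult_right_mono)
    show "real (card BS) \<le> 2 ^ l" using fBS(2) by (metis of_nat_le_iff of_nat_numeral of_nat_power)
  qed (use p in auto)
  finally show ?thesis using c by (simp add: divide_right_mono)
qed

text \<open>First moment over the at most \<open>n * (2 * r)\<close> ordered pairs in a common part,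
  each of which is an edge with probability at most \<open>2 * p\<close>.\<close>

lemma prob_many_bad_vertices:
  assumes V: "V \<in> equipartitions n r" and W: "W \<in> equipartitions n r" and p: "0 \<le> p" "p \<le> 1" and c: "0 < c"
  shows "measure_pmf.prob (pair_pmf (gnp (n div r) p) (gnp (n div r) p))
      {(ER, EB). c \<le> real (card (bad_vertices n (n div r) V W (blow_up V ER \<union> blow_up W EB)))} \<le>
    4 * (real n * p) * real r / c"
proof -
  let ?P = "pair_pmf (gnp (n div r) p) (gnp (n div r) p)" and ?C = "common_part (n div r) V W"
  let ?E = "\<lambda>x. blow_up V (fst x) \<union> blow_up W (snd x)"
  define T where "T = (SIGMA y:{1..n}. {x \<in> {1..n}. ?C x y})"
  have fT: "finite T" by (simp add: T_def)
  have "card T = (\<Sum>y\<in>{1..n}. card {x \<in> {1..n}. ?C x y})" unfolding T_def by (intro card_SigmaI) auto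
  also have "\<dots> \<le> (\<Sum>y\<in>{1..n}. 2 * r)" by (intro sum_mono common_part_card[OF V W])
  finally have cT: "card T \<le> n * (2 * r)" by simp
  have "measure_pmf.prob ?P {(ER, EB). c \<le> real (card (bad_vertices n (n div r) V W (blow_up V ER \<union> blow_up W EB)))} \<le>
     measure_pmf.prob ?P {x. c \<le> real (card {\<tau> \<in> T. {{fst \<tau>, snd \<tau>}} \<subseteq> ?E x})}"
  proof (rule measure_pmf.finite_measure_mono)
    have le: "card (bad_vertices n (n div r) V W (?E x)) \<le> card {\<tau> \<in> T. {{fst \<tau>, snd \<tau>}} \<subseteq> ?E x}" for x
    proof (rule surj_card_le[of _ _ snd])
      show "finite {\<tau> \<in> T. {{fst \<tau>, snd \<tau>}} \<subseteq> ?E x}" using fT by simp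
      show "bad_vertices n (n div r) V W (?E x) \<subseteq> snd ` {\<tau> \<in> T. {{fst \<tau>, snd \<tau>}} \<subseteq> ?E x}"
      proof
        fix v assume "v \<in> bad_vertices n (n div r) V W (?E x)"
        then obtain y where "v \<in> {1..n}" "y \<in> {1..n}" "{v, y} \<in> ?E x" "?C v y" unfolding bad_vertices_def by blast
        then show "v \<in> snd ` {\<tau> \<in> T. {{fst \<tau>, snd \<tau>}} \<subseteq> ?E x}"
          by (intro image_eqI[of _ _ "(y, v)"]) (simp_all add: T_def insert_commute)
      qed
    qed
    show "{(ER, EB). c \<le> real (card (bad_vertices n (n div r) V W (blow_up V ER \<union> blow_up W EB)))} \<subseteq>
        {x. c \<le> real (card {\<tau> \<in> T. {{fst \<tau>, snd \<tau>}} \<subseteq> ?E x})}"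
    proof (rule subsetI)
      fix x assume "x \<in> {(ER, EB). c \<le> real (card (bad_vertices n (n div r) V W (blow_up V ER \<union> blow_up W EB)))}"
      then have "c \<le> real (card (bad_vertices n (n div r) V W (?E x)))" by (simp only: mem_Collect_eq case_prod_unfold)
      also have "\<dots> \<le> real (card {\<tau> \<in> T. {{fst \<tau>, snd \<tau>}} \<subseteq> ?E x})" by (rule of_nat_mono[OF le])
      finally show "x \<in> {x. c \<le> real (card {\<tau> \<in> T. {{fst \<tau>, snd \<tau>}} \<subseteq> ?E x})}" by (rule CollectI)
    qed
  qed simp
  also have "\<dots> \<le> (\<Sum>\<tau>\<in>T. measure_pmf.prob ?P {x. {{fst \<tau>, snd \<tau>}} \<subseteq> ?E x}) / c"
    by (rule prob_card_ge[OF fT c])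
  also have "\<dots> \<le> (\<Sum>\<tau>\<in>T. 2 * p) / c"
  proof (intro divide_right_mono sum_mono)
    fix \<tau> :: "nat \<times> nat"
    have le1: "card ({e} \<inter> B) \<le> 1" for e :: "nat set" and B
      using card_mono[of "{e}" "{e} \<inter> B"] by simp
    have "simple_wrt (n div r) V W {{fst \<tau>, snd \<tau>}}" unfolding simple_wrt_def using le1 by blast
    from prob_simple_subset[OF V W p _ this]
    show "measure_pmf.prob ?P {x. {{fst \<tau>, snd \<tau>}} \<subseteq> ?E x} \<le> 2 * p" by (simp add: case_prod_unfold)
  qed (use c in simp)
  also have "\<dots> = real (card T) * (2 * p) / c" by simp
  also have "\<dots> \<le> real (n * (2 * r)) * (2 * p) / c"
    using cT p c by (intro divide_right_mono mult_right_mono of_nat_mono) auto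
  finally show ?thesis by (simp add: mult_ac)
qed

section \<open>Transversals without open red pairs\<close>

definition part_indices :: "nat \<Rightarrow> (nat \<Rightarrow> nat set) \<Rightarrow> nat set \<Rightarrow> nat set" where
  "part_indices m V S = {i \<in> {1..m}. S \<inter> V i \<noteq> {}}"

text \<open>If \<open>S\<close> is a transversal, \<open>S \<inter> V i\<close> is a single vertex
  and \<open>Min\<close> extracts it. Pairs of \<open>S\<close> are thus indexed by pairs of parts,
  which are the coins of the reduced graph.\<close>

definition rep_pair :: "(nat \<Rightarrow> nat set) \<Rightarrow> nat set \<Rightarrow> nat set \<Rightarrow> nat set" where
  "rep_pair V S P = (\<lambda>i. Min (S \<inter> V i)) ` P"

definition lower_blow_up :: "nat \<Rightarrow> nat set rel \<Rightarrow> (nat \<Rightarrow> nat set) \<Rightarrow> nat set set \<Rightarrow> nat set \<Rightarrow> nat set set" where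
  "lower_blow_up n L V E P = blow_up V {Q \<in> E. pair_rank n L V Q < pair_rank n L V P}"

text \<open>
  An open pair is one whose red edge cannot be deleted: it is not blue, and the red edges revealed
  before it create few walks of length \<open>k\<close> between its ends.
\<close>

definition open_pair ::
  "nat \<Rightarrow> nat \<Rightarrow> nat \<Rightarrow> nat set rel \<Rightarrow> (nat \<Rightarrow> nat set) \<Rightarrow> nat set \<Rightarrow> nat set set \<Rightarrow> nat set set \<Rightarrow> nat set \<Rightarrow> bool" where
  "open_pair n r k L V S B E P \<longleftrightarrow> rep_pair V S P \<notin> B \<and>
     (\<forall>x y. rep_pair V S P = {x, y} \<longrightarrow> walks {1..n} (lower_blow_up n L V E P \<union> B) k {y} x < r)"

text \<open>Which pairs are open is random, so the lower bound \<open>M\<close> on their number is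
  part of the event; it has the shape of the event in \<open>prob_adaptive_avoid\<close>.\<close>

definition avoids ::
  "nat \<Rightarrow> nat \<Rightarrow> nat \<Rightarrow> nat \<Rightarrow> nat set rel \<Rightarrow> (nat \<Rightarrow> nat set) \<Rightarrow> nat set set \<Rightarrow> nat set set \<Rightarrow> nat set \<Rightarrow> bool" where
  "avoids n r k M L V B E S \<longleftrightarrow>
     (\<forall>P\<in>nsets (part_indices (n div r) V S) 2. open_pair n r k L V S B E P \<longrightarrow> P \<notin> E) \<and>
     M \<le> card {P \<in> nsets (part_indices (n div r) V S) 2. open_pair n r k L V S B E P}"

lemma prob_avoids:
  assumes V: "V \<in> equipartitions n r" "0 < r" and L: "block_ordering n (n div r) V L" and p: "0 \<le> p" "p < 1"
  shows "measure_pmf.prob (gnp (n div r) p) {E. avoids n r k M L V B E S} \<le> (1 - p) ^ M"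
proof -
  let ?F = "nsets {1..n div r} (2::nat)" and ?T = "nsets (part_indices (n div r) V S) (2::nat)"
  let ?o = "\<lambda>P b. open_pair n r k L V S B {e \<in> ?F. b e} P"
  have fF: "finite ?F" by (rule finite_imp_finite_nsets[OF finite_atLeastAtMost])
  have T: "?T \<subseteq> ?F" by (auto simp: nsets_def part_indices_def)
  have "measure_pmf.prob (gnp (n div r) p) {E. avoids n r k M L V B E S} =
     measure_pmf.prob (Pi_pmf ?F False (\<lambda>_. bernoulli_pmf p)) {b. avoids n r k M L V B {e \<in> ?F. b e} S}"
    by (simp add: gnp_def vimage_def)
  also have "{b. avoids n r k M L V B {e \<in> ?F. b e} S} = {b. (\<forall>P\<in>?T. ?o P b \<longrightarrow> \<not> b P) \<and> M \<le> card {P \<in> ?T. ?o P b}}"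
    unfolding avoids_def using T by blast
  also have "measure_pmf.prob (Pi_pmf ?F False (\<lambda>_. bernoulli_pmf p)) \<dots> \<le> (1 - p) ^ M"
  proof (rule prob_adaptive_avoid[OF fF T inj_on_pair_rank[OF V L] p])
    fix P and b b' :: "nat set \<Rightarrow> bool"
    assume "P \<in> ?T" and eq: "\<And>Q. Q \<in> ?F \<Longrightarrow> pair_rank n L V Q < pair_rank n L V P \<Longrightarrow> b Q = b' Q"
    have "{Q \<in> {e \<in> ?F. b e}. pair_rank n L V Q < pair_rank n L V P} = {Q \<in> {e \<in> ?F. b' e}. pair_rank n L V Q < pair_rank n L V P}"
      using eq by blast
    then show "?o P b = ?o P b'" unfolding open_pair_def lower_blow_up_def by simp
  qed
  finally show ?thesis .
qed

lemma prob_ex_avoids: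
  assumes V: "V \<in> equipartitions n r" "0 < r" and L: "block_ordering n (n div r) V L" and p: "0 \<le> p" "p < 1"
  shows "measure_pmf.prob (gnp (n div r) p) {E. \<exists>S\<in>nsets {1..n} s. avoids n r k M L V B E S} \<le> real n ^ s * (1 - p) ^ M"
proof -
  have "measure_pmf.prob (gnp (n div r) p) {E. \<exists>S\<in>nsets {1..n} s. avoids n r k M L V B E S} \<le> (\<Sum>S\<in>nsets {1..n} s. (1 - p) ^ M)"
    by (rule prob_UN_le[OF finite_imp_finite_nsets prob_avoids[OF assms]]) simp
  also have "\<dots> = real (n choose s) * (1 - p) ^ M" by (simp add: card_nsets)
  also have "\<dots> \<le> real n ^ s * (1 - p) ^ M"
  proof (rule mult_right_mono)
    have "(n choose s) * 1 \<le> (n choose s) * fact s" by (rule mult_le_mono2) (rule fact_ge_1)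
    also have "\<dots> \<le> n ^ s" by (rule binomial_fact_pow)
    finally have "n choose s \<le> n ^ s" by simp
    then show "real (n choose s) \<le> real n ^ s" by (metis of_nat_le_iff of_nat_power)
  qed (use p in simp)
  finally show ?thesis .
qed

section \<open>Degrees and walks in the union of two pseudo-random blow-ups\<close>

lemma card_neighbours_le:
  assumes V: "V \<in> equipartitions n r" and r: "0 < r" "r dvd n" and pr: "pseudo_random (n div r) p (8 * real (n div r) * p) lam E"
    and v: "v \<in> {1..n}"
  shows "real (card {w \<in> {1..n}. {v, w} \<in> blow_up V E}) \<le> 8 * (real n * p)"
proof -
  have E: "E \<subseteq> nsets {1..n div r} 2" using pr by (simp add: pseudo_random_def)
  obtain i where i: "i \<in> {1..n div r}" "v \<in> V i" using equipartitionsD(7)[OF V v] by blast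
  have "real (card {w \<in> {1..n}. {v, w} \<in> blow_up V E}) = real r * real (deg_in E {1..n div r} i)"
    by (simp only: card_neighbours_blow_up[OF V E i] of_nat_mult)
  also have "\<dots> \<le> real r * (8 * real (n div r) * p)"
    using pr i(1) unfolding pseudo_random_def by (intro mult_left_mono) auto
  also have "\<dots> = 8 * (real (n div r * r) * p)" by (simp add: mult_ac)
  also have "n div r * r = n" using r by simp
  finally show ?thesis .
qed

lemma card_neighbours_Un_le:
  assumes "V \<in> equipartitions n r" "W \<in> equipartitions n r" "0 < r" "r dvd n" "v \<in> {1..n}"
    and "pseudo_random (n div r) p (8 * real (n div r) * p) lam ER" "pseudo_random (n div r) p (8 * real (n div r) * p) lam EB"
  shows "real (card {w \<in> {1..n}. {v, w} \<in> blow_up V ER \<union> blow_up W EB}) \<le> 16 * (real n * p)"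
proof -
  have "{w \<in> {1..n}. {v, w} \<in> blow_up V ER \<union> blow_up W EB} =
    {w \<in> {1..n}. {v, w} \<in> blow_up V ER} \<union> {w \<in> {1..n}. {v, w} \<in> blow_up W EB}" by blast
  then have "card {w \<in> {1..n}. {v, w} \<in> blow_up V ER \<union> blow_up W EB} \<le>
    card {w \<in> {1..n}. {v, w} \<in> blow_up V ER} + card {w \<in> {1..n}. {v, w} \<in> blow_up W EB}"
    by (simp only: card_Un_le)
  then show ?thesis
    using card_neighbours_le[OF assms(1,3,4,6,5)] card_neighbours_le[OF assms(2-4,7,5)] by linarith
qed

lemma harm_le_ln_plus_1: "0 < n \<Longrightarrow> harm n \<le> ln (real n) + 1"
  using euler_mascheroni_sequence_decreasing[of 1 n] by (simp add: harm_def)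

lemma harm_power_le:
  assumes "1 \<le> real l * ln (real n)" "1 < n" "0 < l"
  shows "harm (n ^ l) \<le> 2 * (real l * ln (real n))"
proof -
  have "harm (n ^ l) \<le> ln (real (n ^ l)) + 1" using assms by (intro harm_le_ln_plus_1) simp
  also have "\<dots> = real l * ln (real n) + 1" using assms by (simp add: ln_realpow)
  finally show ?thesis using assms by linarith
qed

text \<open>The bound of \<open>sum_walks_between_le\<close> with \<open>q = 32 * p\<close> and
  \<open>D = 16 * (n * p)\<close>. The first summand has the order of the expected number of walks,
  the second comes from the Euclidean remainder. The constant 1280 is \<open>16 * 5 * 8 * 2\<close>,
  from the step for two blow-ups, \<open>lam\<close>, the degree bound and the harmonic sum.\<close>

definition walk_bound :: "nat \<Rightarrow> nat \<Rightarrow> nat \<Rightarrow> real \<Rightarrow> nat \<Rightarrow> real" where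
  "walk_bound l n r p s = real s * (2 * real (l - 1) * (32 * p) * (16 * (real n * p)) ^ (l - 1) * real s / (16 * (real n * p))) +
     real s * sqrt (1280 * real l * (ln (real n))\<^sup>2 * (real n * p) * real r) ^ (l - 1)"

lemma sum_walks_le_walk_bound:
  assumes V: "V \<in> equipartitions n r" and W: "W \<in> equipartitions n r" and r: "0 < r" "r dvd n"
    and prR: "pseudo_random (n div r) p (8 * real (n div r) * p) (5 * ln (real n)) ER"
    and prB: "pseudo_random (n div r) p (8 * real (n div r) * p) (5 * ln (real n)) EB"
    and S: "S \<subseteq> {1..n}" "card S = s" and p: "0 \<le> p" and l: "2 \<le> l" and n: "1 \<le> real l * ln (real n)" "1 < n"
    and d: "1 \<le> 16 * (real n * p)" "16 * (real n * p) \<le> real n" and s: "1 \<le> 32 * p * real s"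
  shows "(\<Sum>v\<in>S. real (walks {1..n} (blow_up V ER \<union> blow_up W EB) (l - 1) S v)) \<le> walk_bound l n r p s"
proof -
  let ?L = "ln (real n)" and ?d = "16 * (real n * p)"
  define beta where "beta = sqrt (1280 * real l * ?L\<^sup>2 * (real n * p) * real r)"
  have beta2: "beta\<^sup>2 = 1280 * real l * ?L\<^sup>2 * (real n * p) * real r"
    using p by (simp add: beta_def)
  have L: "0 \<le> ?L" using n(2) by simp
  have mr: "real (n div r) * real r = real n" using r by (metis dvd_div_mult_self of_nat_mult)
  have cs: "card S \<le> n" using card_mono[OF _ S(1)] by simp
  have "(\<Sum>v\<in>S. real (walks {1..n} (blow_up V ER \<union> blow_up W EB) (l - 1) S v)) \<le>
     real (card S) * (2 * real (l - 1) * (32 * p) * ?d ^ (l - 1) * real (card S) / ?d) + real (card S) * beta ^ (l - 1)"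
  \<comment> \<open>The crude bound \<open>n ^ l\<close> on all walk counts is harmless, since it
    enters only through \<open>harm (n ^ l)\<close>, of order \<open>l * ln n\<close>.\<close>
  proof (rule sum_walks_between_le[where M = "n ^ l"])
    show "real (card {w \<in> {1..n}. {v, w} \<in> blow_up V ER \<union> blow_up W EB}) \<le> ?d" if "v \<in> {1..n}" for v
      by (rule card_neighbours_Un_le[OF V W r that prR prB])
    have "?d ^ (l - 1) * real (card S) \<le> real n ^ (l - 1) * real n"
      using d p cs by (intro mult_mono power_mono) auto
    also have "\<dots> = real (n ^ l)" using l by (cases l) auto
    finally show "?d ^ (l - 1) * real (card S) \<le> real (n ^ l)" .
    fix g :: "nat \<Rightarrow> nat" assume g: "(\<Sum>v\<in>{1..n}. g v) \<le> n ^ l"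
    obtain h :: "nat \<Rightarrow> real" where h: "\<And>v. v \<in> {1..n} \<Longrightarrow> 0 \<le> h v"
      "\<And>v. v \<in> {1..n} \<Longrightarrow> real (adj_sum {1..n} (blow_up V ER \<union> blow_up W EB) g v) \<le> 32 * p * (\<Sum>w\<in>{1..n}. real (g w)) + h v"
      "(\<Sum>v\<in>{1..n}. (h v)\<^sup>2) \<le> 16 * (5 * ?L) * (8 * real (n div r) * p) * harm (n ^ l) * (real r)\<^sup>2 * (\<Sum>w\<in>{1..n}. (real (g w))\<^sup>2)"
      by (rule two_blow_ups_fun_step[OF V prR W prB p _ _ g]) (use L p in auto)
    have "16 * (5 * ?L) * (8 * real (n div r) * p) * harm (n ^ l) * (real r)\<^sup>2 =
       640 * ?L * (real (n div r) * real r) * p * real r * harm (n ^ l)" by (simp add: power2_eq_square)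
    also have "\<dots> \<le> 640 * ?L * real n * p * real r * (2 * (real l * ?L))"
      unfolding mr using L p l n by (intro mult_left_mono harm_power_le) auto
    also have "\<dots> = beta\<^sup>2" unfolding beta2 by (simp add: power2_eq_square)
    finally have "(\<Sum>v\<in>{1..n}. (h v)\<^sup>2) \<le> beta\<^sup>2 * (\<Sum>w\<in>{1..n}. (real (g w))\<^sup>2)"
      using h(3) by (meson mult_right_mono order_trans sum_nonneg zero_le_power2)
    then show "\<exists>h :: nat \<Rightarrow> real. \<forall>v\<in>{1..n}. 0 \<le> h v \<and>
        real (adj_sum {1..n} (blow_up V ER \<union> blow_up W EB) g v) \<le> 32 * p * (\<Sum>w\<in>{1..n}. real (g w)) + h v \<and>
        (\<Sum>v\<in>{1..n}. (h v)\<^sup>2) \<le> beta\<^sup>2 * (\<Sum>w\<in>{1..n}. (real (g w))\<^sup>2)"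
      using h(1,2) by blast
  qed (use S d s p in \<open>auto simp: beta_def\<close>)
  then show ?thesis unfolding S(2) walk_bound_def beta_def .
qed

section \<open>Large independent sets\<close>

text \<open>An open pair that is an edge would survive the deletions and contradict independence.
  The pairs that are not open are few: the blue ones are counted by degrees, and those with at least
  \<open>r\<close> walks by the walk bound divided by \<open>r\<close>.\<close>

lemma avoids_of_indep:
  assumes V: "V \<in> equipartitions n r" and W: "W \<in> equipartitions n r" and r: "0 < r" "r dvd n" and m: "m = n div r"
    and prR: "pseudo_random m p (8 * real m * p) (5 * ln (real n)) ER"
    and prB: "pseudo_random m p (8 * real m * p) (5 * ln (real n)) EB"
    and LR: "block_ordering n m V LR" and l: "l = 2 * h + 3" "5 \<le> l"
    and R: "R = blow_up V ER" and B: "B = blow_up W EB"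
    and E: "E = (R \<union> B) \<inter> nsets (surviving l n m V W (R \<union> B)) 2"
    and D: "D = reach {1..n} (\<lambda>x y. {x, y} \<in> R \<union> B \<or> common_part m V W x y) h (bad_vertices n m V W (R \<union> B))"
    and S: "S \<subseteq> surviving l n m V W (R \<union> B) - D" "card S = s" "card (part_indices m V S) = s"
    and ind: "indep S (E - deleted_edges l LR LB R B E)"
    and p: "0 \<le> p" and n: "1 \<le> real l * ln (real n)" "1 < n"
    and d: "1 \<le> 16 * (real n * p)" "16 * (real n * p) \<le> real n" and s: "1 \<le> 32 * p * real s"
    and M: "real M + real s * (8 * (real n * p)) + walk_bound l n r p s / real r \<le> real (s choose 2)"
  shows "avoids n r (l - 1) M LR V B ER S"
proof -
  let ?T = "nsets (part_indices m V S) (2::nat)" and ?N = "{1..n}"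
  let ?o = "open_pair n r (l - 1) LR V S B ER"
  have ER: "ER \<subseteq> nsets {1..m} 2" and EB: "EB \<subseteq> nsets {1..m} 2" using prR prB by (auto simp: pseudo_random_def)
  have Sn: "S \<subseteq> ?N" using S(1) by (auto simp: surviving_def)
  have fS: "finite S" using finite_subset[OF Sn] by simp
  have rep: "Min (S \<inter> V i) \<in> S" "Min (S \<inter> V i) \<in> V i" "i \<in> {1..m}" if "i \<in> part_indices m V S" for i
  proof -
    have "S \<inter> V i \<noteq> {}" "i \<in> {1..m}" using that by (auto simp: part_indices_def)
    then have "Min (S \<inter> V i) \<in> S \<inter> V i" using fS by (intro Min_in) auto
    then show "Min (S \<inter> V i) \<in> S" "Min (S \<inter> V i) \<in> V i" "i \<in> {1..m}" using \<open>i \<in> {1..m}\<close> by auto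
  qed
  have pair: "\<exists>i j x y. P = {i, j} \<and> i \<in> {1..m} \<and> j \<in> {1..m} \<and> x \<in> S \<and> y \<in> S \<and> x \<in> V i \<and> y \<in> V j \<and> rep_pair V S P = {x, y}"
    if P: "P \<in> ?T" for P
  proof -
    obtain i j where ij: "P = {i, j}" "i \<in> part_indices m V S" "j \<in> part_indices m V S" by (rule nsets2E[OF P])
    show ?thesis
      using ij rep[OF ij(2)] rep[OF ij(3)]
      by (intro exI[of _ i] exI[of _ j] exI[of _ "Min (S \<inter> V i)"] exI[of _ "Min (S \<inter> V j)"]) (simp add: rep_pair_def)
  qed
  have 1: "P \<notin> ER" if P: "P \<in> ?T" and op: "?o P" for P
  proof
    assume PE: "P \<in> ER"
    obtain i j x y where w: "P = {i, j}" "i \<in> {1..m}" "j \<in> {1..m}" "x \<in> S" "y \<in> S" "x \<in> V i" "y \<in> V j" "rep_pair V S P = {x, y}"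
      using pair[OF P] by blast
    have nB: "{x, y} \<notin> B" using op w(8) unfolding open_pair_def by simp
    have few: "walks ?N (lower_blow_up n LR V ER P \<union> B) (l - 1) {y} x < r" "walks ?N (lower_blow_up n LR V ER P \<union> B) (l - 1) {x} y < r"
      using op w(8) unfolding open_pair_def by (auto simp: insert_commute)
    have xyR: "{x, y} \<in> R" using blow_up_iff[OF V ER[unfolded m] w(2,3,6,7)[unfolded m]] PE w(1) R by simp
    then have "{x, y} \<in> nsets ?N 2" using blow_up_nsets[OF V ER[unfolded m]] R by blast
    then have ne: "x \<noteq> y" by (auto simp: nsets_def)
    have "{x, y} \<in> E" unfolding E using xyR w(4,5) S(1) nsets2I[OF _ _ ne] by blast
    moreover have "{x, y} \<notin> E - deleted_edges l LR LB R B E" using ind w(4,5) ne unfolding indep_def by blast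
    ultimately have del: "{x, y} \<in> deleted_edges l LR LB R B E" by blast
    have xD: "x \<notin> D" "y \<notin> D" using w(4,5) S(1) by blast+
    have "{i, j} \<in> ER" using PE w(1) by simp
    from deleted_red_edge_walks[OF V W r(1) m ER EB LR l R B E D xD w(2,3,6,7) this nB del refl]
    show False using few unfolding lower_blow_up_def w(1) by linarith
  qed
  define pt where "pt = (\<lambda>v. SOME i. i \<in> {1..m} \<and> v \<in> V i)"
  have pt_eq: "pt v = i" if "i \<in> {1..m}" "v \<in> V i" for v i
  proof -
    have "pt v \<in> {1..m} \<and> v \<in> V (pt v)" unfolding pt_def by (rule someI[of _ i]) (use that in blast)
    then show ?thesis using equipartitionsD(6)[OF V] that m by blast
  qed
  define K1 where "K1 = {P \<in> ?T. rep_pair V S P \<in> B}"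
  define K2 where "K2 = {P \<in> ?T. \<exists>x y. rep_pair V S P = {x, y} \<and> r \<le> walks ?N (lower_blow_up n LR V ER P \<union> B) (l - 1) {y} x}"
  define S1 where "S1 = {z \<in> S \<times> S. {fst z, snd z} \<in> B}"
  define S2 where "S2 = {z \<in> S \<times> S. r \<le> walks ?N (R \<union> B) (l - 1) {snd z} (fst z)}"
  have fin12: "finite S1" "finite S2" using fS by (auto simp: S1_def S2_def)
  \<comment> \<open>Two orders of the same pair of vertices give one pair of parts; only
    surjectivity is used.\<close>
  have K1: "card K1 \<le> card S1"
  proof (rule surj_card_le[OF fin12(1), of _ "\<lambda>z. {pt (fst z), pt (snd z)}"])
    show "K1 \<subseteq> (\<lambda>z. {pt (fst z), pt (snd z)}) ` S1"
    proof
      fix P assume P: "P \<in> K1"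
      obtain i j x y where w: "P = {i, j}" "i \<in> {1..m}" "j \<in> {1..m}" "x \<in> S" "y \<in> S" "x \<in> V i" "y \<in> V j" "rep_pair V S P = {x, y}"
        using pair[of P] P unfolding K1_def by blast
      have "(x, y) \<in> S1" using P w(4,5,8) by (simp add: K1_def S1_def)
      moreover have "P = {pt x, pt y}" using w(1) pt_eq[OF w(2,6)] pt_eq[OF w(3,7)] by simp
      ultimately show "P \<in> (\<lambda>z. {pt (fst z), pt (snd z)}) ` S1" by (intro image_eqI[of _ _ "(x, y)"]) simp_all
    qed
  qed
  \<comment> \<open>The partially revealed graph varies with the pair. Comparing it with the full
    graph lets one walk count serve for all pairs.\<close>
  have low: "lower_blow_up n LR V ER P \<union> B \<subseteq> R \<union> B" for P
    unfolding lower_blow_up_def R by (rule Un_mono[OF blow_up_mono order_refl]) auto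
  have K2: "card K2 \<le> card S2"
  proof (rule surj_card_le[OF fin12(2), of _ "\<lambda>z. {pt (fst z), pt (snd z)}"])
    show "K2 \<subseteq> (\<lambda>z. {pt (fst z), pt (snd z)}) ` S2"
    proof
      fix P assume P: "P \<in> K2"
      obtain i j x y where w: "P = {i, j}" "i \<in> {1..m}" "j \<in> {1..m}" "x \<in> S" "y \<in> S" "x \<in> V i" "y \<in> V j" "rep_pair V S P = {x, y}"
        using pair[of P] P unfolding K2_def by blast
      obtain u v where uv: "rep_pair V S P = {u, v}" "r \<le> walks ?N (lower_blow_up n LR V ER P \<union> B) (l - 1) {v} u"
        using P unfolding K2_def by blast
      have uvxy: "(u = x \<and> v = y) \<or> (u = y \<and> v = x)" using uv(1) w(8) by (auto simp: doubleton_eq_iff)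
      have "walks ?N (lower_blow_up n LR V ER P \<union> B) (l - 1) {v} u \<le> walks ?N (R \<union> B) (l - 1) {v} u"
        by (rule walks_mono[OF _ low]) simp
      then have "(u, v) \<in> S2" using uv(2) uvxy w(4,5) by (auto simp: S2_def)
      moreover have "P = {pt u, pt v}" using w(1) pt_eq[OF w(2,6)] pt_eq[OF w(3,7)] uvxy by auto
      ultimately show "P \<in> (\<lambda>z. {pt (fst z), pt (snd z)}) ` S2" by (intro image_eqI[of _ _ "(u, v)"]) simp_all
    qed
  qed
  have S1le: "real (card S1) \<le> real s * (8 * (real n * p))"
  proof -
    have "S1 = (SIGMA x:S. {y \<in> S. {x, y} \<in> B})" by (auto simp: S1_def)
    then have "card S1 = (\<Sum>x\<in>S. card {y \<in> S. {x, y} \<in> B})" using fS by (simp add: card_SigmaI)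
    then have "real (card S1) = (\<Sum>x\<in>S. real (card {y \<in> S. {x, y} \<in> B}))" by simp
    also have "\<dots> \<le> (\<Sum>x\<in>S. 8 * (real n * p))"
    proof (rule sum_mono)
      fix x assume "x \<in> S"
      then have x: "x \<in> ?N" using Sn by blast
      have "card {y \<in> S. {x, y} \<in> B} \<le> card {w \<in> ?N. {x, w} \<in> blow_up W EB}"
        using Sn B by (intro card_mono) auto
      then show "real (card {y \<in> S. {x, y} \<in> B}) \<le> 8 * (real n * p)"
        using card_neighbours_le[OF W r prB[unfolded m] x] by linarith
    qed
    finally show ?thesis using S(2) by simp
  qed
  have S2le: "real (card S2) \<le> walk_bound l n r p s / real r"
  proof -
    have "real r * real (card S2) = (\<Sum>z\<in>S2. real r)" by simp
    also have "\<dots> \<le> (\<Sum>z\<in>S2. real (walks ?N (R \<union> B) (l - 1) {snd z} (fst z)))"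
      by (intro sum_mono of_nat_mono) (simp add: S2_def)
    also have "\<dots> \<le> (\<Sum>z\<in>S \<times> S. real (walks ?N (R \<union> B) (l - 1) {snd z} (fst z)))"
      using fS by (intro sum_mono2) (auto simp: S2_def)
    also have "\<dots> = (\<Sum>x\<in>S. \<Sum>y\<in>S. real (walks ?N (R \<union> B) (l - 1) {y} x))"
      by (simp add: sum.cartesian_product case_prod_unfold)
    also have "\<dots> = (\<Sum>x\<in>S. real (walks ?N (R \<union> B) (l - 1) S x))"
      by (intro sum.cong refl) (simp only: sum_walks_singletons[OF fS] flip: of_nat_sum)
    also have "\<dots> \<le> walk_bound l n r p s"
      unfolding R B using sum_walks_le_walk_bound[OF V W r prR[unfolded m] prB[unfolded m] Sn S(2) p _ n d s] l by simp
    finally show ?thesis using r(1) by (simp add: field_simps)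
  qed
  have fT: "finite ?T" by (rule finite_imp_finite_nsets) (simp add: part_indices_def)
  have cT: "card ?T = s choose 2" by (simp add: card_nsets S(3))
  have "?T - (K1 \<union> K2) \<subseteq> {P \<in> ?T. ?o P}"
  proof
    fix P assume P: "P \<in> ?T - (K1 \<union> K2)"
    then have "rep_pair V S P \<notin> B" by (simp add: K1_def)
    moreover have "walks ?N (lower_blow_up n LR V ER P \<union> B) (l - 1) {y} x < r" if "rep_pair V S P = {x, y}" for x y
      using P that unfolding K2_def not_le[symmetric] by blast
    ultimately show "P \<in> {P \<in> ?T. ?o P}" using P by (simp add: open_pair_def)
  qed
  then have "card (?T - (K1 \<union> K2)) \<le> card {P \<in> ?T. ?o P}" using fT by (intro card_mono) auto
  moreover have "card ?T - card (K1 \<union> K2) \<le> card (?T - (K1 \<union> K2))" by (rule diff_card_le_card_Diff) (use fT in \<open>auto simp: K1_def K2_def\<close>)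
  moreover have "card (K1 \<union> K2) \<le> card K1 + card K2" by (rule card_Un_le)
  ultimately have "s choose 2 \<le> card {P \<in> ?T. ?o P} + card S1 + card S2" using K1 K2 cT by linarith
  then have "real (s choose 2) \<le> real (card {P \<in> ?T. ?o P}) + real (card S1) + real (card S2)"
    by (metis of_nat_add of_nat_le_iff)
  then have "real M \<le> real (card {P \<in> ?T. ?o P})" using M S1le S2le by linarith
  then have "M \<le> card {P \<in> ?T. ?o P}" by simp
  then show ?thesis unfolding avoids_def m[symmetric] using 1 by blast
qed

lemma ex_transversal:
  assumes V: "V \<in> equipartitions n r" and S: "S \<subseteq> {1..n}" and s: "s \<le> card (part_indices (n div r) V S)"
  obtains T where "T \<subseteq> S" "card T = s" "card (part_indices (n div r) V T) = s"
proof -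
  have fS: "finite S" using finite_subset[OF S] by simp
  obtain I where I: "I \<subseteq> part_indices (n div r) V S" "card I = s" "finite I" using obtain_subset_with_card_n[OF s] by metis
  have mi: "Min (S \<inter> V i) \<in> S \<inter> V i" "i \<in> {1..n div r}" if "i \<in> I" for i
  proof -
    have "S \<inter> V i \<noteq> {}" "i \<in> {1..n div r}" using that I(1) by (auto simp: part_indices_def)
    then show "Min (S \<inter> V i) \<in> S \<inter> V i" "i \<in> {1..n div r}" using fS by (auto intro!: Min_in simp del: Int_iff)
  qed
  define T where "T = (\<lambda>i. Min (S \<inter> V i)) ` I"
  have inj: "inj_on (\<lambda>i. Min (S \<inter> V i)) I"
  proof (rule inj_onI)
    fix i j assume ij: "i \<in> I" "j \<in> I" "Min (S \<inter> V i) = Min (S \<inter> V j)"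
    show "i = j" using equipartitionsD(6)[OF V mi(2)[OF ij(1)] mi(2)[OF ij(2)], of "Min (S \<inter> V i)"] mi(1)[OF ij(1)] mi(1)[OF ij(2)] ij(3) by simp
  qed
  have "part_indices (n div r) V T = I"
  proof (intro equalityI subsetI)
    fix i assume "i \<in> part_indices (n div r) V T"
    then obtain j where j: "i \<in> {1..n div r}" "j \<in> I" "Min (S \<inter> V j) \<in> V i" by (auto simp: part_indices_def T_def)
    have "i = j" using equipartitionsD(6)[OF V j(1) mi(2)[OF j(2)] j(3)] mi(1)[OF j(2)] by simp
    then show "i \<in> I" using j by simp
  next
    fix i assume i: "i \<in> I"
    then show "i \<in> part_indices (n div r) V T" using mi[OF i] unfolding part_indices_def T_def by blast
  qed
  moreover have "T \<subseteq> S" using mi(1) by (auto simp: T_def)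
  moreover have "card T = s" using card_image[OF inj] I(2) by (simp add: T_def)
  ultimately show ?thesis using that I(2) by metis
qed

text \<open>A set meeting few parts of both partitions lies in a small intersection.\<close>

lemma many_parts:
  assumes V: "V \<in> equipartitions n r" and W: "W \<in> equipartitions n r" and S: "S \<subseteq> {1..n}" and s: "s \<le> n div r"
    and small: "\<And>I J. I \<in> nsets {1..n div r} s \<Longrightarrow> J \<in> nsets {1..n div r} s \<Longrightarrow> card ((\<Union>i\<in>I. V i) \<inter> (\<Union>j\<in>J. W j)) < card S"
  shows "s \<le> card (part_indices (n div r) V S) \<or> s \<le> card (part_indices (n div r) W S)"
proof (rule ccontr)
  assume "\<not> ?thesis"
  then have less: "card (part_indices (n div r) V S) \<le> s" "card (part_indices (n div r) W S) \<le> s" by auto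
  have ext: "\<exists>I\<in>nsets {1..n div r} s. A \<subseteq> I" if A: "A \<subseteq> {1..n div r}" "card A \<le> s" for A
  proof -
    have "s \<le> card {1..n div r}" using s by simp
    then obtain I where "A \<subseteq> I" "I \<subseteq> {1..n div r}" "card I = s"
      using exists_subset_between[OF A(2) _ A(1)] by auto
    then show ?thesis using finite_subset[of I "{1..n div r}"] by (auto simp: nsets_def)
  qed
  obtain I J where IJ: "I \<in> nsets {1..n div r} s" "part_indices (n div r) V S \<subseteq> I" "J \<in> nsets {1..n div r} s" "part_indices (n div r) W S \<subseteq> J"
  proof -
    have "part_indices (n div r) V S \<subseteq> {1..n div r}" "part_indices (n div r) W S \<subseteq> {1..n div r}"
      unfolding part_indices_def by blast+
    then show ?thesis using ext[OF _ less(1)] ext[OF _ less(2)] that by blast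
  qed
  have "S \<subseteq> (\<Union>i\<in>I. V i) \<inter> (\<Union>j\<in>J. W j)"
  proof
    fix x assume x: "x \<in> S"
    then have xn: "x \<in> {1..n}" using S by blast
    obtain i j where "i \<in> {1..n div r}" "x \<in> V i" "j \<in> {1..n div r}" "x \<in> W j"
      using equipartitionsD(7)[OF V xn] equipartitionsD(7)[OF W xn] by blast
    then have "i \<in> I" "j \<in> J" using IJ(2,4) x by (auto simp: part_indices_def)
    then show "x \<in> (\<Union>i\<in>I. V i) \<inter> (\<Union>j\<in>J. W j)" using \<open>x \<in> V i\<close> \<open>x \<in> W j\<close> by blast
  qed
  moreover have "(\<Union>i\<in>I. V i) \<subseteq> {1..n}"
    using card_Union_parts(2)[OF V] IJ(1) by (simp add: nsets_def)
  then have "finite ((\<Union>i\<in>I. V i) \<inter> (\<Union>j\<in>J. W j))" by (meson finite_Int finite_atLeastAtMost finite_subset)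
  ultimately have "card S \<le> card ((\<Union>i\<in>I. V i) \<inter> (\<Union>j\<in>J. W j))" by (intro card_mono)
  then show False using small[OF IJ(1,3)] by simp
qed

lemma indep_number_le:
  assumes "finite X" "\<And>S. S \<subseteq> X \<Longrightarrow> indep S E \<Longrightarrow> real (card S) \<le> c"
  shows "real (indep_number X E) \<le> c"
proof -
  let ?A = "{card S | S. S \<subseteq> X \<and> indep S E}"
  have "?A \<subseteq> card ` Pow X" by auto
  then have "finite ?A" using assms(1) finite_subset by blast
  moreover have "indep {} E" by (simp add: indep_def)
  then have "?A \<noteq> {}" by blast
  ultimately have "indep_number X E \<in> ?A" unfolding indep_number_def by (rule Max_in)
  then show ?thesis using assms(2) by auto
qed

text \<open>The deterministic end of the argument, all random events having become hypotheses. At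
  most half of \<open>\<kappa>\<close> is lost to the vertices close to exceptional ones, and the
  rest is still large enough for \<open>many_parts\<close>.\<close>

lemma good_event_conclusion:
  assumes V: "V \<in> equipartitions n r" and W: "W \<in> equipartitions n r" and r: "0 < r" "r dvd n" and m: "m = n div r"
    and prR: "pseudo_random m p (8 * real m * p) (5 * ln (real n)) ER"
    and prB: "pseudo_random m p (8 * real m * p) (5 * ln (real n)) EB"
    and LR: "block_ordering n m V LR" and LB: "block_ordering n m W LB" and l: "l = 2 * h + 3" "5 \<le> l"
    and R: "R = blow_up V ER" and B: "B = blow_up W EB"
    and p: "0 \<le> p" and n: "1 \<le> real l * ln (real n)" "1 < n"
    and d: "1 \<le> 16 * (real n * p)" "16 * (real n * p) \<le> real n" and s: "1 \<le> 32 * p * real s" "s \<le> m"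
    and M: "real M + real s * (8 * (real n * p)) + walk_bound l n r p s / real r \<le> real (s choose 2)"
    and rd: "real r \<le> real n * p"
    and del: "2 * card ({1..n} - surviving l n m V W (R \<union> B)) \<le> n"
    and bad: "real (card (bad_vertices n m V W (R \<union> B))) * (18 * (real n * p) + 1) ^ h \<le> \<kappa> / 2"
    and k0: "real k0 < \<kappa> / 2 + 1"
    and small: "\<And>I J. I \<in> nsets {1..m} s \<Longrightarrow> J \<in> nsets {1..m} s \<Longrightarrow> card ((\<Union>i\<in>I. V i) \<inter> (\<Union>j\<in>J. W j)) < k0"
    and av: "\<And>S. S \<in> nsets {1..n} s \<Longrightarrow> \<not> avoids n r (l - 1) M LR V B ER S"
      "\<And>S. S \<in> nsets {1..n} s \<Longrightarrow> \<not> avoids n r (l - 1) M LB W R EB S"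
  shows "case final_graph l n m LR LB V W R B of (X, E) \<Rightarrow> (\<nexists>xs. length xs = l \<and> is_cycle E xs) \<and>
     real n / 2 \<le> real (card X) \<and> real (indep_number X E) \<le> \<kappa>"
proof -
  define X where "X = surviving l n m V W (R \<union> B)"
  define E where "E = (R \<union> B) \<inter> nsets X 2"
  let ?C = "common_part m V W"
  have fg: "final_graph l n m LR LB V W R B = (X, E - deleted_edges l LR LB R B E)"
    by (simp add: final_graph_def Let_def X_def E_def)
  have ER: "ER \<subseteq> nsets {1..n div r} 2" and EB: "EB \<subseteq> nsets {1..n div r} 2"
    using prR prB m by (auto simp: pseudo_random_def)
  have RB: "R \<union> B \<subseteq> nsets {1..n} 2" using blow_up_nsets[OF V ER] blow_up_nsets[OF W EB] R B by blast
  have Xn: "X \<subseteq> {1..n}" by (auto simp: X_def surviving_def)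
  have fX: "finite X" using finite_subset[OF Xn] by simp
  have "odd l" using l by simp
  have "\<not> (length xs = l \<and> is_cycle (E - deleted_edges l LR LB R B E) xs)" for xs
  proof (rule no_cycle_after_deletion[OF \<open>odd l\<close>])
    show "linear_order_on (nsets {1..n} 2) LR" "linear_order_on (nsets {1..n} 2) LB"
      using LR LB by (simp_all add: block_ordering_def)
    show "E \<subseteq> R \<union> B" "E \<subseteq> nsets {1..n} 2" using RB by (auto simp: E_def)
  qed
  moreover have "real n / 2 \<le> real (card X)"
  proof -
    have "card ({1..n} - X) = n - card X" using card_Diff_subset[OF fX Xn] by simp
    then show ?thesis using del card_mono[OF _ Xn] unfolding X_def[symmetric] by simp
  qed
  moreover have "real (indep_number X (E - deleted_edges l LR LB R B E)) \<le> \<kappa>"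
  proof (rule indep_number_le[OF fX], rule ccontr)
    fix S assume S: "S \<subseteq> X" "indep S (E - deleted_edges l LR LB R B E)" and "\<not> real (card S) \<le> \<kappa>"
    then have big: "\<kappa> < real (card S)" by simp
    define D where "D = reach {1..n} (\<lambda>x y. {x, y} \<in> R \<union> B \<or> ?C x y) h (bad_vertices n m V W (R \<union> B))"
    have fS: "finite S" using finite_subset[OF S(1) fX] .
    have D: "real (card D) \<le> \<kappa> / 2" "D \<subseteq> {1..n}"
    proof -
      \<comment> \<open>At most \<open>16 * (n * p)\<close> neighbours, and at most
        \<open>2 * r\<close> vertices in the two parts of \<open>y\<close>, where
        \<open>r \<le> n * p\<close>.\<close>
      have nb: "real (card {x \<in> {1..n}. {x, y} \<in> R \<union> B \<or> ?C x y}) \<le> 18 * (real n * p)" if y: "y \<in> {1..n}" for y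
      proof -
        have "{x \<in> {1..n}. {x, y} \<in> R \<union> B \<or> ?C x y} = {x \<in> {1..n}. {y, x} \<in> R \<union> B} \<union> {x \<in> {1..n}. ?C x y}"
          by (auto simp: insert_commute)
        then have "card {x \<in> {1..n}. {x, y} \<in> R \<union> B \<or> ?C x y} \<le> card {x \<in> {1..n}. {y, x} \<in> R \<union> B} + card {x \<in> {1..n}. ?C x y}"
          by (simp only: card_Un_le)
        moreover have "real (card {x \<in> {1..n}. {y, x} \<in> R \<union> B}) \<le> 16 * (real n * p)"
          unfolding R B by (rule card_neighbours_Un_le[OF V W r y prR[unfolded m] prB[unfolded m]])
        moreover have "card {x \<in> {1..n}. ?C x y} \<le> 2 * r" unfolding m by (rule common_part_card[OF V W])
        ultimately show ?thesis using rd by linarith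
      qed
      have bn: "bad_vertices n m V W (R \<union> B) \<subseteq> {1..n}" by (auto simp: bad_vertices_def)
      have "real (card D) \<le> (18 * (real n * p) + 1) ^ h * real (card (bad_vertices n m V W (R \<union> B))) \<and> D \<subseteq> {1..n}"
        unfolding D_def by (rule card_reach_le[OF finite_atLeastAtMost nb bn]) (use p in auto)
      then show "real (card D) \<le> \<kappa> / 2" "D \<subseteq> {1..n}" using bad by (simp_all add: mult.commute)
    qed
    define T where "T = S - D"
    have Tn: "T \<subseteq> {1..n}" using S(1) Xn by (auto simp: T_def)
    have "card S - card D \<le> card T" unfolding T_def using finite_subset[OF D(2)] by (intro diff_card_le_card_Diff) simp
    then have "\<kappa> / 2 < real (card T)" using big D(1) by linarith
    \<comment> \<open>Both numbers are integers, \<open>card T\<close> is above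
      \<open>\<kappa> / 2\<close>, and \<open>k0\<close> is below
      \<open>\<kappa> / 2 + 1\<close>.\<close>
    then have kT: "k0 \<le> card T" using k0 by linarith
    have sm: "card ((\<Union>i\<in>I. V i) \<inter> (\<Union>j\<in>J. W j)) < card T"
      if "I \<in> nsets {1..n div r} s" "J \<in> nsets {1..n div r} s" for I J
      using small[unfolded m, OF that] kT by linarith
    have contra: False if part: "P \<in> equipartitions n r" "s \<le> card (part_indices (n div r) P T)"
      and step: "\<And>U. U \<subseteq> T \<Longrightarrow> card U = s \<Longrightarrow> card (part_indices m P U) = s \<Longrightarrow> indep U (E - deleted_edges l LR LB R B E) \<Longrightarrow> False" for P
    proof -
      obtain U where U: "U \<subseteq> T" "card U = s" "card (part_indices (n div r) P U) = s"
        by (rule ex_transversal[OF part(1) Tn part(2)])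
      have "indep U (E - deleted_edges l LR LB R B E)" using S(2) U(1) unfolding indep_def T_def by blast
      then show False using step[OF U(1,2)] U(3) m by blast
    qed
    have nsU: "U \<in> nsets {1..n} s" if "U \<subseteq> T" "card U = s" for U
      using that Tn finite_subset[of U "{1..n}"] by (auto simp: nsets_def)
    from many_parts[OF V W Tn s(2)[unfolded m] sm] show False
    proof
      assume "s \<le> card (part_indices (n div r) V T)"
      then show False
      proof (rule contra[OF V])
        fix U assume U: "U \<subseteq> T" "card U = s" "card (part_indices m V U) = s" "indep U (E - deleted_edges l LR LB R B E)"
        have sub: "U \<subseteq> surviving l n m V W (R \<union> B) - D" using U(1) S(1) by (auto simp: T_def X_def)
        have "avoids n r (l - 1) M LR V B ER U"
          by (rule avoids_of_indep[OF V W r m prR prB LR l R B E_def[unfolded X_def] D_def sub U(2,3,4) p n d s(1) M])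
        then show False using av(1)[OF nsU[OF U(1,2)]] by blast
      qed
    next
      assume "s \<le> card (part_indices (n div r) W T)"
      then show False
      proof (rule contra[OF W])
        fix U assume U: "U \<subseteq> T" "card U = s" "card (part_indices m W U) = s" "indep U (E - deleted_edges l LR LB R B E)"
        \<comment> \<open>The blue case is the red one with the colours interchanged.\<close>
        have sw: "surviving l n m V W (R \<union> B) = surviving l n m W V (B \<union> R)"
          by (subst surviving_swap) (simp only: Un_commute)
        have E': "E = (B \<union> R) \<inter> nsets (surviving l n m W V (B \<union> R)) 2"
          unfolding E_def X_def sw by (simp only: Un_commute)
        have D': "D = reach {1..n} (\<lambda>x y. {x, y} \<in> B \<union> R \<or> common_part m W V x y) h (bad_vertices n m W V (B \<union> R))"
          unfolding D_def bad_vertices_def by (simp only: Un_commute[of R B] common_part_swap[of m V W])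
        have sub: "U \<subseteq> surviving l n m W V (B \<union> R) - D" using U(1) S(1) unfolding T_def X_def sw by blast
        have ind: "indep U (E - deleted_edges l LB LR B R E)" using U(4) deleted_edges_swap[of l LR LB R B E] by simp
        have "avoids n r (l - 1) M LB W R EB U"
          by (rule avoids_of_indep[OF W V r m prB prR LB l B R E' D' sub U(2,3) ind p n d s(1) M])
        then show False using av(2)[OF nsU[OF U(1,2)]] by blast
      qed
    qed
  qed
  ultimately show ?thesis unfolding fg by simp
qed

section \<open>The probability of failure\<close>

lemma set_pmf_equipartitions:
  assumes "0 < r" "r dvd n"
  shows "set_pmf (pmf_of_set (equipartitions n r)) = equipartitions n r"
  by (rule set_pmf_of_set[OF equipartitions_nonempty[OF assms] finite_equipartitions])

text \<open>The terms of the bound belong, in this order, to a large intersection of parts, a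
  failure of pseudo-randomness in either reduced graph, too many deleted vertices, too many
  exceptional vertices, and a transversal without open edges in either colour.\<close>

lemma prob_failure_le:
  fixes LR LB :: "(nat \<Rightarrow> nat set) \<Rightarrow> nat set rel"
  assumes r: "0 < r" "r dvd n" and pp: "p = edge_prob l n" and l: "l = 2 * h + 3" "5 \<le> l"
    and LR: "\<And>V. V \<in> equipartitions n r \<Longrightarrow> block_ordering n (n div r) V (LR V)"
    and LB: "\<And>W. W \<in> equipartitions n r \<Longrightarrow> block_ordering n (n div r) W (LB W)"
    and p: "0 < p" "p < 1" and n: "1 \<le> real l * ln (real n)" "1 < n"
    and d: "1 \<le> 16 * (real n * p)" "16 * (real n * p) \<le> real n" and s: "1 \<le> 32 * p * real s" "s \<le> n div r"
    and M: "real M + real s * (8 * (real n * p)) + walk_bound l n r p s / real r \<le> real (s choose 2)"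
    and rd: "real r \<le> real n * p" and \<kappa>: "0 < \<kappa>" and k0: "real k0 < \<kappa> / 2 + 1" "0 < k0" "k0 \<le> n"
  shows "1 - measure_pmf.prob (random_graph l n r LR LB) {(X, E). (\<nexists>xs. length xs = l \<and> is_cycle E xs) \<and>
       real n / 2 \<le> real (card X) \<and> real (indep_number X E) \<le> \<kappa>} \<le>
     real n ^ (2 * s) * (exp 2 * (real (s * r))\<^sup>2 / (real k0 * real n)) ^ k0 +
     2 * (real (n div r) * exp (- (8 * real (n div r) * p)) + ((1 + exp (- (5 / 2 * ln (real n)))) ^ (n div r) - 1)\<^sup>2) +
     2 ^ l * ((2 * (real n * p)) ^ (l - 2) * (2 * real r)) / (real n / (2 * real l)) +
     4 * (real n * p) * real r / (\<kappa> / 2 / (18 * (real n * p) + 1) ^ h) +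
     2 * (real n ^ s * (1 - p) ^ M)"
    (is "1 - measure_pmf.prob _ ?Good \<le> ?q1 + 2 * ?q2 + ?q3 + ?q4 + 2 * ?q5")
proof -
  let ?m = "n div r" and ?Q = "pmf_of_set (equipartitions n r)"
  let ?G = "gnp ?m p"
  let ?VW = "pair_pmf ?Q ?Q" and ?GG = "pair_pmf ?G ?G"
  let ?Om = "pair_pmf ?VW ?GG"
  let ?f = "\<lambda>((V, W), (ER, EB)). final_graph l n ?m (LR V) (LB W) V W (blow_up V ER) (blow_up W EB)"
  let ?pr = "pseudo_random ?m p (8 * real ?m * p) (5 * ln (real n))"
  \<comment> \<open>With fewer than \<open>?c3\<close> short cycles of at most \<open>l\<close>
    vertices, fewer than \<open>n / 2\<close> vertices are deleted; with fewer than
    \<open>?c4\<close> exceptional vertices, the ball of radius \<open>h\<close> around them has at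
    most \<open>\<kappa> / 2\<close> vertices.\<close>
  let ?c3 = "real n / (2 * real l)" and ?c4 = "\<kappa> / 2 / (18 * (real n * p) + 1) ^ h"
  note sQ = set_pmf_equipartitions[OF r]
  have p': "0 \<le> p" "p \<le> 1" using p by auto
  define B1 where "B1 = {(vw, g :: nat set set \<times> nat set set). case vw of (V, W) \<Rightarrow> \<exists>I J. I \<in> nsets {1..?m} s \<and> J \<in> nsets {1..?m} s \<and>
      k0 \<le> card ((\<Union>i\<in>I. (V :: nat \<Rightarrow> nat set) i) \<inter> (\<Union>j\<in>J. (W :: nat \<Rightarrow> nat set) j))}"
  define B2 where "B2 = {(vw :: (nat \<Rightarrow> nat set) \<times> (nat \<Rightarrow> nat set), g). case g of (ER, EB :: nat set set) \<Rightarrow> \<not> ?pr ER}"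
  define B2' where "B2' = {(vw :: (nat \<Rightarrow> nat set) \<times> (nat \<Rightarrow> nat set), g). case g of (ER :: nat set set, EB) \<Rightarrow> \<not> ?pr EB}"
  define B3 where "B3 = {(vw, g). case vw of (V, W) \<Rightarrow> case g of (ER, EB) \<Rightarrow>
      ?c3 * real l \<le> real (card ({1..n} - surviving l n ?m V W (blow_up V ER \<union> blow_up W EB)))}"
  define B4 where "B4 = {(vw, g). case vw of (V, W) \<Rightarrow> case g of (ER, EB) \<Rightarrow>
      ?c4 \<le> real (card (bad_vertices n ?m V W (blow_up V ER \<union> blow_up W EB)))}"
  define B5 where "B5 = {(vw, g). case vw of (V, W) \<Rightarrow> case g of (ER, EB) \<Rightarrow>
      \<exists>S\<in>nsets {1..n} s. avoids n r (l - 1) M (LR V) V (blow_up W EB) ER S}"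
  define B5' where "B5' = {(vw, g). case vw of (V, W) \<Rightarrow> case g of (ER, EB) \<Rightarrow>
      \<exists>S\<in>nsets {1..n} s. avoids n r (l - 1) M (LB W) W (blow_up V ER) EB S}"
  have VWin: "fst vw \<in> equipartitions n r" "snd vw \<in> equipartitions n r" if "vw \<in> set_pmf ?VW" for vw
    using that unfolding set_pair_pmf sQ by auto
  have b1: "measure_pmf.prob ?Om B1 \<le> ?q1"
  proof -
    have "measure_pmf.prob ?Om B1 = measure_pmf.prob ?VW {(V, W). \<exists>I J. I \<in> nsets {1..?m} s \<and> J \<in> nsets {1..?m} s \<and>
      k0 \<le> card ((\<Union>i\<in>I. V i) \<inter> (\<Union>j\<in>J. W j))}"
      unfolding B1_def prob_pair_pmf_fst by (simp only: case_prod_unfold)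
    also have "\<dots> \<le> ?q1"
      by (rule prob_pair_pmf_le, rule prob_large_intersection[OF r _ k0(2,3)]) (simp only: sQ)
    finally show ?thesis .
  qed
  have pm: "real ?m \<le> exp (ln (real n))" using n(2) by (simp add: div_le_dividend)
  have ln0: "0 \<le> ln (real n)" using n(2) by simp
  have g2: "measure_pmf.prob ?G {E. \<not> ?pr E} \<le> ?q2" by (rule prob_gnp_not_pseudo_random[OF p' pm ln0])
  have b2: "measure_pmf.prob ?Om B2 \<le> ?q2"
    unfolding B2_def prob_pair_pmf_snd using g2 prob_pair_pmf_fst[of ?G ?G "\<lambda>E. \<not> ?pr E"]
    by (simp only: case_prod_unfold)
  have b2': "measure_pmf.prob ?Om B2' \<le> ?q2"
    unfolding B2'_def prob_pair_pmf_snd using g2 prob_pair_pmf_snd[of ?G ?G "\<lambda>E. \<not> ?pr E"]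
    by (simp only: case_prod_unfold)
  have b3: "measure_pmf.prob ?Om B3 \<le> ?q3"
    unfolding B3_def
  proof (rule prob_pair_pmf_le)
    fix vw assume vw: "vw \<in> set_pmf ?VW"
    have "odd l" using l by simp
    have "measure_pmf.prob ?GG {(ER, EB). ?c3 * real l \<le> real (card ({1..n} - surviving l n ?m (fst vw) (snd vw) (blow_up (fst vw) ER \<union> blow_up (snd vw) EB)))} \<le> ?q3"
      by (rule prob_many_deleted_vertices[OF VWin[OF vw] r(1) p' \<open>odd l\<close> l(2) rd]) (use n l in simp)
    then show "measure_pmf.prob ?GG {g. case vw of (V, W) \<Rightarrow> case g of (ER, EB) \<Rightarrow>
       ?c3 * real l \<le> real (card ({1..n} - surviving l n ?m V W (blow_up V ER \<union> blow_up W EB)))} \<le> ?q3"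
      by (simp only: case_prod_unfold)
  qed
  have c4: "0 < ?c4" using \<kappa> p by (intro divide_pos_pos zero_less_power) (auto intro!: add_nonneg_pos)
  have b4: "measure_pmf.prob ?Om B4 \<le> ?q4"
    unfolding B4_def
  proof (rule prob_pair_pmf_le)
    fix vw assume vw: "vw \<in> set_pmf ?VW"
    have "measure_pmf.prob ?GG {(ER, EB). ?c4 \<le> real (card (bad_vertices n ?m (fst vw) (snd vw) (blow_up (fst vw) ER \<union> blow_up (snd vw) EB)))} \<le> ?q4"
      by (rule prob_many_bad_vertices[OF VWin[OF vw] p' c4])
    then show "measure_pmf.prob ?GG {g. case vw of (V, W) \<Rightarrow> case g of (ER, EB) \<Rightarrow>
       ?c4 \<le> real (card (bad_vertices n ?m V W (blow_up V ER \<union> blow_up W EB)))} \<le> ?q4"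
      by (simp only: case_prod_unfold)
  qed
  have b5: "measure_pmf.prob ?Om B5 \<le> ?q5"
    unfolding B5_def
  proof (rule prob_pair_pmf_le)
    fix vw assume vw: "vw \<in> set_pmf ?VW"
    have "measure_pmf.prob ?GG {(ER, EB). \<exists>S\<in>nsets {1..n} s. avoids n r (l - 1) M (LR (fst vw)) (fst vw) (blow_up (snd vw) EB) ER S} \<le> ?q5"
      \<comment> \<open>The blue graph is fixed first here and the red one stays random; in the
        symmetric case the factors already have the right order.\<close>
      by (subst prob_pair_pmf_swap, rule prob_pair_pmf_le, rule prob_ex_avoids[OF VWin(1)[OF vw] r(1) LR[OF VWin(1)[OF vw]] p'(1) p(2)])
    then show "measure_pmf.prob ?GG {g. case vw of (V, W) \<Rightarrow> case g of (ER, EB) \<Rightarrow>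
       \<exists>S\<in>nsets {1..n} s. avoids n r (l - 1) M (LR V) V (blow_up W EB) ER S} \<le> ?q5"
      by (simp only: case_prod_unfold)
  qed
  have b5': "measure_pmf.prob ?Om B5' \<le> ?q5"
    unfolding B5'_def
  proof (rule prob_pair_pmf_le)
    fix vw assume vw: "vw \<in> set_pmf ?VW"
    have "measure_pmf.prob ?GG {(ER, EB). \<exists>S\<in>nsets {1..n} s. avoids n r (l - 1) M (LB (snd vw)) (snd vw) (blow_up (fst vw) ER) EB S} \<le> ?q5"
      by (rule prob_pair_pmf_le, rule prob_ex_avoids[OF VWin(2)[OF vw] r(1) LB[OF VWin(2)[OF vw]] p'(1) p(2)])
    then show "measure_pmf.prob ?GG {g. case vw of (V, W) \<Rightarrow> case g of (ER, EB) \<Rightarrow>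
       \<exists>S\<in>nsets {1..n} s. avoids n r (l - 1) M (LB W) W (blow_up V ER) EB S} \<le> ?q5"
      by (simp only: case_prod_unfold)
  qed
  let ?B = "B1 \<union> (B2 \<union> (B2' \<union> (B3 \<union> (B4 \<union> (B5 \<union> B5')))))"
  have good: "?f x \<in> ?Good" if x: "x \<in> set_pmf ?Om" and nB: "x \<notin> ?B" for x
  proof -
    obtain V W ER EB where xe: "x = ((V, W), (ER, EB))" by (metis surj_pair)
    have VW: "V \<in> equipartitions n r" "W \<in> equipartitions n r" using x unfolding xe set_pair_pmf sQ by simp_all
    have nb: "x \<notin> B1" "x \<notin> B2" "x \<notin> B2'" "x \<notin> B3" "x \<notin> B4" "x \<notin> B5" "x \<notin> B5'" using nB by auto
    have prR: "?pr ER" and prB: "?pr EB" using nb(2,3) unfolding xe B2_def B2'_def by simp_all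
    have small: "card ((\<Union>i\<in>I. V i) \<inter> (\<Union>j\<in>J. W j)) < k0" if "I \<in> nsets {1..?m} s" "J \<in> nsets {1..?m} s" for I J
      using nb(1) that unfolding xe B1_def mem_Collect_eq prod.case not_le[symmetric] by blast
    have "real (card ({1..n} - surviving l n ?m V W (blow_up V ER \<union> blow_up W EB))) < ?c3 * real l"
      using nb(4) unfolding xe B3_def by (simp add: not_le)
    also have "?c3 * real l = real n / 2" using l(2) by simp
    finally have del: "2 * card ({1..n} - surviving l n ?m V W (blow_up V ER \<union> blow_up W EB)) \<le> n" by linarith
    have pos: "0 < (18 * (real n * p) + 1) ^ h" using p by (intro zero_less_power add_nonneg_pos) auto
    have "real (card (bad_vertices n ?m V W (blow_up V ER \<union> blow_up W EB))) \<le> ?c4"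
      using nb(5) unfolding xe B4_def by simp
    then have bad: "real (card (bad_vertices n ?m V W (blow_up V ER \<union> blow_up W EB))) * (18 * (real n * p) + 1) ^ h \<le> \<kappa> / 2"
      using pos by (simp only: pos_le_divide_eq)
    have av: "\<not> avoids n r (l - 1) M (LR V) V (blow_up W EB) ER S" "\<not> avoids n r (l - 1) M (LB W) W (blow_up V ER) EB S"
      if "S \<in> nsets {1..n} s" for S
      using nb(6,7) that unfolding xe B5_def B5'_def mem_Collect_eq prod.case by blast+
    have "case final_graph l n ?m (LR V) (LB W) V W (blow_up V ER) (blow_up W EB) of (X, E) \<Rightarrow> (\<nexists>xs. length xs = l \<and> is_cycle E xs) \<and>
       real n / 2 \<le> real (card X) \<and> real (indep_number X E) \<le> \<kappa>"
      by (rule good_event_conclusion[OF VW r refl prR prB LR[OF VW(1)] LB[OF VW(2)] l refl refl p'(1) n d s M rd del bad k0(1) small av])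
    then show ?thesis unfolding xe by simp
  qed
  have "1 - measure_pmf.prob (random_graph l n r LR LB) ?Good = 1 - measure_pmf.prob ?Om (?f -` ?Good)"
    unfolding random_graph_def pp[symmetric] by simp
  also have "\<dots> = measure_pmf.prob ?Om (- (?f -` ?Good))"
    using measure_pmf.prob_compl[of "?f -` ?Good" ?Om] by (simp add: Compl_eq_Diff_UNIV)
  also have "\<dots> \<le> measure_pmf.prob ?Om ?B"
  proof (rule measure_pmf.finite_measure_mono_AE)
    show "AE x in ?Om. x \<in> - (?f -` ?Good) \<longrightarrow> x \<in> ?B" unfolding AE_measure_pmf_iff using good by blast
  qed simp
  also have "\<dots> \<le> measure_pmf.prob ?Om B1 + (measure_pmf.prob ?Om B2 + (measure_pmf.prob ?Om B2' +
     (measure_pmf.prob ?Om B3 + (measure_pmf.prob ?Om B4 + (measure_pmf.prob ?Om B5 + measure_pmf.prob ?Om B5')))))"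
    by (intro order.trans[OF measure_Un_le] add_left_mono order.refl) auto
  also have "\<dots> \<le> ?q1 + (?q2 + (?q2 + (?q3 + (?q4 + (?q5 + ?q5)))))"
    by (intro add_mono b1 b2 b2' b3 b4 b5 b5')
  finally show ?thesis by (simp only: mult_2 add.assoc)
qed

section \<open>Numerical estimates\<close>

text \<open>
  With \<open>l = 2 * h + 3\<close>, \<open>L = ln n\<close> and \<open>a = n powr (1 / (4 * h + 3))\<close> all quantities become monomials:
  \<open>1 / p = L * a ^ (4 * h + 1)\<close>, the part size is \<open>a / L\<^sup>2\<close> and \<open>n * p = a\<^sup>2 / L\<close>.
\<close>

locale parameters =
  fixes a L p \<kappa> :: real and n l h r s k0 M :: nat
  assumes l: "l = 2 * h + 3" and h: "1 \<le> h"
    and n: "real n = a ^ (4 * h + 3)" "1 < n" and L: "L = ln (real n)" and p: "p = 1 / (L * a ^ (4 * h + 1))"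
    and r: "a / (2 * L\<^sup>2) \<le> real r" "real r \<le> 2 * a / L\<^sup>2" "r dvd n"
    and s: "8 * L ^ 3 * a ^ (4 * h + 1) - 1 \<le> real s" "real s \<le> 8 * L ^ 3 * a ^ (4 * h + 1)"
    and \<kappa>: "\<kappa> = 8 * L ^ 4 * a ^ (4 * h + 1)" and k0: "\<kappa> / 2 \<le> real k0" "real k0 < \<kappa> / 2 + 1"
    and M: "(real s)\<^sup>2 / 4 - 1 \<le> real M" "real M \<le> (real s)\<^sup>2 / 4"
    and large: "2560 * real l \<le> L" "4096 * real (l - 1) * 16 ^ (l - 2) \<le> L" "256 * L\<^sup>2 \<le> a"
begin

text \<open>The power of \<open>n\<close> in \<open>1 / p\<close>, so that
  \<open>1 / p = L * A\<close> and \<open>n = A * a\<^sup>2\<close>.\<close>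

definition A :: real where "A = a ^ (4 * h + 1)"

lemma L_ge: "12800 \<le> L"
  using large(1) l h by (simp add: l)

lemma a_ge: "256 * L \<le> a" "256 \<le> a" "L \<le> a"
proof -
  have "256 * L * 1 \<le> 256 * L * L" using L_ge by (intro mult_left_mono) auto
  also have "\<dots> \<le> a" using large(3) by (simp add: power2_eq_square)
  finally show "256 * L \<le> a" by simp
  then show "256 \<le> a" "L \<le> a" using L_ge by auto
qed

text \<open>For \<open>h = 1\<close>, that is \<open>l = 5\<close>, the three comparisons of
  exponents are equalities, so this is the tight case.\<close>

lemma A_ge: "a ^ 5 \<le> A" "1 \<le> A" "a ^ (2 * h + 3) \<le> A" "a ^ (3 * h + 3) \<le> A * a"
proof -
  have a1: "1 \<le> a" using a_ge by simp
  show "a ^ 5 \<le> A" unfolding A_def using h a1 by (intro power_increasing) auto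
  show "1 \<le> A" unfolding A_def by (rule one_le_power[OF a1])
  show "a ^ (2 * h + 3) \<le> A" unfolding A_def using h a1 by (intro power_increasing) auto
  have "a ^ (3 * h + 3) \<le> a ^ Suc (4 * h + 1)" using h a1 by (intro power_increasing) auto
  then show "a ^ (3 * h + 3) \<le> A * a" by (simp add: A_def mult.commute)
qed

lemma nA: "real n = A * a\<^sup>2"
  unfolding n A_def by (simp add: power_add[symmetric] eval_nat_numeral)

lemma pA: "p = 1 / (L * A)" by (simp add: p A_def)
lemma np: "real n * p = a\<^sup>2 / L"
  using A_ge(2) L_ge by (simp add: nA pA)
lemma \<kappa>A: "\<kappa> = 8 * L ^ 4 * A" by (simp add: \<kappa> A_def)
lemma sA: "8 * L ^ 3 * A - 1 \<le> real s" "real s \<le> 8 * L ^ 3 * A" using s by (simp_all add: A_def)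

lemma L3: "1 \<le> L ^ 3" "1 \<le> L\<^sup>2" "1 \<le> L ^ 4"
  using L_ge by (simp_all add: one_le_power)

lemma s_ge: "7 * L ^ 3 * A \<le> real s" "4 * a \<le> real s" "10 \<le> real s" "256 * (a\<^sup>2 / L) \<le> real s" "L \<le> real s"
proof -
  have "1 * 1 \<le> L ^ 3 * A" using L3(1) A_ge(2) L_ge by (intro mult_mono) auto
  then show 1: "7 * L ^ 3 * A \<le> real s" using sA(1) by linarith
  have "1 * a ^ 5 \<le> L ^ 3 * A" using L3(1) A_ge(1,2) a_ge L_ge by (intro mult_mono) auto
  then have 2: "7 * a ^ 5 \<le> real s" using 1 by linarith
  have "256 * a\<^sup>2 \<le> a * a\<^sup>2" using a_ge by (intro mult_right_mono) auto
  also have "\<dots> = a ^ 3" by (simp add: eval_nat_numeral)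
  also have "\<dots> \<le> a ^ 5" using a_ge by (intro power_increasing) auto
  finally have 3: "256 * a\<^sup>2 \<le> a ^ 5" .
  have "256 * (a\<^sup>2 / L) \<le> 256 * a\<^sup>2" using L_ge by (simp add: divide_le_eq mult_le_cancel_left1)
  then show "256 * (a\<^sup>2 / L) \<le> real s" using 2 3 by (smt (verit) zero_le_power2)
  have "256 * a \<le> a\<^sup>2" using a_ge by (simp add: power2_eq_square)
  then show "4 * a \<le> real s" "10 \<le> real s" "L \<le> real s" using 2 3 a_ge by (smt (verit) zero_le_power2)+
qed

lemma p_pos: "0 < p" "p < 1"
proof -
  have "1 * 1 < L * A" using L_ge A_ge(2) by (intro mult_less_le_imp_less) auto
  then show "0 < p" "p < 1" by (simp_all add: pA)
qed

lemma ps: "7 * L\<^sup>2 \<le> p * real s"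
proof -
  have "7 * L\<^sup>2 = p * (7 * L ^ 3 * A)" using L_ge A_ge(2) by (simp add: pA power2_eq_square power3_eq_cube)
  also have "\<dots> \<le> p * real s" using s_ge(1) p_pos by (intro mult_left_mono) auto
  finally show ?thesis .
qed

lemma r_pos: "0 < r"
proof -
  have "0 < a / (2 * L\<^sup>2)" using a_ge L_ge by simp
  then have "0 < real r" using r(1) by linarith
  then show ?thesis by simp
qed

lemma r_le: "real r \<le> real n * p" "real s * real r \<le> 16 * L * A * a" "real s * real r \<le> real n"
proof -
  show "real r \<le> real n * p"
  proof -
    have "2 * a / L\<^sup>2 \<le> a\<^sup>2 / L"
    proof -
      have "2 * 1 \<le> a * L" using a_ge L_ge by (intro mult_mono) auto
      then have "2 * (a * L) \<le> a * L * (a * L)" using a_ge L_ge by (intro mult_right_mono) auto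
      then show ?thesis using L_ge by (simp add: field_simps power2_eq_square)
    qed
    then show ?thesis using r(2) np by linarith
  qed
  have "real s * real r \<le> (8 * L ^ 3 * A) * (2 * a / L\<^sup>2)"
    using sA(2) r(2) a_ge L_ge A_ge(2) by (intro mult_mono) auto
  also have "\<dots> = 16 * L * A * a" using L_ge by (simp add: power2_eq_square power3_eq_cube)
  finally show 1: "real s * real r \<le> 16 * L * A * a" .
  also have "16 * L * A * a \<le> a * A * a" using a_ge L_ge A_ge(2) by (intro mult_right_mono) auto
  also have "\<dots> = real n" by (simp add: nA power2_eq_square)
  finally show "real s * real r \<le> real n" .
qed

lemma m_r: "real (n div r) * real r = real n"
  using r(3) by (metis dvd_div_mult_self of_nat_mult)

lemma mp: "4 * L \<le> 8 * real (n div r) * p"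
proof -
  have "real (n div r) * p * real r = a\<^sup>2 / L" using m_r np by (simp add: mult_ac)
  moreover have "real (n div r) * p * real r \<le> real (n div r) * p * (2 * a / L\<^sup>2)"
    using r(2) p_pos by (intro mult_left_mono) auto
  ultimately have "a\<^sup>2 / L \<le> real (n div r) * p * (2 * a / L\<^sup>2)" by simp
  then have "a * L \<le> 2 * (real (n div r) * p)"
    using a_ge L_ge by (simp add: field_simps power2_eq_square)
  moreover have "1 * L \<le> a * L" using a_ge L_ge by (intro mult_right_mono) auto
  ultimately show ?thesis using a_ge L_ge by linarith
qed

lemma parameter_ranges: "0 < r" "5 \<le> l" "1 \<le> real l * ln (real n)" "1 \<le> 16 * (real n * p)" "16 * (real n * p) \<le> real n"
  "1 \<le> 32 * p * real s" "s \<le> n div r" "0 < \<kappa>" "0 < k0" "k0 \<le> n"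
proof -
  show "0 < r" by (rule r_pos)
  show l5: "5 \<le> l" using l h by simp
  have "1 * 1 \<le> real l * L" using l5 L_ge by (intro mult_mono) auto
  then show "1 \<le> real l * ln (real n)" by (simp add: L)
  have "L * 1 \<le> a * a" using a_ge L_ge by (intro mult_mono) auto
  then show "1 \<le> 16 * (real n * p)" unfolding np using L_ge by (simp add: field_simps power2_eq_square)
  have "16 * a\<^sup>2 \<le> L * a\<^sup>2" using L_ge by (intro mult_right_mono) auto
  then have "16 * (a\<^sup>2 / L) \<le> 1 * a\<^sup>2" using L_ge by (simp add: field_simps)
  also have "\<dots> \<le> A * a\<^sup>2" using A_ge(2) by (intro mult_right_mono) auto
  finally show "16 * (real n * p) \<le> real n" unfolding np unfolding nA .
  show "1 \<le> 32 * p * real s" using ps L3(2) by linarith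
  have "s * r \<le> n" using r_le(3) by (metis of_nat_le_iff of_nat_mult)
  then show "s \<le> n div r" using less_eq_div_iff_mult_less_eq[OF r_pos] by blast
  have "1 * 1 \<le> L ^ 4 * A" using L3(3) A_ge(2) L_ge by (intro mult_mono) auto
  then have LA: "1 \<le> L ^ 4 * A" by simp
  then show "0 < \<kappa>" unfolding \<kappa>A by linarith
  have k1: "4 \<le> \<kappa> / 2" using LA unfolding \<kappa>A by linarith
  then show "0 < k0" using k0(1) by (cases k0) auto
  have "real k0 \<le> 5 * L ^ 4 * A" using k0(2) LA unfolding \<kappa>A by linarith
  also have "\<dots> \<le> a\<^sup>2 * A"
  proof (rule mult_right_mono)
    have "5 * L ^ 4 \<le> (256 * L\<^sup>2)\<^sup>2" using L3 by (simp add: power_mult_distrib power_mult[symmetric])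
    also have "\<dots> \<le> a\<^sup>2" using large(3) L_ge by (intro power_mono) auto
    finally show "5 * L ^ 4 \<le> a\<^sup>2" .
  qed (use A_ge(2) in simp)
  finally show "k0 \<le> n" using nA by (simp add: mult.commute)
qed

text \<open>Both summands are compared with \<open>r * s\<close>. In the first the powers of
  \<open>a\<close> balance exactly, so only the logarithms decide, and they must beat a constant
  depending on \<open>l\<close>. In the second the comparison is \<open>a ^ (3 * h + 3)\<close>
  against \<open>A * a\<close>.\<close>

lemma walk_estimate: "walk_bound l n r p s / real r \<le> (real s)\<^sup>2 / 16"
proof -
  let ?d = "a\<^sup>2 / L"
  have d0: "0 < ?d" using a_ge L_ge by simp
  have r0: "0 < real r" using r_pos by simp
  have lm: "l - 1 = Suc (l - 2)" "l - 2 = 2 * h + 1" "l - 1 = 2 * (h + 1)" using l by auto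
  have t1: "2 * real (l - 1) * (32 * p) * (16 * ?d) ^ (l - 1) * real s / (16 * ?d) \<le> real r * real s / 32"
  proof -
    \<comment> \<open>The balance behind \<open>eps\<close>: the typical number of walks between two
      vertices is \<open>a / L ^ (2 * h + 2)\<close> up to constants, while \<open>r\<close> is
      about \<open>a / L\<^sup>2\<close>.\<close>
    have pd: "p * ?d ^ (l - 2) = a / L ^ (2 * h + 2)"
    proof -
      have "p * ?d ^ (l - 2) = (a\<^sup>2) ^ (2 * h + 1) / (L * A * L ^ (2 * h + 1))"
        unfolding lm(2) by (simp add: pA power_divide)
      also have "(a\<^sup>2) ^ (2 * h + 1) = a * A"
      proof -
        have e: "2 * (2 * h + 1) = Suc (4 * h + 1)" by simp
        show ?thesis unfolding A_def power_mult[symmetric] e by (rule power_Suc)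
      qed
      also have "a * A / (L * A * L ^ (2 * h + 1)) = a / L ^ (2 * h + 2)" using A_ge(2) by (simp add: power_add mult_ac)
      finally show ?thesis .
    qed
    have "2 * real (l - 1) * (32 * p) * (16 * ?d) ^ (l - 1) * real s / (16 * ?d) =
       64 * real (l - 1) * 16 ^ (l - 2) * (p * ?d ^ (l - 2)) * real s"
    proof -
      have pw: "(16 * ?d) ^ (l - 1) = 16 * ?d * (16 ^ (l - 2) * ?d ^ (l - 2))"
        by (simp only: lm(1) power_Suc power_mult_distrib)
      have gen: "X * (16 * D * Y) * t / (16 * D) = X * Y * t" if "0 < D" for X D Y t :: real
        using that by simp
      show ?thesis unfolding pw gen[OF d0] by (simp add: mult_ac)
    qed
    also have "\<dots> = 64 * real (l - 1) * 16 ^ (l - 2) / L ^ (2 * h + 2) * a * real s" unfolding pd by simp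
    also have "\<dots> \<le> (a / (2 * L\<^sup>2)) * real s / 32"
    proof -
      have "4096 * real (l - 1) * 16 ^ (l - 2) \<le> L ^ (2 * h)"
      proof -
        have "L ^ 1 \<le> L ^ (2 * h)" using h L_ge by (intro power_increasing) auto
        then show ?thesis using large(2) by simp
      qed
      then have "64 * real (l - 1) * 16 ^ (l - 2) / L ^ (2 * h + 2) \<le> (L ^ (2 * h) / 64) / L ^ (2 * h + 2)"
        using L_ge by (intro divide_right_mono) auto
      also have "\<dots> = 1 / (64 * L\<^sup>2)" using L_ge by (simp add: power_add power2_eq_square)
      finally have "64 * real (l - 1) * 16 ^ (l - 2) / L ^ (2 * h + 2) * (a * real s) \<le> 1 / (64 * L\<^sup>2) * (a * real s)"
        using a_ge by (intro mult_right_mono) auto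
      then show ?thesis by (simp add: mult_ac)
    qed
    also have "\<dots> \<le> real r * real s / 32" using r(1) by (intro divide_right_mono mult_right_mono) auto
    finally show ?thesis .
  qed
  have t2: "sqrt (1280 * real l * L\<^sup>2 * ?d * real r) ^ (l - 1) \<le> real r * real s / 32"
  proof -
    have x0: "0 \<le> 1280 * real l * L\<^sup>2 * ?d * real r" by (intro mult_nonneg_nonneg less_imp_le[OF d0]) auto
    have "sqrt (1280 * real l * L\<^sup>2 * ?d * real r) ^ (l - 1) = (1280 * real l * L\<^sup>2 * ?d * real r) ^ (h + 1)"
      unfolding lm(3) power_mult using x0 by simp
    also have "\<dots> \<le> (1280 * real l * L\<^sup>2 * ?d * (2 * a / L\<^sup>2)) ^ (h + 1)"
      by (intro power_mono mult_left_mono mult_nonneg_nonneg less_imp_le[OF d0] r(2)) auto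
    \<comment> \<open>The \<open>L\<^sup>2\<close> cancels against the part size, and the
      \<open>1 / L\<close> of \<open>n * p\<close> is left to beat the constant.\<close>
    also have "1280 * real l * L\<^sup>2 * ?d * (2 * a / L\<^sup>2) = (2560 * real l / L) * a ^ 3"
      using L_ge by (simp add: power2_eq_square power3_eq_cube)
    also have "((2560 * real l / L) * a ^ 3) ^ (h + 1) \<le> (1 * a ^ 3) ^ (h + 1)"
      using large(1) L_ge a_ge by (intro power_mono mult_right_mono) auto
    also have "\<dots> = a ^ (3 * h + 3)"
    proof -
      have e: "3 * (h + 1) = 3 * h + 3" by simp
      show ?thesis by (simp only: mult_1 power_mult[symmetric] e)
    qed
    also have "\<dots> \<le> A * a" by (rule A_ge(4))
    also have "\<dots> \<le> (a / (2 * L\<^sup>2)) * (7 * L ^ 3 * A) / 32"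
    proof -
      have "(a / (2 * L\<^sup>2)) * (7 * L ^ 3 * A) / 32 = (7 * L / 64) * (A * a)"
        using L_ge by (simp add: power2_eq_square power3_eq_cube)
      moreover have "1 * (A * a) \<le> (7 * L / 64) * (A * a)" using L_ge A_ge(2) a_ge by (intro mult_right_mono) auto
      ultimately show ?thesis by (simp only: mult_1)
    qed
    also have "\<dots> \<le> real r * real s / 32"
      using r(1) s_ge(1) a_ge L_ge A_ge(2) by (intro divide_right_mono mult_mono) auto
    finally show ?thesis .
  qed
  have "walk_bound l n r p s \<le> real s * (real r * real s / 32) + real s * (real r * real s / 32)"
    unfolding walk_bound_def np L[symmetric] by (intro add_mono mult_left_mono t1 t2) auto
  also have "\<dots> = (real s)\<^sup>2 / 16 * real r" by (simp add: power2_eq_square)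
  finally show ?thesis using r0 by (simp add: divide_le_eq)
qed

text \<open>The three terms are at most \<open>1 / 4\<close>, \<open>1 / 32\<close> and
  \<open>1 / 16\<close> of \<open>s\<^sup>2\<close>, together \<open>11 / 32\<close>, while
  \<open>s * (s - 1) / 2\<close> is at least \<open>9 / 20\<close> of it because
  \<open>10 \<le> s\<close>.\<close>

lemma open_pairs: "real M + real s * (8 * (real n * p)) + walk_bound l n r p s / real r \<le> real (s choose 2)"
proof -
  have s1: "1 \<le> s" using s_ge(3) by simp
  have c: "real (s choose 2) = real s * (real s - 1) / 2"
  proof -
    have "even (s * (s - 1))" by (cases "even s") auto
    then have "2 * (s choose 2) = s * (s - 1)" unfolding choose_two by (rule dvd_mult_div_cancel)
    then have "2 * real (s choose 2) = real s * real (s - 1)" by (metis of_nat_mult of_nat_numeral)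
    then show ?thesis using s1 by (simp add: of_nat_diff)
  qed
  have "real s * (8 * (real n * p)) \<le> real s * (real s / 32)"
    unfolding np using s_ge(4) by (intro mult_left_mono) auto
  moreover have "real s * 10 \<le> real s * real s" using s_ge(3) by (intro mult_left_mono) auto
  ultimately show ?thesis using M(2) walk_estimate c by (simp add: power2_eq_square field_simps)
qed

text \<open>All error terms are relaxed to multiples of \<open>1 / L\<close>; here
  \<open>exp (- L)\<close> is \<open>1 / n\<close>.\<close>

lemma inv_n_le: "exp (- L) \<le> 1 / L"
proof -
  have "L \<le> exp L" using exp_ge_add_one_self[of L] by linarith
  then show ?thesis unfolding exp_minus inverse_eq_divide using L_ge by (intro frac_le) auto
qed

text \<open>Two unions of \<open>s\<close> parts meet in about \<open>(s * r)\<^sup>2 / n\<close>,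
  at most \<open>256 * L\<^sup>2 * A\<close>, vertices on average, whereas \<open>k0\<close> is at
  least \<open>4 * L ^ 4 * A\<close>. The base is thus below \<open>exp (- 5)\<close>, and the
  number of choices \<open>exp (2 * s * L)\<close> is at most \<open>exp (4 * k0)\<close>, which
  leaves \<open>exp (- k0)\<close>.\<close>

lemma large_intersection_term: "real n ^ (2 * s) * (exp 2 * (real (s * r))\<^sup>2 / (real k0 * real n)) ^ k0 \<le> 1 / L"
proof -
  have nL: "real n = exp L" using n(2) by (simp add: L)
  have k0L: "4 * L ^ 4 * A \<le> real k0" using k0(1) by (simp add: \<kappa>A mult_ac)
  have k0p: "0 < real k0" using parameter_ranges(9) by simp
  have "exp 2 * (real (s * r))\<^sup>2 / (real k0 * real n) \<le> exp (- 5)"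
  proof -
    have e: "exp (7::real) \<le> 2187"
    proof -
      have "exp (7::real) = exp 1 ^ 7" by (simp flip: exp_of_nat_mult)
      also have "\<dots> \<le> 3 ^ 7" using exp_le by (intro power_mono) auto
      finally show ?thesis by simp
    qed
    have "(real (s * r))\<^sup>2 \<le> (16 * L * A * a)\<^sup>2" using r_le(2) by (intro power_mono) auto
    also have "\<dots> = 256 * (L\<^sup>2 * A * real n)" by (simp add: nA power2_eq_square)
    finally have "exp 7 * (real (s * r))\<^sup>2 \<le> 2187 * (256 * (L\<^sup>2 * A * real n))"
      using e by (intro mult_mono) auto
    also have "\<dots> = 559872 * (L\<^sup>2 * A * real n)" by simp
    also have "\<dots> \<le> (4 * L\<^sup>2) * (L\<^sup>2 * A * real n)"
    proof (rule mult_right_mono)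
      have "12800 * 12800 \<le> L * L" using L_ge by (intro mult_mono) auto
      then show "559872 \<le> 4 * L\<^sup>2" by (simp add: power2_eq_square)
    qed (use A_ge(2) in simp)
    also have "\<dots> = 4 * L ^ 4 * A * real n" by (simp add: eval_nat_numeral)
    also have "\<dots> \<le> real k0 * real n" using k0L by (intro mult_right_mono) auto
    finally have "exp 7 * (real (s * r))\<^sup>2 \<le> real k0 * real n" .
    then have "exp 5 * (exp 2 * (real (s * r))\<^sup>2) \<le> real k0 * real n"
      by (simp add: mult.assoc[symmetric] exp_add[symmetric])
    then show ?thesis using k0p n(2) by (simp add: exp_minus field_simps)
  qed
  then have "(exp 2 * (real (s * r))\<^sup>2 / (real k0 * real n)) ^ k0 \<le> exp (- 5) ^ k0"
    by (intro power_mono) auto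
  moreover have "real n ^ (2 * s) = exp (real (2 * s) * L)" by (simp only: nL exp_of_nat_mult)
  ultimately have "real n ^ (2 * s) * (exp 2 * (real (s * r))\<^sup>2 / (real k0 * real n)) ^ k0 \<le>
      exp (real (2 * s) * L) * exp (- 5) ^ k0" by (simp add: mult_left_mono)
  also have "\<dots> = exp (2 * (real s * L) - 5 * real k0)"
    by (simp add: exp_of_nat_mult[symmetric] exp_add[symmetric] mult_ac)
  also have "\<dots> \<le> exp (- L)"
  proof -
    have "real s * L \<le> 8 * L ^ 3 * A * L" using sA(2) L_ge by (intro mult_right_mono) auto
    also have "\<dots> = 2 * (4 * L ^ 4 * A)" by (simp add: eval_nat_numeral)
    finally have "real s * L \<le> 2 * real k0" using k0L by linarith
    moreover have "L \<le> real k0"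
    proof -
      have "L * 1 \<le> L ^ 4 * A" using L_ge A_ge(2) self_le_power[of L 4] by (intro mult_mono) auto
      then show ?thesis using k0L L_ge by linarith
    qed
    ultimately show ?thesis by simp
  qed
  finally show ?thesis using inv_n_le by linarith
qed

lemma not_pseudo_random_term: "real (n div r) * exp (- (8 * real (n div r) * p)) + ((1 + exp (- (5 / 2 * ln (real n)))) ^ (n div r) - 1)\<^sup>2 \<le> 5 / L"
proof -
  have nL: "real n = exp L" using n(2) by (simp add: L)
  have mn: "real (n div r) \<le> exp L" using nL by (metis div_le_dividend of_nat_le_iff)
  have "real (n div r) * exp (- (8 * real (n div r) * p)) \<le> exp L * exp (- (4 * L))"
    using mn mp by (intro mult_mono) auto
  also have "\<dots> = exp (- 3 * L)" by (simp flip: exp_add)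
  also have "\<dots> \<le> exp (- L)" using L_ge by simp
  finally have 1: "real (n div r) * exp (- (8 * real (n div r) * p)) \<le> 1 / L" using inv_n_le by linarith
  define y where "y = exp (- (5 / 2 * L))"
  have y0: "0 \<le> y" by (simp add: y_def)
  have "real (n div r) * y \<le> exp L * y" using mn y0 by (rule mult_right_mono)
  also have "\<dots> = exp (- (3 / 2 * L))" by (simp add: y_def flip: exp_add)
  also have "\<dots> \<le> exp (- L)" using L_ge by simp
  finally have my: "real (n div r) * y \<le> 1 / L" using inv_n_le by linarith
  have il: "1 / L \<le> 1" using L_ge by simp
  have "(1 + y) ^ (n div r) \<le> exp y ^ (n div r)" using y0 exp_ge_add_one_self[of y] by (intro power_mono) auto
  also have "\<dots> = exp (real (n div r) * y)" by (simp add: exp_of_nat_mult)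
  also have "\<dots> \<le> 1 + real (n div r) * y + (real (n div r) * y)\<^sup>2"
    using y0 my il by (intro exp_bound) (auto intro: order.trans)
  also have "(real (n div r) * y)\<^sup>2 \<le> (real (n div r) * y) * 1"
    unfolding power2_eq_square using y0 my il by (intro mult_left_mono) auto
  finally have "(1 + y) ^ (n div r) - 1 \<le> 2 * (1 / L)" using my by linarith
  moreover have "1 \<le> (1 + y) ^ (n div r)" using y0 by (intro one_le_power) simp
  ultimately have "((1 + y) ^ (n div r) - 1)\<^sup>2 \<le> (2 * (1 / L))\<^sup>2" by (intro power_mono) auto
  also have "\<dots> = 4 / L * (1 / L)" by (simp add: power2_eq_square)
  also have "\<dots> \<le> 4 / L * 1" using il L_ge by (intro mult_left_mono) auto
  finally show ?thesis using 1 unfolding y_def L by (simp add: add_divide_distrib)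
qed

text \<open>Here the powers of \<open>a\<close> in \<open>(n * p) ^ (l - 2) * r\<close> multiply to
  exactly \<open>n\<close>, so the gain consists of logarithms only.\<close>

lemma deleted_vertices_term: "2 ^ l * ((2 * (real n * p)) ^ (l - 2) * (2 * real r)) / (real n / (2 * real l)) \<le> 8 * real l * 4 ^ l / L"
proof -
  have lm: "l - 2 = 2 * h + 1" using l by simp
  have n0: "0 < real n" using n(2) by simp
  have "(2 * (real n * p)) ^ (l - 2) * (2 * real r) \<le> 2 ^ l * ((a\<^sup>2 / L) ^ (l - 2) * (4 * a / L\<^sup>2))"
  proof -
    have "(2 * (real n * p)) ^ (l - 2) * (2 * real r) = 2 ^ (l - 2) * ((a\<^sup>2 / L) ^ (l - 2) * (2 * real r))"
      unfolding np by (simp add: power_mult_distrib[symmetric])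
    also have "\<dots> \<le> 2 ^ l * ((a\<^sup>2 / L) ^ (l - 2) * (4 * a / L\<^sup>2))"
    proof (rule mult_mono)
      show "(2::real) ^ (l - 2) \<le> 2 ^ l" by (intro power_increasing) auto
      show "(a\<^sup>2 / L) ^ (l - 2) * (2 * real r) \<le> (a\<^sup>2 / L) ^ (l - 2) * (4 * a / L\<^sup>2)"
        using r(2) L_ge by (intro mult_left_mono) auto
    qed (use L_ge in auto)
    finally show ?thesis .
  qed
  also have "(a\<^sup>2 / L) ^ (l - 2) * (4 * a / L\<^sup>2) = 4 * real n / L ^ (2 * h + 3)"
  proof -
    have "(a\<^sup>2 / L) ^ (l - 2) = a ^ (4 * h + 2) / L ^ (2 * h + 1)"
    proof -
      have e: "2 * (2 * h + 1) = 4 * h + 2" by simp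
      show ?thesis by (simp only: lm power_divide power_mult[symmetric] e)
    qed
    moreover have "a ^ (4 * h + 2) * a = real n" unfolding n by (simp add: power_add eval_nat_numeral)
    moreover have "L ^ (2 * h + 1) * L\<^sup>2 = L ^ (2 * h + 3)" by (simp add: power_add eval_nat_numeral)
    ultimately show ?thesis by (simp add: mult_ac)
  qed
  also have "2 ^ l * (4 * real n / L ^ (2 * h + 3)) \<le> 2 ^ l * (4 * real n / L)"
  proof -
    have "L ^ 1 \<le> L ^ (2 * h + 3)" using L_ge by (intro power_increasing) auto
    then show ?thesis using L_ge by (intro mult_left_mono divide_left_mono) auto
  qed
  finally have "2 ^ l * ((2 * (real n * p)) ^ (l - 2) * (2 * real r)) / (real n / (2 * real l)) \<le>
      2 ^ l * (2 ^ l * (4 * real n / L)) / (real n / (2 * real l))"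
    using n0 by (intro divide_right_mono mult_left_mono) auto
  also have "\<dots> = 8 * real l * (2 ^ l * 2 ^ l) / L" using n0 by (simp add: field_simps)
  also have "(2 ^ l * 2 ^ l :: real) = 4 ^ l" by (simp flip: power_mult_distrib)
  finally show ?thesis .
qed

text \<open>The exceptional vertices and the growth of the ball give at most a constant times
  \<open>a ^ (2 * h + 3) \<le> A\<close>, and \<open>\<kappa>\<close> exceeds \<open>A\<close> by
  \<open>8 * L ^ 4\<close>.\<close>

lemma bad_vertices_term: "4 * (real n * p) * real r / (\<kappa> / 2 / (18 * (real n * p) + 1) ^ h) \<le> 2 * 19 ^ h / L"
proof -
  let ?d = "a\<^sup>2 / L"
  have d1: "1 \<le> ?d"
  proof -
    have "L * 1 \<le> a * a" using a_ge L_ge by (intro mult_mono) auto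
    then show ?thesis using L_ge by (simp add: power2_eq_square)
  qed
  have "4 * ?d * real r * (18 * ?d + 1) ^ h \<le> 4 * a\<^sup>2 * (2 * a) * (19 * a\<^sup>2) ^ h"
  proof (intro mult_mono power_mono)
    show dl: "?d \<le> a\<^sup>2" using L_ge by (simp add: divide_le_eq mult_le_cancel_left1)
    have "2 * a / L\<^sup>2 \<le> 2 * a / 1" using L3(2) a_ge by (intro divide_left_mono) auto
    then show "real r \<le> 2 * a" using r(2) by simp
    show "18 * ?d + 1 \<le> 19 * a\<^sup>2" using dl d1 by linarith
  qed (use d1 a_ge in auto)
  also have "\<dots> = 8 * 19 ^ h * a ^ (2 * h + 3)"
    by (simp add: power_mult_distrib power_mult[symmetric] power_add eval_nat_numeral)
  also have "\<dots> \<le> 8 * 19 ^ h * A" using A_ge(3) by (intro mult_left_mono) auto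
  finally have num: "4 * ?d * real r * (18 * ?d + 1) ^ h \<le> 8 * 19 ^ h * A" .
  have pos: "0 < (18 * ?d + 1) ^ h" using d1 by (intro zero_less_power) linarith
  have "4 * ?d * real r / (\<kappa> / 2 / (18 * ?d + 1) ^ h) = 4 * ?d * real r * (18 * ?d + 1) ^ h / (\<kappa> / 2)"
    using pos by simp
  also have "\<dots> \<le> 8 * 19 ^ h * A / (\<kappa> / 2)" using num parameter_ranges(8) by (intro divide_right_mono) auto
  also have "\<dots> = 2 * 19 ^ h / L ^ 4" using A_ge(2) L_ge by (simp add: \<kappa>A)
  also have "\<dots> \<le> 2 * 19 ^ h / L" using L_ge self_le_power[of L 4] by (intro divide_left_mono) auto
  finally show ?thesis unfolding np .
qed

text \<open>The exponent \<open>p * M\<close> is about \<open>(p * s) * s / 4\<close>, at least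
  about \<open>7 / 4 * L\<^sup>2 * s\<close>, against \<open>s * L\<close> for the number of
  sets.\<close>

lemma avoids_term: "real n ^ s * (1 - p) ^ M \<le> 1 / L"
proof -
  have nL: "real n = exp L" using n(2) by (simp add: L)
  have "(1 - p) ^ M \<le> exp (- p) ^ M"
    using p_pos exp_ge_add_one_self[of "- p"] by (intro power_mono) auto
  also have "\<dots> = exp (- (p * real M))" by (simp add: exp_of_nat_mult[symmetric] mult.commute)
  finally have "real n ^ s * (1 - p) ^ M \<le> exp (real s * L) * exp (- (p * real M))"
    unfolding nL by (simp add: exp_of_nat_mult mult_left_mono)
  also have "\<dots> = exp (real s * L - p * real M)" by (simp flip: exp_add)
  also have "\<dots> \<le> exp (- L)"
  proof -
    have "p * ((real s)\<^sup>2 / 4 - 1) \<le> p * real M" using M(1) p_pos by (intro mult_left_mono) auto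
    then have "(p * real s) * real s / 4 - p \<le> p * real M" by (simp add: algebra_simps power2_eq_square)
    moreover have "7 * L\<^sup>2 * real s \<le> (p * real s) * real s" using ps by (intro mult_right_mono) auto
    moreover have "16 * L * real s \<le> L\<^sup>2 * real s"
      unfolding power2_eq_square using L_ge by (intro mult_right_mono) auto
    moreover have "1 * L \<le> real s * L" using s_ge(3) L_ge by (intro mult_right_mono) auto
    ultimately have "real s * L - p * real M \<le> - L" using p_pos(2) L_ge by (simp only: mult.commute[of _ L] mult.assoc)
    then show ?thesis by simp
  qed
  finally show ?thesis using inv_n_le by linarith
qed

end

lemma (in parameters) failure_bound:
  fixes LR LB :: "(nat \<Rightarrow> nat set) \<Rightarrow> nat set rel"
  assumes "p = edge_prob l n"
    and "\<And>V. V \<in> equipartitions n r \<Longrightarrow> block_ordering n (n div r) V (LR V)"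
    and "\<And>W. W \<in> equipartitions n r \<Longrightarrow> block_ordering n (n div r) W (LB W)"
  shows "1 - measure_pmf.prob (random_graph l n r LR LB) {(X, E). (\<nexists>xs. length xs = l \<and> is_cycle E xs) \<and>
       real n / 2 \<le> real (card X) \<and> real (indep_number X E) \<le> \<kappa>} \<le>
     (13 + 8 * real l * 4 ^ l + 2 * 19 ^ h) / L"
proof -
  note b = parameter_ranges
  have "1 - measure_pmf.prob (random_graph l n r LR LB) {(X, E). (\<nexists>xs. length xs = l \<and> is_cycle E xs) \<and>
       real n / 2 \<le> real (card X) \<and> real (indep_number X E) \<le> \<kappa>} \<le>
     1 / L + 2 * (5 / L) + 8 * real l * 4 ^ l / L + 2 * 19 ^ h / L + 2 * (1 / L)"
    by (rule order.trans[OF prob_failure_le[OF b(1) r(3) assms(1) l b(2) assms(2,3) p_pos b(3) n(2) b(4-7) open_pairs r_le(1) b(8) k0(2) b(9,10)]],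
        assumption, assumption, intro add_mono mult_left_mono large_intersection_term not_pseudo_random_term deleted_vertices_term bad_vertices_term avoids_term zero_le_numeral)
  also have "\<dots> = (13 + 8 * real l * 4 ^ l + 2 * 19 ^ h) / L" by (simp add: add_divide_distrib)
  finally show ?thesis .
qed

section \<open>The parameters as powers of \<open>n\<close>, and the limit\<close>

text \<open>Adding the exponents gives
  \<open>- 1 + 1 / (l - 1) + eps l = - 1 + 2 / (2 * l - 3)\<close>, and
  \<open>2 * l - 3 = 4 * h + 3\<close>.\<close>

lemma edge_prob_eq:
  assumes "l = 2 * h + 3" "1 < n"
  shows "edge_prob l n = 1 / (ln (real n) * (real n powr (1 / (4 * real h + 3))) ^ (4 * h + 1))"
proof -
  let ?y = "(4 * real h + 1) / (4 * real h + 3)"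
  have n0: "0 < real n" using assms(2) by simp
  have e: "- 1 + 1 / (real l - 1) + eps l = - ?y"
  proof -
    have l: "real l = 2 * real h + 3" using assms(1) by simp
    have g: "- 1 + 1 / (x + x + 2) + 1 / ((4 * x + 3) * (x + x + 2)) = - ((4 * x + 1) / (4 * x + 3))" if "0 \<le> x" for x :: real
    proof -
      have nz: "4 * x + 3 \<noteq> 0" "x + x + 2 \<noteq> 0" using that by auto
      then show ?thesis by (simp add: divide_simps) (simp add: algebra_simps)
    qed
    have "2 * real l - 3 = 4 * real h + 3" "real l - 1 = real h + real h + 2" using l by simp_all
    then show ?thesis by (simp only: eps_def g[OF of_nat_0_le_iff])
  qed
  have "edge_prob l n = real n powr (- ?y) / ln (real n)"
    unfolding edge_prob_def e[symmetric] by (simp add: powr_add)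
  also have "real n powr (- ?y) = 1 / real n powr ?y" by (rule powr_minus_divide)
  also have "real n powr ?y = (real n powr (1 / (4 * real h + 3))) ^ (4 * h + 1)"
  proof -
    have "(real n powr (1 / (4 * real h + 3))) ^ (4 * h + 1) = (real n powr (1 / (4 * real h + 3))) powr real (4 * h + 1)"
      using n0 by (intro powr_realpow[symmetric]) simp
    moreover have "1 / (4 * real h + 3) * real (4 * h + 1) = ?y" by simp
    ultimately show ?thesis by (simp only: powr_powr)
  qed
  finally show ?thesis by simp
qed

text \<open>The square root of \<open>n * p = a\<^sup>2 / L\<close> contributes \<open>L\<close> to
  the power \<open>- 1 / 2\<close>, which with the explicit \<open>- 3 / 2\<close> makes
  \<open>1 / L\<^sup>2\<close>.\<close>

lemma part_size_eq:
  assumes "l = 2 * h + 3" "1 < n"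
  shows "part_size l n = real n powr (1 / (4 * real h + 3)) / (ln (real n))\<^sup>2"
proof -
  define a where "a = real n powr (1 / (4 * real h + 3))"
  let ?L = "ln (real n)"
  have a0: "0 < a" and L0: "0 < ?L" using assms(2) by (auto simp: a_def)
  have an: "a ^ (4 * h + 3) = real n"
    using assms(2) by (simp add: a_def powr_realpow[symmetric] powr_powr)
  have "edge_prob l n * real n = a\<^sup>2 / ?L"
  proof -
    have "real n = a ^ (4 * h + 1) * a\<^sup>2" unfolding an[symmetric] by (simp add: power_add eval_nat_numeral)
    then show ?thesis unfolding edge_prob_eq[OF assms] a_def[symmetric] using a0 by simp
  qed
  then have "part_size l n = (a\<^sup>2 / ?L) powr (1 / 2) * ?L powr (- 3 / 2)" by (simp add: part_size_def)
  also have "(a\<^sup>2 / ?L) powr (1 / 2) = a / ?L powr (1 / 2)"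
    using a0 L0 by (simp add: powr_divide powr_half_sqrt)
  also have "a / ?L powr (1 / 2) * ?L powr (- 3 / 2) = a / ?L powr 2"
  proof -
    have "?L powr 2 = ?L powr (1 / 2) * ?L powr (3 / 2)" by (simp flip: powr_add)
    moreover have "?L powr (- 3 / 2) = 1 / ?L powr (3 / 2)" using powr_minus_divide[of ?L "3 / 2"] by simp
    ultimately show ?thesis by simp
  qed
  also have "?L powr 2 = ?L\<^sup>2" using L0 by (simp add: powr_numeral)
  finally show ?thesis by (simp add: a_def)
qed

lemma eventually_large:
  fixes c :: real
  assumes "0 < g"
  shows "eventually (\<lambda>n. c \<le> ln (real n) \<and> 256 * (ln (real n))\<^sup>2 \<le> real n powr g) sequentially"
proof -
  have "eventually (\<lambda>n. c \<le> ln (real n)) sequentially" by real_asymp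
  moreover have "((\<lambda>n. (ln (real n))\<^sup>2 / real n powr g) \<longlongrightarrow> 0) sequentially" using assms by real_asymp
  then have "eventually (\<lambda>n. (ln (real n))\<^sup>2 / real n powr g < 1 / 256) sequentially"
    by (rule order_tendstoD) simp
  ultimately show ?thesis using eventually_gt_at_top[of 0]
  proof eventually_elim
    case (elim n)
    have "0 < real n powr g" using elim(3) by simp
    then show ?case using elim(1,2) by (simp add: field_simps)
  qed
qed

theorem theorem2p4:
  fixes l :: nat and r :: "nat \<Rightarrow> nat"
    and LR LB :: "nat \<Rightarrow> (nat \<Rightarrow> nat set) \<Rightarrow> nat set rel"
  assumes "odd l" and "5 \<le> l"
    and "\<And>n. \<bar>real (r n) - part_size l n\<bar> < 1"
    and "\<And>n V. V \<in> equipartitions n (r n) \<Longrightarrow> block_ordering n (n div r n) V (LR n V)"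
    and "\<And>n W. W \<in> equipartitions n (r n) \<Longrightarrow> block_ordering n (n div r n) W (LB n W)"
  shows "((\<lambda>n. measure_pmf.prob (random_graph l n (r n) (LR n) (LB n))
            {(X, E). (\<nexists>xs. length xs = l \<and> is_cycle E xs) \<and>
                     real n / 2 \<le> real (card X) \<and>
                     real (indep_number X E) \<le> 8 / edge_prob l n * (ln (real n)) ^ 3})
          \<longlongrightarrow> 1) (inf sequentially (principal {n. r n dvd n}))"
proof -
  define h where "h = (l - 3) div 2"
  have lh: "l = 2 * h + 3" "1 \<le> h"
  proof -
    obtain k where "l = 2 * k + 1" using assms(1) by (elim oddE)
    then show "l = 2 * h + 3" "1 \<le> h" using assms(2) by (auto simp: h_def)
  qed
  let ?P = "\<lambda>n. measure_pmf.prob (random_graph l n (r n) (LR n) (LB n))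
            {(X, E). (\<nexists>xs. length xs = l \<and> is_cycle E xs) \<and>
                     real n / 2 \<le> real (card X) \<and>
                     real (indep_number X E) \<le> 8 / edge_prob l n * (ln (real n)) ^ 3}"
  let ?K = "13 + 8 * real l * 4 ^ l + 2 * 19 ^ h :: real"
  let ?F = "inf sequentially (principal {n. r n dvd n})"
  define g where "g = 1 / (4 * real h + 3)"
  have g0: "0 < g" by (simp add: g_def)
  \<comment> \<open>The sum dominates each of the two constant lower bounds on \<open>L\<close>
    demanded by the locale.\<close>
  define c where "c = 2560 * real l + 4096 * real (l - 1) * 16 ^ (l - 2)"
  have lower: "1 - ?K / ln (real n) \<le> ?P n"
    if n1: "1 < n" and lg: "c \<le> ln (real n)" "256 * (ln (real n))\<^sup>2 \<le> real n powr g" and dv: "r n dvd n" for n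
  proof -
    define a L where "a = real n powr g" and "L = ln (real n)"
    define \<kappa> where "\<kappa> = 8 * L ^ 4 * a ^ (4 * h + 1)"
    define s where "s = nat \<lfloor>8 * L ^ 3 * a ^ (4 * h + 1)\<rfloor>"
    have L0: "0 < L" and a0: "0 < a" using n1 by (auto simp: L_def a_def)
    have pe: "edge_prob l n = 1 / (L * a ^ (4 * h + 1))"
      using edge_prob_eq[OF lh(1) n1] by (simp only: a_def L_def g_def)
    have pz: "part_size l n = a / L\<^sup>2" using part_size_eq[OF lh(1) n1] by (simp only: a_def L_def g_def)
    have big: "256 \<le> a / L\<^sup>2" using lg(2) L0 by (simp add: a_def L_def field_simps)
    have half: "a / (2 * L\<^sup>2) = (a / L\<^sup>2) / 2" "2 * a / L\<^sup>2 = 2 * (a / L\<^sup>2)" by simp_all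
    have near: "b / 2 \<le> x \<and> x \<le> 2 * b" if "\<bar>x - b\<bar> < 1" "256 \<le> b" for x b :: real
      using that by (simp add: abs_less_iff)
    have rr: "\<bar>real (r n) - a / L\<^sup>2\<bar> < 1" using assms(3)[of n] by (simp only: pz)
    interpret parameters a L "edge_prob l n" \<kappa> n l h "r n" s "nat \<lceil>\<kappa> / 2\<rceil>" "nat \<lfloor>(real s)\<^sup>2 / 4\<rfloor>"
    proof
      show "real n = a ^ (4 * h + 3)"
        using n1 by (simp add: a_def g_def powr_realpow[symmetric] powr_powr)
      show "a / (2 * L\<^sup>2) \<le> real (r n)" "real (r n) \<le> 2 * a / L\<^sup>2" unfolding half using near[OF rr big] by blast+
      have "0 \<le> 8 * L ^ 3 * a ^ (4 * h + 1)" using L0 a0 by simp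
      then show "8 * L ^ 3 * a ^ (4 * h + 1) - 1 \<le> real s" "real s \<le> 8 * L ^ 3 * a ^ (4 * h + 1)"
        unfolding s_def by linarith+
      have "0 < \<kappa>" using L0 a0 by (simp add: \<kappa>_def)
      then show "\<kappa> / 2 \<le> real (nat \<lceil>\<kappa> / 2\<rceil>)" "real (nat \<lceil>\<kappa> / 2\<rceil>) < \<kappa> / 2 + 1" by linarith+
      have "0 \<le> (real s)\<^sup>2 / 4" by simp
      then show "(real s)\<^sup>2 / 4 - 1 \<le> real (nat \<lfloor>(real s)\<^sup>2 / 4\<rfloor>)" "real (nat \<lfloor>(real s)\<^sup>2 / 4\<rfloor>) \<le> (real s)\<^sup>2 / 4" by linarith+
      have nn: "0 \<le> 2560 * real l" "0 \<le> 4096 * real (l - 1) * 16 ^ (l - 2)" by simp_all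
      show "2560 * real l \<le> L" "4096 * real (l - 1) * 16 ^ (l - 2) \<le> L"
        using lg(1) nn unfolding c_def L_def by linarith+
      show "256 * L\<^sup>2 \<le> a" using lg(2) by (simp only: L_def a_def)
    qed (use lh n1 dv pe in \<open>auto simp: L_def \<kappa>_def\<close>)
    have \<kappa>p: "8 / edge_prob l n * (ln (real n)) ^ 3 = \<kappa>"
      unfolding pe \<kappa>_def L_def[symmetric] by (simp add: eval_nat_numeral)
    have "1 - ?P n \<le> ?K / L" unfolding \<kappa>p by (rule failure_bound[OF refl assms(4,5)])
    then show ?thesis unfolding L_def by linarith
  qed
  show ?thesis
  proof (rule tendsto_sandwich)
    have "eventually (\<lambda>n. r n dvd n \<longrightarrow> 1 - ?K / ln (real n) \<le> ?P n) sequentially"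
      using eventually_large[OF g0, of c] eventually_gt_at_top[of 1]
    proof eventually_elim
      case (elim n)
      then show ?case using lower[of n] by blast
    qed
    then show "eventually (\<lambda>n. 1 - ?K / ln (real n) \<le> ?P n) ?F" by (simp add: eventually_inf_principal)
    show "eventually (\<lambda>n. ?P n \<le> 1) ?F" by (intro always_eventually allI measure_pmf.prob_le_1)
    have "((\<lambda>n. 1 - ?K / ln (real n)) \<longlongrightarrow> 1) sequentially" by real_asymp
    then show "((\<lambda>n. 1 - ?K / ln (real n)) \<longlongrightarrow> 1) ?F" by (rule tendsto_mono[OF inf_le1])
  qed simp
qed

end
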